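(* Let $I$ (items) and $Q$ (queries) be compact topological spaces, and let $R: I\times Q\to\mathbb{R}$ be a relevance function. Suppose that $I$ and $Q$ are equipped with the structure of a measure space, with probability measures $\mu_I$ and $\mu_Q$ respectively, and that the integral of $R^4(i,q)$ over $I\times Q$ (with respect to $\mu_I\times\mu_Q$) is finite. Then the regularized CUR approximation $\mathrm{CUR}_\lambda$ of $R$ (defined in the context) can be chosen arbitrarily close to the true $R$ in $L_2(I\times Q)=L_2(I\times Q,\mu_I\times\mu_Q)$, provided enough independently sampled support items (sampled from $\mu_I$) and support queries (sampled from $\mu_Q$) and sufficiently small $\lambda$.
   Context: Let $S_I=\{i_1,\ldots,i_N\}\subset I$ be a finite ordered set of support items and $S_Q=\{q_1,\ldots,q_m\}\subset Q$ a finite ordered set of support queries. For $i\in I$ and $q\in Q$ write $R(i,S_Q)=(R(i,q_1),\ldots,R(i,q_m))$ (a row vector in $\mathbb{R}^m$), $R(S_I,q)=(R(i_1,q),\ldots,R(i_N,q))\in\mathbb{R}^N$, and let $R(S_I,S_Q)$ be the $N\times m$ matrix with entries $R(i_a,q_b)$. For a real matrix $A$ and $\lambda>0$, the regularized pseudo-inverse is $$\mathrm{pinv}_\lambda(A)=(A^TA+\lambda E)^{-1}A^T,$$ where $E$ is the identity matrix of the appropriate size. The regularized CUR approximation $\mathrm{CUR}_\lambda$ of $R$ with support items $S_I$ and support queries $S_Q$ is the function on $I\times Q$ $$\tilde R(i,q)=\big\langle\, R(i,S_Q)\,\mathrm{pinv}_\lambda(R(S_I,S_Q)),\; R(S_I,q)\,\big\rangle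 ,$$ where $\langle\cdot,\cdot\rangle$ is the standard dot product on $\mathbb{R}^N$. *)

theory Defs
  imports
    "HOL-Probability.Probability"
    "Jordan_Normal_Form.Gauss_Jordan_Elimination"
begin

(* For l > 0 the matrix A^T A + l E is positive definite, so mat_inverse returns Some
   and "the" never falls through to an unspecified value. *)
definition pinv_reg :: "real \<Rightarrow> real mat \<Rightarrow> real mat" where
  "pinv_reg l A =
     the (mat_inverse (transpose_mat A * A + l \<cdot>\<^sub>m 1\<^sub>m (dim_col A))) * transpose_mat A"

(* The support items are s 0, ..., s (N - 1) and the support queries t 0, ..., t (m - 1),
   repetitions allowed.  A row vector times a matrix, u P, is written as P^T *_v u. *)
definition CUR_reg ::
    "real \<Rightarrow> ('i \<times> 'q \<Rightarrow> real) \<Rightarrow> nat \<Rightarrow> nat \<Rightarrow> (nat \<Rightarrow> 'i) \<Rightarrow> (nat \<Rightarrow> 'q) \<Rightarrow> 'i \<times> 'q \<Rightarrow> real" where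
  "CUR_reg l R N m s t = (\<lambda>(i, q).
     scalar_prod
       (transpose_mat (pinv_reg l (mat N m (\<lambda>(a, b). R (s a, t b)))) *\<^sub>v vec m (\<lambda>b. R (i, t b)))
       (vec N (\<lambda>a. R (s a, q))))"

definition L2_functions :: "'a measure \<Rightarrow> ('a \<Rightarrow> real) set" where
  "L2_functions M = {f \<in> borel_measurable M. integrable M (\<lambda>x. (f x)\<^sup>2)}"

definition L2_dist :: "'a measure \<Rightarrow> ('a \<Rightarrow> real) \<Rightarrow> ('a \<Rightarrow> real) \<Rightarrow> real" where
  "L2_dist M f g = sqrt (\<integral>x. (f x - g x)\<^sup>2 \<partial>M)"

(* The law of N items drawn from MI and m queries drawn from MQ, all N + m draws independent. *)
definition support_sample ::
    "'i measure \<Rightarrow> 'q measure \<Rightarrow> nat \<Rightarrow> nat \<Rightarrow> ((nat \<Rightarrow> 'i) \<times> (nat \<Rightarrow> 'q)) measure" where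
  "support_sample MI MQ N m =
     (\<Pi>\<^sub>M a\<in>{..<N}. MI) \<Otimes>\<^sub>M (\<Pi>\<^sub>M b\<in>{..<m}. MQ)"

(* L2_dist is a distance only between members of L2 (the integral of a non-integrable function
   is 0 by convention), hence the separate membership condition. *)
definition CUR_close_event ::
    "'i measure \<Rightarrow> 'q measure \<Rightarrow> ('i \<times> 'q \<Rightarrow> real) \<Rightarrow> real \<Rightarrow> nat \<Rightarrow> nat \<Rightarrow> real
      \<Rightarrow> ((nat \<Rightarrow> 'i) \<times> (nat \<Rightarrow> 'q)) set" where
  "CUR_close_event MI MQ R l N m \<epsilon> =
     {(s, t) \<in> space (support_sample MI MQ N m).
        CUR_reg l R N m s t \<in> L2_functions (MI \<Otimes>\<^sub>M MQ) \<and>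
        L2_dist (MI \<Otimes>\<^sub>M MQ) (CUR_reg l R N m s t) R < \<epsilon>}"

end

theory Submission
  imports Defs "Jordan_Normal_Form.Determinant"
begin

text \<open>
  Write the approximation as $\sum_b R(i, q_b) c_b(q)$. The vector $c(q)$ minimizes
  $\sum_a (R(i_a, q) - \sum_b R(i_a, q_b) c_b)^2 + \lambda |c|^2$, so it suffices to exhibit one good
  competitor $d(q)$ with bounded coordinates. Let $k$ be the kernel of the orthogonal projection of $L_2(Q)$
  onto the span of finitely many indicator functions chosen such that $\int k(q, q') R(i, q') dq'$ is close to
  $R(i, q)$, and take $d_b(q) = k(q, q_b) / m$: the variance of the Monte Carlo sum is $O(1/m)$, so for
  large $m$ the competitor is good with high probability over the queries.

  Now fix the queries. By Markov's inequality the competitor is also good in the empirical norm over the items,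
  hence so is $c(q)$ up to $\lambda |d(q)|^2 / N$, which is negligible for all $\lambda < 1$ simultaneously.
  On the finite-dimensional span of the functions $R(\cdot, q_b)$ the empirical norm dominates half of the true
  norm: apply Chebyshev's inequality to the products of an orthonormal basis, which are square integrable because
  $R^4$ is integrable. Using an orthonormal basis of the span, and not the Gram matrix of the $R(\cdot, q_b)$
  themselves, covers the case of a singular Gram matrix. Since the threshold for $N$ depends on the
  queries but not on $\lambda$, continuity of measure along $N$ yields a uniform threshold.

  The second order of quantifiers follows from the first by exchanging items and queries: the push-through
  identity makes the approximation invariant under transposition.
\<close>

section \<open>Regularized least squares\<close>

text \<open>The obstacle is that c(q) depends at once on the sampled items, on q and on \<lambda>,
  so no law of large numbers applies to it directly. The randomness of the items is therefore
  confined to two events that mention neither c nor \<lambda>: one speaks about all vectors of the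
  span simultaneously, the other only about the fixed competitor d. On their intersection the
  estimate is deterministic. The penalty \<lambda> |c|^2 is not multiplied by N while the data term
  is a sum of N squares. This is why it fades as N grows, without any relation between \<lambda> and
  N, as long as d stays bounded. Boundedness is also the reason for indicator functions: an
  orthonormal basis of their span consists of bounded functions. A second obstacle is uniformity in
  the uncountably many \<lambda>: an infimum over them need not be visibly measurable. It is avoided
  by picking, for each N, one \<lambda> that violates the claim whenever such a \<lambda> exists,
  and by treating only the resulting sequence of events.\<close>

lemma ridge_matrix_invertible:
  fixes A :: "real mat" and l :: real
  assumes A: "A \<in> carrier_mat N m" and l: "0 < l"
  defines "W \<equiv> transpose_mat A * A + l \<cdot>\<^sub>m 1\<^sub>m (dim_col A)"
  shows "det W \<noteq> 0"
    and "\<exists>B. mat_inverse W = Some B \<and> W * B = 1\<^sub>m m \<and> B * W = 1\<^sub>m m \<and> B \<in> carrier_mat m m"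
proof -
  have W: "W \<in> carrier_mat m m" using A by (auto simp: W_def)
  show det: "det W \<noteq> 0"
  proof
    assume "det W = 0"
    then obtain v where v: "v \<in> carrier_vec m" "v \<noteq> 0\<^sub>v m" "W *\<^sub>v v = 0\<^sub>v m"
      using det_0_iff_vec_prod_zero[OF W] by blast
    have Av: "A *\<^sub>v v \<in> carrier_vec N" using A v by auto
    have "W *\<^sub>v v = transpose_mat A *\<^sub>v (A *\<^sub>v v) + l \<cdot>\<^sub>v v"
      unfolding W_def using A v
      by (subst add_mult_distrib_mat_vec[of _ m m]) (auto simp: assoc_mult_mat_vec[of _ m N])
    then have "0 = v \<bullet> (transpose_mat A *\<^sub>v (A *\<^sub>v v) + l \<cdot>\<^sub>v v)"
      using v(1,3) by (metis scalar_prod_right_zero)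
    also have "\<dots> = v \<bullet> (transpose_mat A *\<^sub>v (A *\<^sub>v v)) + l * (v \<bullet> v)"
      using A v by (subst scalar_prod_add_distrib[of _ m]) auto
    also have "v \<bullet> (transpose_mat A *\<^sub>v (A *\<^sub>v v)) = (A *\<^sub>v v) \<bullet> (A *\<^sub>v v)"
      using transpose_vec_mult_scalar[OF A v(1) Av] comm_scalar_prod[OF v(1) mult_mat_vec_carrier[OF _ Av], of "transpose_mat A"] A
      by simp
    finally have "(A *\<^sub>v v) \<bullet> (A *\<^sub>v v) + l * (v \<bullet> v) = 0" by simp
    moreover have "0 \<le> (A *\<^sub>v v) \<bullet> (A *\<^sub>v v)" "0 \<le> v \<bullet> v"
      by (auto simp: scalar_prod_def intro!: sum_nonneg)
    moreover from this(2) l have "0 \<le> l * (v \<bullet> v)" by simp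
    ultimately have "l * (v \<bullet> v) = 0" by linarith
    with l have "v \<bullet> v = 0" by simp
    then have "\<forall>i<m. v $ i = 0" using v(1)
      by (auto simp: scalar_prod_def sum_nonneg_eq_0_iff)
    then show False using v(1,2) by auto
  qed
  from det have "W \<in> Units (ring_mat TYPE(real) m ())" by (rule det_non_zero_imp_unit[OF W])
  then have "mat_inverse W \<noteq> None" using mat_inverse(1)[OF W, of "()"] by blast
  then obtain B where B: "mat_inverse W = Some B" by blast
  from mat_inverse(2)[OF W B] B
  show "\<exists>B. mat_inverse W = Some B \<and> W * B = 1\<^sub>m m \<and> B * W = 1\<^sub>m m \<and> B \<in> carrier_mat m m"
    by simp
qed

text \<open>Later arguments use the pseudo-inverse through the linear equation that determines it.
  The uniqueness clause identifies other candidates with it: the transpose in the push-through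
  identity and the adjugate formula behind measurability.\<close>

lemma pinv_reg:
  fixes A :: "real mat" and l :: real
  assumes A: "A \<in> carrier_mat N m" and l: "0 < l"
  shows "pinv_reg l A \<in> carrier_mat m N"
    and "(transpose_mat A * A + l \<cdot>\<^sub>m 1\<^sub>m m) * pinv_reg l A = transpose_mat A"
    and "X \<in> carrier_mat m N \<Longrightarrow> (transpose_mat A * A + l \<cdot>\<^sub>m 1\<^sub>m m) * X = transpose_mat A
      \<Longrightarrow> X = pinv_reg l A"
proof -
  let ?W = "transpose_mat A * A + l \<cdot>\<^sub>m 1\<^sub>m m"
  have W: "?W \<in> carrier_mat m m" and dc: "dim_col A = m" and T: "transpose_mat A \<in> carrier_mat m N"
    using A by auto
  obtain B where B: "mat_inverse ?W = Some B" "?W * B = 1\<^sub>m m" "B * ?W = 1\<^sub>m m" "B \<in> carrier_mat m m"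
    using ridge_matrix_invertible(2)[OF A l] unfolding dc by blast
  have P: "pinv_reg l A = B * transpose_mat A" using B(1) by (simp add: pinv_reg_def dc)
  show "pinv_reg l A \<in> carrier_mat m N" using P B(4) T by auto
  have "?W * (B * transpose_mat A) = (?W * B) * transpose_mat A"
    by (rule assoc_mult_mat[OF W B(4) T, symmetric])
  then show "?W * pinv_reg l A = transpose_mat A" using B(2) T P by simp
  assume X: "X \<in> carrier_mat m N" "?W * X = transpose_mat A"
  have "B * (?W * X) = (B * ?W) * X" by (rule assoc_mult_mat[OF B(4) W X(1), symmetric])
  then show "X = pinv_reg l A" using B(3) X P by simp
qed

text \<open>The push-through identity $A^T (A A^T + \lambda E)^{-1} = (A^T A + \lambda E)^{-1} A^T$.\<close>

lemma pinv_reg_transpose: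
  fixes A :: "real mat" and l :: real
  assumes A: "A \<in> carrier_mat N m" and l: "0 < l"
  shows "pinv_reg l (transpose_mat A) = transpose_mat (pinv_reg l A)"
proof -
  define P where "P = pinv_reg l A"
  have T: "transpose_mat A \<in> carrier_mat m N" using A by auto
  define Y where "Y = pinv_reg l (transpose_mat A)"
  have Y: "Y \<in> carrier_mat N m" and eqY: "(A * transpose_mat A + l \<cdot>\<^sub>m 1\<^sub>m N) * Y = A"
    using pinv_reg(1,2)[OF T l] by (simp_all add: Y_def)
  have YT: "transpose_mat Y \<in> carrier_mat m N" using Y by auto
  have V0: "A * transpose_mat A + l \<cdot>\<^sub>m 1\<^sub>m N \<in> carrier_mat N N" using A by auto
  have eqT: "transpose_mat Y * (A * transpose_mat A + l \<cdot>\<^sub>m 1\<^sub>m N) = transpose_mat A"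
  proof -
    have "transpose_mat (A * transpose_mat A + l \<cdot>\<^sub>m 1\<^sub>m N) = A * transpose_mat A + l \<cdot>\<^sub>m 1\<^sub>m N"
    proof (rule eq_matI)
      fix i j assume "i < dim_row (A * transpose_mat A + l \<cdot>\<^sub>m 1\<^sub>m N)"
        "j < dim_col (A * transpose_mat A + l \<cdot>\<^sub>m 1\<^sub>m N)"
      then have ij: "i < N" "j < N" using A by simp_all
      have "scalar_prod (row A j) (row A i) = scalar_prod (row A i) (row A j)"
        by (rule comm_scalar_prod[of _ m]) (use A ij in \<open>auto simp: carrier_vecI\<close>)
      then show "transpose_mat (A * transpose_mat A + l \<cdot>\<^sub>m 1\<^sub>m N) $$ (i, j)
          = (A * transpose_mat A + l \<cdot>\<^sub>m 1\<^sub>m N) $$ (i, j)"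
        using A ij by simp
    qed (use A in simp_all)
    then show ?thesis using transpose_mult[OF V0 Y] eqY by simp
  qed
  have AT: "A * transpose_mat A \<in> carrier_mat N N" "transpose_mat A * A \<in> carrier_mat m m" using A by auto
  have E1: "(transpose_mat A * A + l \<cdot>\<^sub>m 1\<^sub>m m) * transpose_mat A
      = transpose_mat A * (A * transpose_mat A + l \<cdot>\<^sub>m 1\<^sub>m N)" (is "?W * _ = _ * ?V")
  proof -
    have "?W * transpose_mat A = transpose_mat A * A * transpose_mat A + l \<cdot>\<^sub>m 1\<^sub>m m * transpose_mat A"
      by (rule add_mult_distrib_mat[OF AT(2) _ T]) simp
    moreover have "transpose_mat A * ?V
        = transpose_mat A * (A * transpose_mat A) + transpose_mat A * (l \<cdot>\<^sub>m 1\<^sub>m N)"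
      by (rule mult_add_distrib_mat[OF T AT(1)]) simp
    moreover have "l \<cdot>\<^sub>m 1\<^sub>m m * transpose_mat A = transpose_mat A * (l \<cdot>\<^sub>m 1\<^sub>m N)"
      unfolding mult_smult_assoc_mat[OF one_carrier_mat T] mult_smult_distrib[OF T one_carrier_mat]
        left_mult_one_mat[OF T] right_mult_one_mat[OF T] ..
    ultimately show ?thesis using assoc_mult_mat[OF T A T] by simp
  qed
  obtain C where C: "?V * C = 1\<^sub>m N" "C \<in> carrier_mat N N"
    using ridge_matrix_invertible(2)[OF T l] A by auto
  have W: "?W \<in> carrier_mat m m" and V: "?V \<in> carrier_mat N N" using AT by auto
  have WY: "?W * transpose_mat Y \<in> carrier_mat m N" by (rule mult_carrier_mat[OF W YT])
  \<comment> \<open>The goal is W Y^T = A^T. It holds after right multiplication by V, since W Y^T V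
    = W A^T = A^T V by \<open>eqT\<close> and \<open>E1\<close>; the right inverse \<open>C\<close>
    then cancels V.\<close>
  have "?W * transpose_mat Y = ?W * transpose_mat Y * (?V * C)"
    unfolding C(1) by (rule right_mult_one_mat[OF WY, symmetric])
  also have "\<dots> = ?W * transpose_mat Y * ?V * C" by (rule assoc_mult_mat[OF WY V C(2), symmetric])
  also have "?W * transpose_mat Y * ?V = ?W * (transpose_mat Y * ?V)" by (rule assoc_mult_mat[OF W YT V])
  also have "\<dots> = transpose_mat A * ?V" unfolding eqT by (rule E1)
  also have "transpose_mat A * ?V * C = transpose_mat A * (?V * C)" by (rule assoc_mult_mat[OF T V C(2)])
  also have "\<dots> = transpose_mat A" unfolding C(1) by (rule right_mult_one_mat[OF T])
  finally have "transpose_mat Y = P" unfolding P_def by (rule pinv_reg(3)[OF A l YT])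
  then have "transpose_mat (transpose_mat Y) = transpose_mat P" by (rule arg_cong)
  then show ?thesis by (simp add: Y_def P_def)
qed

text \<open>The map from the data R(S_I, q) to the coefficients c(q) is linear. Its matrix depends
  on the supports and on l only, not on the point (i, q), and is recorded entrywise so that the
  estimates can be carried out with finite sums.\<close>

definition ridge_coeff ::
    "real \<Rightarrow> ('i \<times> 'q \<Rightarrow> real) \<Rightarrow> nat \<Rightarrow> nat \<Rightarrow> (nat \<Rightarrow> 'i) \<Rightarrow> (nat \<Rightarrow> 'q) \<Rightarrow> nat \<Rightarrow> nat \<Rightarrow> real" where
  "ridge_coeff l R N m s t b a = pinv_reg l (mat N m (\<lambda>(a, b). R (s a, t b))) $$ (b, a)"

lemma CUR_reg_eq_sum:
  assumes "0 < l"
  shows "CUR_reg l R N m s t (i, q) =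
    (\<Sum>b<m. R (i, t b) * (\<Sum>a<N. ridge_coeff l R N m s t b a * R (s a, q)))"
proof -
  define P where "P = pinv_reg l (mat N m (\<lambda>(a, b). R (s a, t b)))"
  have P: "P \<in> carrier_mat m N" unfolding P_def by (rule pinv_reg(1)[OF _ assms]) simp
  have "CUR_reg l R N m s t (i, q) = (\<Sum>a<N. (\<Sum>b<m. P $$ (b, a) * R (i, t b)) * R (s a, q))"
    unfolding CUR_reg_def P_def[symmetric] using P
    by (auto simp: scalar_prod_def mult_mat_vec_def lessThan_atLeast0 intro!: sum.cong)
  also have "\<dots> = (\<Sum>b<m. R (i, t b) * (\<Sum>a<N. P $$ (b, a) * R (s a, q)))"
    unfolding sum_distrib_left sum_distrib_right by (subst sum.swap) (simp add: ac_simps)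
  finally show ?thesis by (simp add: ridge_coeff_def P_def)
qed

lemma CUR_reg_swap:
  assumes "0 < l"
  shows "CUR_reg l R N m s t (i, q) = CUR_reg l (R \<circ> prod.swap) m N t s (q, i)"
proof -
  define A where "A = mat N m (\<lambda>(a, b). R (s a, t b))"
  have A: "A \<in> carrier_mat N m" by (simp add: A_def)
  have AT: "transpose_mat A = mat m N (\<lambda>(b, a). (R \<circ> prod.swap) (t b, s a))"
    by (auto simp: A_def)
  have *: "ridge_coeff l (R \<circ> prod.swap) m N t s a b = ridge_coeff l R N m s t b a" if "a < N" "b < m" for a b
    unfolding ridge_coeff_def AT[symmetric] A_def[symmetric] pinv_reg_transpose[OF A assms]
    using pinv_reg(1)[OF A assms] that by auto
  show ?thesis unfolding CUR_reg_eq_sum[OF assms] sum_distrib_left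
    by (subst sum.swap) (auto simp: * ac_simps intro!: sum.cong)
qed

text \<open>This is entry (b, a) of (A^T A + l E) P = A^T. Multiplied by R(s a, q) and summed over
  a, it becomes the normal equation of the ridge problem with data R(s a, q).\<close>

lemma ridge_coeff_normal_eq:
  assumes "0 < l" "a < N" "b < m"
  shows "(\<Sum>a'<N. R (s a', t b) * (\<Sum>b'<m. R (s a', t b') * ridge_coeff l R N m s t b' a))
    + l * ridge_coeff l R N m s t b a = R (s a, t b)"
proof -
  define A where "A = mat N m (\<lambda>(a, b). R (s a, t b))"
  define P where "P = pinv_reg l A"
  have A: "A \<in> carrier_mat N m" by (simp add: A_def)
  have P: "P \<in> carrier_mat m N"
    and eq: "(transpose_mat A * A + l \<cdot>\<^sub>m 1\<^sub>m m) * P = transpose_mat A"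
    using pinv_reg(1,2)[OF A assms(1)] by (simp_all add: P_def)
  have "(transpose_mat A * A + l \<cdot>\<^sub>m 1\<^sub>m m) * P = transpose_mat A * A * P + l \<cdot>\<^sub>m P"
    using A P by (simp add: add_mult_distrib_mat[of _ m m] mult_smult_assoc_mat[of _ m m])
  then have "(transpose_mat A * A * P + l \<cdot>\<^sub>m P) $$ (b, a) = transpose_mat A $$ (b, a)"
    using eq by simp
  then show ?thesis using A P assms
    by (simp add: scalar_prod_def ridge_coeff_def A_def[symmetric] P_def[symmetric] lessThan_atLeast0)
      (simp add: A_def)
qed

text \<open>Completing the square: with u the residual at c and w the change of the fit from c to d,
  the normal equations turn the cross term into -l <c, d - c>. The objective at d then equals |u|^2
  + |w|^2 + l (|d - c|^2 + |c|^2), and everything but |u|^2 is nonnegative.\<close>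

lemma ridge_minimizer:
  fixes g :: "nat \<Rightarrow> nat \<Rightarrow> real" and r c :: "nat \<Rightarrow> real"
  assumes normal: "\<And>b. b < m \<Longrightarrow> (\<Sum>a<N. g b a * ((\<Sum>b'<m. g b' a * c b') - r a)) + l * c b = 0"
    and "0 \<le> l"
  shows "(\<Sum>a<N. ((\<Sum>b<m. g b a * c b) - r a)\<^sup>2)
    \<le> (\<Sum>a<N. ((\<Sum>b<m. g b a * d b) - r a)\<^sup>2) + l * (\<Sum>b<m. (d b)\<^sup>2)"
proof -
  define u where "u a = (\<Sum>b<m. g b a * c b) - r a" for a
  define w where "w a = (\<Sum>b<m. g b a * (d b - c b))" for a
  have uw: "(\<Sum>b<m. g b a * d b) - r a = u a + w a" for a
    by (simp add: u_def w_def right_diff_distrib sum_subtractf)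
  have cross: "(\<Sum>a<N. u a * w a) = - l * (\<Sum>b<m. c b * (d b - c b))"
  proof -
    have "(\<Sum>a<N. u a * w a) = (\<Sum>b<m. (\<Sum>a<N. g b a * u a) * (d b - c b))"
      unfolding w_def sum_distrib_left sum_distrib_right by (subst sum.swap) (simp add: ac_simps)
    also have "\<dots> = (\<Sum>b<m. - l * c b * (d b - c b))"
    proof (rule sum.cong[OF refl])
      fix b assume "b \<in> {..<m}"
      then have "(\<Sum>a<N. g b a * u a) = - l * c b" using normal[of b] by (simp add: u_def)
      then show "(\<Sum>a<N. g b a * u a) * (d b - c b) = - l * c b * (d b - c b)" by simp
    qed
    finally show ?thesis by (simp add: sum_distrib_left mult.assoc)
  qed
  have "(\<Sum>a<N. (u a + w a)\<^sup>2) + l * (\<Sum>b<m. (d b)\<^sup>2)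
      = (\<Sum>a<N. (u a)\<^sup>2) + 2 * (\<Sum>a<N. u a * w a) + (\<Sum>a<N. (w a)\<^sup>2) + l * (\<Sum>b<m. (d b)\<^sup>2)"
    by (simp add: power2_sum sum.distrib sum_distrib_left ac_simps)
  also have "\<dots> = (\<Sum>a<N. (u a)\<^sup>2) + (\<Sum>a<N. (w a)\<^sup>2) + l * (\<Sum>b<m. (d b)\<^sup>2 - 2 * (c b * (d b - c b)))"
    unfolding cross by (simp add: sum_subtractf sum_distrib_left right_diff_distrib sum.distrib sum_negf ac_simps)
  also have "(\<Sum>b<m. (d b)\<^sup>2 - 2 * (c b * (d b - c b))) = (\<Sum>b<m. (d b - c b)\<^sup>2 + (c b)\<^sup>2)"
    by (intro sum.cong refl) (simp add: power2_eq_square algebra_simps)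
  finally have "(\<Sum>a<N. (u a + w a)\<^sup>2) + l * (\<Sum>b<m. (d b)\<^sup>2)
      = (\<Sum>a<N. (u a)\<^sup>2) + (\<Sum>a<N. (w a)\<^sup>2) + l * (\<Sum>b<m. (d b - c b)\<^sup>2 + (c b)\<^sup>2)" .
  moreover have "0 \<le> (\<Sum>a<N. (w a)\<^sup>2)" by (simp add: sum_nonneg)
  moreover have "0 \<le> l * (\<Sum>b<m. (d b - c b)\<^sup>2 + (c b)\<^sup>2)" using \<open>0 \<le> l\<close> by (simp add: sum_nonneg)
  ultimately show ?thesis unfolding uw by (simp add: u_def)
qed

text \<open>The coefficients of the regularized CUR approximation solve a ridge regression problem on the support items.\<close>

lemma ridge_coeff_optimal:
  fixes R :: "'i \<times> 'q \<Rightarrow> real" and d :: "nat \<Rightarrow> real" and N m :: nat and s t and l :: real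
  assumes "0 < l"
  defines "c \<equiv> \<lambda>q b. \<Sum>a<N. ridge_coeff l R N m s t b a * R (s a, q)"
  shows "(\<Sum>a<N. ((\<Sum>b<m. R (s a, t b) * c q b) - R (s a, q))\<^sup>2)
    \<le> (\<Sum>a<N. ((\<Sum>b<m. R (s a, t b) * d b) - R (s a, q))\<^sup>2) + l * (\<Sum>b<m. (d b)\<^sup>2)"
proof (rule ridge_minimizer)
  fix b assume b: "b < m"
  have "(\<Sum>a<N. R (s a, t b) * (\<Sum>b'<m. R (s a, t b') * c q b')) + l * c q b
      = (\<Sum>a<N. ((\<Sum>a'<N. R (s a', t b) * (\<Sum>b'<m. R (s a', t b') * ridge_coeff l R N m s t b' a))
         + l * ridge_coeff l R N m s t b a) * R (s a, q))" (is "?A + _ = _")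
  proof -
    have "?A = (\<Sum>a'<N. \<Sum>b'<m. \<Sum>a<N. R (s a', t b) * R (s a', t b') * ridge_coeff l R N m s t b' a * R (s a, q))"
      by (simp add: c_def sum_distrib_left ac_simps)
    also have "\<dots> = (\<Sum>a'<N. \<Sum>a<N. \<Sum>b'<m. R (s a', t b) * R (s a', t b') * ridge_coeff l R N m s t b' a * R (s a, q))"
      by (rule sum.cong[OF refl], rule sum.swap)
    also have "\<dots> = (\<Sum>a<N. \<Sum>a'<N. \<Sum>b'<m. R (s a', t b) * R (s a', t b') * ridge_coeff l R N m s t b' a * R (s a, q))"
      by (rule sum.swap)
    finally have "?A = \<dots>" .
    then show ?thesis
      by (simp add: c_def sum_distrib_left sum_distrib_right sum.distrib distrib_left distrib_right ac_simps)
  qed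
  also have "\<dots> = (\<Sum>a<N. R (s a, t b) * R (s a, q))"
    using ridge_coeff_normal_eq[OF \<open>0 < l\<close> _ b, of _ N R s t] by simp
  finally show "(\<Sum>a<N. R (s a, t b) * ((\<Sum>b'<m. R (s a, t b') * c q b') - R (s a, q))) + l * c q b = 0"
    by (simp add: right_diff_distrib sum_subtractf)
qed (use \<open>0 < l\<close> in simp)

section \<open>Measurable dependence of the ridge coefficients on the supports\<close>

lemma borel_measurable_det:
  fixes F :: "'a \<Rightarrow> real mat"
  assumes F: "\<And>x. F x \<in> carrier_mat n n"
    and meas: "\<And>i j. i < n \<Longrightarrow> j < n \<Longrightarrow> (\<lambda>x. F x $$ (i, j)) \<in> borel_measurable M"
  shows "(\<lambda>x. det (F x)) \<in> borel_measurable M"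
  unfolding det_def'[OF F]
proof (intro borel_measurable_sum borel_measurable_times borel_measurable_const borel_measurable_prod)
  fix p i assume "p \<in> {p. p permutes {0..<n}}" "i \<in> {0..<n}"
  then have "p i < n" "i < n" using permutes_in_image[of p "{0..<n}" i] by auto
  then show "(\<lambda>x. F x $$ (i, p i)) \<in> borel_measurable M" by (intro meas)
qed

text \<open>Up to sign, entry (i, j) of the adjugate is the minor with row j and column i deleted;
  its entries are entries of the given matrix with shifted indices.\<close>

lemma borel_measurable_adj_mat:
  fixes F :: "'a \<Rightarrow> real mat"
  assumes F: "\<And>x. F x \<in> carrier_mat n n"
    and meas: "\<And>i j. i < n \<Longrightarrow> j < n \<Longrightarrow> (\<lambda>x. F x $$ (i, j)) \<in> borel_measurable M"
    and ij: "i < n" "j < n"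
  shows "(\<lambda>x. adj_mat (F x) $$ (i, j)) \<in> borel_measurable M"
proof -
  have eq: "adj_mat (F x) $$ (i, j) = (- 1) ^ (j + i) * det (mat_delete (F x) j i)" for x
    using F[of x] ij by (simp add: adj_mat_def cofactor_def)
  have "(\<lambda>x. det (mat_delete (F x) j i)) \<in> borel_measurable M"
  proof (rule borel_measurable_det)
    show "mat_delete (F x) j i \<in> carrier_mat (n - 1) (n - 1)" for x
      using F[of x] by (simp add: mat_delete_def)
    fix a b assume ab: "a < n - 1" "b < n - 1"
    then have "mat_delete (F x) j i $$ (a, b)
        = F x $$ (if a < j then a else Suc a, if b < i then b else Suc b)" for x
      using F[of x] by (simp add: mat_delete_def)
    then show "(\<lambda>x. mat_delete (F x) j i $$ (a, b)) \<in> borel_measurable M"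
      using ab meas by simp
  qed
  then show ?thesis unfolding eq by simp
qed

text \<open>Cramer's rule writes the pseudo-inverse as adj(W) A^T / det W, a rational function of
  the entries of A whose denominator never vanishes. The elimination behind
  \<open>mat_inverse\<close> branches on pivots and does not display this regularity. The parameter
  x will stand for the sampled supports together with the point of evaluation.\<close>

lemma borel_measurable_ridge_coeff:
  fixes R :: "'i \<times> 'q \<Rightarrow> real" and s :: "'a \<Rightarrow> nat \<Rightarrow> 'i" and t :: "'a \<Rightarrow> nat \<Rightarrow> 'q"
  assumes l: "0 < l" and ab: "a < N" "b < m"
    and meas: "\<And>a b. a < N \<Longrightarrow> b < m \<Longrightarrow> (\<lambda>x. R (s x a, t x b)) \<in> borel_measurable M"
  shows "(\<lambda>x. ridge_coeff l R N m (s x) (t x) b a) \<in> borel_measurable M"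
proof -
  define A where "A x = mat N m (\<lambda>(a, b). R (s x a, t x b))" for x
  define W where "W x = transpose_mat (A x) * A x + l \<cdot>\<^sub>m 1\<^sub>m m" for x
  have A: "A x \<in> carrier_mat N m" and T: "transpose_mat (A x) \<in> carrier_mat m N" for x
    by (simp_all add: A_def)
  have W: "W x \<in> carrier_mat m m" for x using A[of x] by (simp add: W_def)
  have adj: "adj_mat (W x) \<in> carrier_mat m m" for x by (rule adj_mat(1)[OF W])
  have det: "det (W x) \<noteq> 0" for x
    using ridge_matrix_invertible(1)[OF A l, of x] A[of x] by (simp add: W_def)
  have P: "pinv_reg l (A x) = (1 / det (W x)) \<cdot>\<^sub>m (adj_mat (W x) * transpose_mat (A x))" for x
  proof (rule pinv_reg(3)[OF A l, symmetric])
    have AT: "adj_mat (W x) * transpose_mat (A x) \<in> carrier_mat m N" using adj T by (rule mult_carrier_mat)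
    then show "(1 / det (W x)) \<cdot>\<^sub>m (adj_mat (W x) * transpose_mat (A x)) \<in> carrier_mat m N" by simp
    have "W x * ((1 / det (W x)) \<cdot>\<^sub>m (adj_mat (W x) * transpose_mat (A x)))
        = (1 / det (W x)) \<cdot>\<^sub>m (W x * adj_mat (W x) * transpose_mat (A x))"
      unfolding mult_smult_distrib[OF W AT] assoc_mult_mat[OF W adj T] ..
    also have "W x * adj_mat (W x) * transpose_mat (A x) = det (W x) \<cdot>\<^sub>m transpose_mat (A x)"
      unfolding adj_mat(2)[OF W] mult_smult_assoc_mat[OF one_carrier_mat T] left_mult_one_mat[OF T] ..
    also have "(1 / det (W x)) \<cdot>\<^sub>m (det (W x) \<cdot>\<^sub>m transpose_mat (A x)) = transpose_mat (A x)"
      using det[of x] by (intro eq_matI) auto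
    finally show "(transpose_mat (A x) * A x + l \<cdot>\<^sub>m 1\<^sub>m m)
        * ((1 / det (W x)) \<cdot>\<^sub>m (adj_mat (W x) * transpose_mat (A x))) = transpose_mat (A x)"
      unfolding W_def .
  qed
  have W_meas: "(\<lambda>x. W x $$ (i, j)) \<in> borel_measurable M" if "i < m" "j < m" for i j
  proof -
    have "W x $$ (i, j) = (\<Sum>a<N. R (s x a, t x i) * R (s x a, t x j)) + l * (if i = j then 1 else 0)" for x
      using that by (simp add: W_def A_def scalar_prod_def lessThan_atLeast0)
    then show ?thesis using that
      by (auto intro!: borel_measurable_add borel_measurable_sum borel_measurable_times meas)
  qed
  have "ridge_coeff l R N m (s x) (t x) b a
      = (1 / det (W x)) * (\<Sum>k<m. adj_mat (W x) $$ (b, k) * R (s x a, t x k))" for x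
    unfolding ridge_coeff_def A_def[symmetric] P using adj[of x] A[of x] ab
    by (simp add: scalar_prod_def lessThan_atLeast0) (simp add: A_def)
  then show ?thesis
    using borel_measurable_det[OF W W_meas] borel_measurable_adj_mat[OF W W_meas ab(2)] meas[OF ab(1)]
    by (auto intro!: borel_measurable_times borel_measurable_divide borel_measurable_sum)
qed

section \<open>Square integrable functions\<close>

lemma L2_functionsD:
  assumes "f \<in> L2_functions M"
  shows "f \<in> borel_measurable M" "integrable M (\<lambda>x. (f x)\<^sup>2)"
  using assms by (auto simp: L2_functions_def)

lemma L2_functionsI:
  "f \<in> borel_measurable M \<Longrightarrow> integrable M (\<lambda>x. (f x)\<^sup>2) \<Longrightarrow> f \<in> L2_functions M"
  by (auto simp: L2_functions_def)

lemma L2_functions_iff_nn_integral: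
  assumes "f \<in> borel_measurable M"
  shows "f \<in> L2_functions M \<longleftrightarrow> (\<integral>\<^sup>+x. ennreal ((f x)\<^sup>2) \<partial>M) < \<infinity>"
  using assms by (simp add: L2_functions_def integrable_iff_bounded)

lemma L2_functions_integrable_mult:
  assumes "f \<in> L2_functions M" "g \<in> L2_functions M"
  shows "integrable M (\<lambda>x. f x * g x)"
proof (rule Bochner_Integration.integrable_bound)
  show "integrable M (\<lambda>x. (f x)\<^sup>2 + (g x)\<^sup>2)" using assms by (auto dest: L2_functionsD)
  show "(\<lambda>x. f x * g x) \<in> borel_measurable M"
    by (intro borel_measurable_times assms[THEN L2_functionsD(1)])
  show "AE x in M. norm (f x * g x) \<le> norm ((f x)\<^sup>2 + (g x)\<^sup>2)"
  proof (rule AE_I2)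
    fix x
    have "2 * (\<bar>f x\<bar> * \<bar>g x\<bar>) \<le> (f x)\<^sup>2 + (g x)\<^sup>2"
      using sum_squares_bound[of "\<bar>f x\<bar>" "\<bar>g x\<bar>"] by (simp add: mult.assoc)
    moreover have "0 \<le> \<bar>f x\<bar> * \<bar>g x\<bar>" by simp
    ultimately have "\<bar>f x\<bar> * \<bar>g x\<bar> \<le> (f x)\<^sup>2 + (g x)\<^sup>2" by linarith
    then show "norm (f x * g x) \<le> norm ((f x)\<^sup>2 + (g x)\<^sup>2)" by (simp add: abs_mult)
  qed
qed

lemma L2_functions_zero: "(\<lambda>x. 0) \<in> L2_functions M"
  by (simp add: L2_functions_def)

lemma L2_functions_cmult: "f \<in> L2_functions M \<Longrightarrow> (\<lambda>x. c * f x) \<in> L2_functions M"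
  by (auto simp: L2_functions_def power_mult_distrib)

lemma L2_functions_add:
  assumes "f \<in> L2_functions M" "g \<in> L2_functions M"
  shows "(\<lambda>x. f x + g x) \<in> L2_functions M"
  using assms L2_functions_integrable_mult[OF assms]
  by (auto simp: L2_functions_def power2_sum mult.assoc)

lemma L2_functions_diff:
  assumes "f \<in> L2_functions M" "g \<in> L2_functions M"
  shows "(\<lambda>x. f x - g x) \<in> L2_functions M"
  using L2_functions_add[OF assms(1) L2_functions_cmult[OF assms(2), of "-1"]] by simp

lemma L2_functions_sum:
  assumes "\<And>i. i \<in> A \<Longrightarrow> f i \<in> L2_functions M"
  shows "(\<lambda>x. \<Sum>i\<in>A. f i x) \<in> L2_functions M"
  using assms by (induction A rule: infinite_finite_induct)
    (auto simp: L2_functions_zero intro: L2_functions_add)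

lemma (in finite_measure) L2_functions_integrable:
  assumes "f \<in> L2_functions M"
  shows "integrable M f"
  using L2_functions_integrable_mult[OF assms, of "\<lambda>_. 1"] by (simp add: L2_functions_def)

lemma (in finite_measure) L2_functions_const: "(\<lambda>x. c) \<in> L2_functions M"
  by (simp add: L2_functions_def)

lemma integral_linear_combination:
  fixes F :: "'b \<Rightarrow> 'a \<Rightarrow> real"
  assumes "\<And>k. k \<in> A \<Longrightarrow> integrable M (F k)"
  shows "integrable M (\<lambda>x. \<Sum>k\<in>A. d k * F k x)"
    and "(\<integral>x. (\<Sum>k\<in>A. d k * F k x) \<partial>M) = (\<Sum>k\<in>A. d k * (\<integral>x. F k x \<partial>M))"
  using assms by (auto simp: Bochner_Integration.integral_sum)

section \<open>Orthonormal families and projections\<close>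

definition orthonormal_family :: "'a measure \<Rightarrow> nat \<Rightarrow> (nat \<Rightarrow> 'a \<Rightarrow> real) \<Rightarrow> bool" where
  "orthonormal_family M K e \<longleftrightarrow> (\<forall>k<K. e k \<in> L2_functions M) \<and>
     (\<forall>j<K. \<forall>k<K. (\<integral>x. e j x * e k x \<partial>M) = (if j = k then 1 else 0))"

lemma orthonormal_expansion:
  assumes e: "orthonormal_family M K e" and f: "f \<in> L2_functions M"
  shows "(\<integral>x. (f x - (\<Sum>k<K. d k * e k x))\<^sup>2 \<partial>M)
    = (\<integral>x. (f x)\<^sup>2 \<partial>M) - 2 * (\<Sum>k<K. d k * (\<integral>x. f x * e k x \<partial>M)) + (\<Sum>k<K. (d k)\<^sup>2)"
proof -
  have eL: "\<And>k. k < K \<Longrightarrow> e k \<in> L2_functions M"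
    and on: "\<And>j k. j < K \<Longrightarrow> k < K \<Longrightarrow> (\<integral>x. e j x * e k x \<partial>M) = (if j = k then 1 else 0)"
    using e by (auto simp: orthonormal_family_def)
  note int = L2_functionsD(2)[OF f] L2_functions_integrable_mult[OF f eL] L2_functions_integrable_mult[OF eL eL]
  have "(\<integral>x. (f x - (\<Sum>k<K. d k * e k x))\<^sup>2 \<partial>M) = (\<integral>x. (f x)\<^sup>2 - 2 * (\<Sum>k<K. d k * (f x * e k x))
      + (\<Sum>j<K. d j * (\<Sum>k<K. d k * (e j x * e k x))) \<partial>M)"
  proof (intro Bochner_Integration.integral_cong refl)
    fix x
    have 1: "f x * (\<Sum>k<K. d k * e k x) = (\<Sum>k<K. d k * (f x * e k x))"
      by (simp add: sum_distrib_left ac_simps)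
    have 2: "(\<Sum>k<K. d k * e k x)\<^sup>2 = (\<Sum>j<K. d j * (\<Sum>k<K. d k * (e j x * e k x)))"
      unfolding power2_eq_square sum_product by (simp add: sum_distrib_left ac_simps)
    show "(f x - (\<Sum>k<K. d k * e k x))\<^sup>2 = (f x)\<^sup>2 - 2 * (\<Sum>k<K. d k * (f x * e k x))
      + (\<Sum>j<K. d j * (\<Sum>k<K. d k * (e j x * e k x)))"
      unfolding power2_diff 2 mult.assoc 1 by simp
  qed
  also have "\<dots> = (\<integral>x. (f x)\<^sup>2 \<partial>M) - 2 * (\<Sum>k<K. d k * (\<integral>x. f x * e k x \<partial>M))
      + (\<Sum>j<K. d j * (\<Sum>k<K. d k * (\<integral>x. e j x * e k x \<partial>M)))"
    
  proof -
    have 1: "integrable M (\<lambda>x. \<Sum>k<K. d k * (f x * e k x))"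
      "(\<integral>x. (\<Sum>k<K. d k * (f x * e k x)) \<partial>M) = (\<Sum>k<K. d k * (\<integral>x. f x * e k x \<partial>M))"
      using int(2) by (auto intro!: integral_linear_combination)
    have 2: "integrable M (\<lambda>x. \<Sum>k<K. d k * (e j x * e k x))"
      "(\<integral>x. (\<Sum>k<K. d k * (e j x * e k x)) \<partial>M) = (\<Sum>k<K. d k * (\<integral>x. e j x * e k x \<partial>M))" if "j < K" for j
      using int(3)[OF that] by (auto intro!: integral_linear_combination)
    have 3: "integrable M (\<lambda>x. \<Sum>j<K. d j * (\<Sum>k<K. d k * (e j x * e k x)))"
      "(\<integral>x. (\<Sum>j<K. d j * (\<Sum>k<K. d k * (e j x * e k x))) \<partial>M)
        = (\<Sum>j<K. d j * (\<integral>x. (\<Sum>k<K. d k * (e j x * e k x)) \<partial>M))"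
      by (rule integral_linear_combination; simp add: 2(1))+
    show ?thesis using int(1) 1 3 2(2) by simp
  qed
  also have "(\<Sum>j<K. d j * (\<Sum>k<K. d k * (\<integral>x. e j x * e k x \<partial>M))) = (\<Sum>j<K. d j * (\<Sum>k<K. if k = j then d j else 0))"
    by (intro sum.cong refl arg_cong2[where f = "(*)"]) (auto simp: on)
  also have "\<dots> = (\<Sum>j<K. (d j)\<^sup>2)" by (intro sum.cong refl) (simp add: sum.delta power2_eq_square)
  finally show ?thesis .
qed

text \<open>By the expansion, the right side exceeds the left one by the sum of the squares (d k - c
  k)^2, where c lists the Fourier coefficients of f.\<close>

lemma orthonormal_best_approximation:
  assumes e: "orthonormal_family M K e" and f: "f \<in> L2_functions M"
  shows "(\<integral>x. (f x - (\<Sum>k<K. (\<integral>y. f y * e k y \<partial>M) * e k x))\<^sup>2 \<partial>M)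
    \<le> (\<integral>x. (f x - (\<Sum>k<K. d k * e k x))\<^sup>2 \<partial>M)"
proof -
  define c where "c k = (\<integral>y. f y * e k y \<partial>M)" for k
  have "0 \<le> (\<Sum>k<K. (d k - c k)\<^sup>2)" by (simp add: sum_nonneg)
  also have "\<dots> = (\<Sum>k<K. (d k)\<^sup>2) - 2 * (\<Sum>k<K. d k * c k) + (\<Sum>k<K. (c k)\<^sup>2)"
    by (simp add: power2_diff sum.distrib sum_subtractf sum_distrib_left ac_simps)
  finally show ?thesis
    unfolding orthonormal_expansion[OF e f] c_def[symmetric] by (simp add: power2_eq_square)
qed

lemma orthonormal_norm_sum:
  assumes "orthonormal_family M K e"
  shows "(\<integral>x. (\<Sum>k<K. d k * e k x)\<^sup>2 \<partial>M) = (\<Sum>k<K. (d k)\<^sup>2)"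
  using orthonormal_expansion[OF assms L2_functions_zero, of d] by simp

text \<open>The two span relations differ on purpose. The basis functions are combinations of the g
  b at every point, so boundedness and integrability of products pass from the g b to them. The g b
  are recovered only almost everywhere, because a residual of norm zero need not vanish everywhere.
  Linear dependence is allowed and merely makes K smaller than n.\<close>

lemma gram_schmidt:
  fixes n :: nat and g :: "nat \<Rightarrow> 'a \<Rightarrow> real"
  assumes "\<And>b. b < n \<Longrightarrow> g b \<in> L2_functions M"
  shows "\<exists>K e B. orthonormal_family M K e \<and> (\<forall>k<K. \<exists>c. e k = (\<lambda>x. \<Sum>b<n. c b * g b x)) \<and>
    (\<forall>b<n. AE x in M. g b x = (\<Sum>k<K. B b k * e k x))"
  using assms
proof (induction n)
  case 0
  show ?case by (rule exI[of _ 0]) (simp add: orthonormal_family_def)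
next
  case (Suc n)
  have "\<And>b. b < n \<Longrightarrow> g b \<in> L2_functions M" using Suc.prems by simp
  from Suc.IH[OF this] obtain K e B where e: "orthonormal_family M K e"
    and span: "\<And>k. k < K \<Longrightarrow> \<exists>c. e k = (\<lambda>x. \<Sum>b<n. c b * g b x)"
    and B: "\<And>b. b < n \<Longrightarrow> AE x in M. g b x = (\<Sum>k<K. B b k * e k x)"
    by blast
  have eL: "\<And>k. k < K \<Longrightarrow> e k \<in> L2_functions M"
    and on: "\<And>j k. j < K \<Longrightarrow> k < K \<Longrightarrow> (\<integral>x. e j x * e k x \<partial>M) = (if j = k then 1 else 0)"
    using e by (auto simp: orthonormal_family_def)
  have f: "g n \<in> L2_functions M" using Suc.prems by simp
  define d where "d k = (\<integral>x. g n x * e k x \<partial>M)" for k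
  define h where "h x = g n x - (\<Sum>k<K. d k * e k x)" for x
  have h: "h \<in> L2_functions M"
    unfolding h_def by (intro L2_functions_diff f L2_functions_sum L2_functions_cmult eL) simp
  have span': "\<exists>c. e k = (\<lambda>x. \<Sum>b<Suc n. c b * g b x)" if k: "k < K" for k
  proof -
    obtain c where "e k = (\<lambda>x. \<Sum>b<n. c b * g b x)" using span[OF k] by blast
    then have "e k = (\<lambda>x. \<Sum>b<Suc n. (c(n := 0)) b * g b x)" by (auto intro!: sum.cong)
    then show ?thesis by blast
  qed
  have span_h: "\<exists>c. h = (\<lambda>x. \<Sum>b<Suc n. c b * g b x)"
  proof -
    obtain c where c: "\<And>k. k < K \<Longrightarrow> e k = (\<lambda>x. \<Sum>b<n. c k b * g b x)" using span by metis
    define c' where "c' b = (if b = n then 1 else - (\<Sum>k<K. d k * c k b))" for b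
    have "h x = (\<Sum>b<Suc n. c' b * g b x)" for x
    proof -
      have "(\<Sum>k<K. d k * e k x) = (\<Sum>k<K. \<Sum>b<n. d k * c k b * g b x)"
        using c by (intro sum.cong refl) (simp add: sum_distrib_left mult.assoc)
      also have "\<dots> = (\<Sum>b<n. (\<Sum>k<K. d k * c k b) * g b x)"
        by (subst sum.swap) (simp add: sum_distrib_right)
      finally show ?thesis by (simp add: h_def c'_def sum_negf)
    qed
    then have "h = (\<lambda>x. \<Sum>b<Suc n. c' b * g b x)" by (rule ext)
    then show ?thesis by blast
  qed
  show ?case
  \<comment> \<open>If the residual has norm zero, then \<open>g n\<close> is dependent on its
    predecessors and the basis is kept; otherwise the normalized residual becomes the new basis
    function with index K.\<close>
  proof (cases "(\<integral>x. (h x)\<^sup>2 \<partial>M) = 0")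
    case True
    then have "AE x in M. (h x)\<^sup>2 = 0"
      using integral_nonneg_eq_0_iff_AE[OF L2_functionsD(2)[OF h]] by simp
    then have ae: "AE x in M. g n x = (\<Sum>k<K. d k * e k x)" by (auto simp: h_def)
    have "\<forall>b<Suc n. AE x in M. g b x = (\<Sum>k<K. (if b = n then d k else B b k) * e k x)"
    proof (intro allI impI)
      fix b assume "b < Suc n"
      then show "AE x in M. g b x = (\<Sum>k<K. (if b = n then d k else B b k) * e k x)"
        using ae B[of b] by (cases "b = n") simp_all
    qed
    with e span' show ?thesis
      by (intro exI[of _ K] exI[of _ e] exI[of _ "\<lambda>b k. if b = n then d k else B b k"] conjI) simp_all
  next
    case False
    define r where "r = sqrt (\<integral>x. (h x)\<^sup>2 \<partial>M)"
    have "0 < (\<integral>x. (h x)\<^sup>2 \<partial>M)" using False by (simp add: order_less_le)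
    then have r: "r > 0" "r\<^sup>2 = (\<integral>x. (h x)\<^sup>2 \<partial>M)" by (simp_all add: r_def)
    define e' where "e' = e(K := \<lambda>x. (1 / r) * h x)"
    have e'K: "e' K = (\<lambda>x. (1 / r) * h x)" and e'k: "k < K \<Longrightarrow> e' k = e k" for k by (auto simp: e'_def)
    have eL': "e' k \<in> L2_functions M" if "k < Suc K" for k
      using that eL L2_functions_cmult[OF h, of "1 / r"] by (auto simp: less_Suc_eq e'K e'k)
    have orth: "(\<integral>x. h x * e j x \<partial>M) = 0" if j: "j < K" for j
    proof -
      have "(\<integral>x. h x * e j x \<partial>M) = (\<integral>x. g n x * e j x - (\<Sum>k<K. d k * (e k x * e j x)) \<partial>M)"
        by (simp add: h_def left_diff_distrib sum_distrib_right mult.assoc)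
      also have "\<dots> = d j - (\<Sum>k<K. d k * (\<integral>x. e k x * e j x \<partial>M))"
      proof -
        have "integrable M (\<lambda>x. \<Sum>k<K. d k * (e k x * e j x))"
          "(\<integral>x. (\<Sum>k<K. d k * (e k x * e j x)) \<partial>M) = (\<Sum>k<K. d k * (\<integral>x. e k x * e j x \<partial>M))"
          using L2_functions_integrable_mult[OF eL eL] j by (auto intro!: integral_linear_combination)
        then show ?thesis using L2_functions_integrable_mult[OF f eL[OF j]] by (simp add: d_def)
      qed
      also have "(\<Sum>k<K. d k * (\<integral>x. e k x * e j x \<partial>M)) = (\<Sum>k<K. if k = j then d k else 0)"
        by (intro sum.cong refl) (simp add: on j)
      finally show ?thesis using j by simp
    qed
    have hh: "(\<integral>x. h x * h x \<partial>M) = r\<^sup>2" using r by (simp add: power2_eq_square)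
    have "orthonormal_family M (Suc K) e'"
      unfolding orthonormal_family_def
    proof (intro conjI allI impI)
      fix j k assume jk: "j < Suc K" "k < Suc K"
      show "(\<integral>x. e' j x * e' k x \<partial>M) = (if j = k then 1 else 0)"
      proof (cases "j = K"; cases "k = K")
        assume "j = K" "k = K"
        then have "(\<integral>x. e' j x * e' k x \<partial>M) = (\<integral>x. (1 / r\<^sup>2) * (h x * h x) \<partial>M)"
          by (simp add: e'K power2_eq_square)
        also have "\<dots> = 1" using hh r(1) by (simp only: integral_mult_right_zero) simp
        finally show ?thesis using \<open>j = K\<close> \<open>k = K\<close> by simp
      next
        assume "j = K" "k \<noteq> K"
        then show ?thesis using jk orth[of k] by (simp add: e'K e'k mult.assoc)
      next
        assume "j \<noteq> K" "k = K"
        then have "(\<integral>x. e' j x * e' k x \<partial>M) = (\<integral>x. (1 / r) * (h x * e j x) \<partial>M)"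
          using jk by (simp add: e'K e'k ac_simps)
        then show ?thesis using \<open>j \<noteq> K\<close> \<open>k = K\<close> jk orth[of j] by (simp only: integral_mult_right_zero) simp
      next
        assume "j \<noteq> K" "k \<noteq> K"
        then show ?thesis using jk on by (simp add: e'k)
      qed
    qed (rule eL')
    moreover have "\<exists>c. e' k = (\<lambda>x. \<Sum>b<Suc n. c b * g b x)" if k: "k < Suc K" for k
    proof (cases "k = K")
      case True
      obtain c where c: "h = (\<lambda>x. \<Sum>b<Suc n. c b * g b x)" using span_h by blast
      define c' where "c' b = 1 / r * c b" for b
      have "e' k = (\<lambda>x. \<Sum>b<Suc n. c' b * g b x)"
        unfolding True e'K c'_def by (subst c) (simp only: sum_distrib_left mult.assoc)
      then show ?thesis by blast
    next
      case False
      with k have "k < K" by simp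
      from span'[OF this] show ?thesis unfolding e'k[OF \<open>k < K\<close>] .
    qed
    moreover have "AE x in M. g b x = (\<Sum>k<Suc K. (if b = n then (if k = K then r else d k)
        else if k = K then 0 else B b k) * e' k x)" if b: "b < Suc n" for b
    proof (cases "b = n")
      case True
      \<comment> \<open>The residual is r times the new basis function, so in this case
        \<open>g n\<close> is recovered at every point.\<close>
      have "g n x = (\<Sum>k<Suc K. (if k = K then r else d k) * e' k x)" for x
      proof -
        have "(\<Sum>k<K. (if k = K then r else d k) * e' k x) = (\<Sum>k<K. d k * e k x)"
          by (intro sum.cong refl) (auto simp: e'k)
        then show ?thesis using r(1) by (simp add: e'K h_def)
      qed
      then show ?thesis using True by simp
    next
      case False
      have "(\<Sum>k<Suc K. (if k = K then 0 else B b k) * e' k x) = (\<Sum>k<K. B b k * e k x)" for x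
        by (auto simp: e'k intro!: sum.cong)
      then show ?thesis using False b B[of b] by simp
    qed
    ultimately show ?thesis
      by (intro exI[of _ "Suc K"] exI[of _ e'] conjI
          exI[of _ "\<lambda>b k. if b = n then (if k = K then r else d k) else if k = K then 0 else B b k"]) blast+
  qed
qed

section \<open>Averages of independent samples\<close>

context prob_space
begin

lemma component:
  assumes a: "a < (N::nat)"
  shows "distr (\<Pi>\<^sub>M a\<in>{..<N}. M) M (\<lambda>s. s a) = M"
  using a by (intro distr_PiM_component prob_space_axioms) simp

lemma nn_integral_component:
  assumes "a < (N::nat)" and f: "f \<in> borel_measurable M"
  shows "(\<integral>\<^sup>+s. f (s a) \<partial>(\<Pi>\<^sub>M a\<in>{..<N}. M)) = (\<integral>\<^sup>+x. f x \<partial>M)"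
proof -
  have "(\<integral>\<^sup>+x. f x \<partial>M) = (\<integral>\<^sup>+x. f x \<partial>distr (\<Pi>\<^sub>M a\<in>{..<N}. M) M (\<lambda>s. s a))"
    by (simp only: component[OF assms(1)])
  also have "\<dots> = (\<integral>\<^sup>+s. f (s a) \<partial>(\<Pi>\<^sub>M a\<in>{..<N}. M))"
    using assms by (intro nn_integral_distr) auto
  finally show ?thesis by simp
qed

lemma integral_component:
  fixes f :: "'a \<Rightarrow> real"
  assumes "a < (N::nat)" and f: "f \<in> borel_measurable M"
  shows "(\<integral>s. f (s a) \<partial>(\<Pi>\<^sub>M a\<in>{..<N}. M)) = (\<integral>x. f x \<partial>M)"
    and "integrable M f \<Longrightarrow> integrable (\<Pi>\<^sub>M a\<in>{..<N}. M) (\<lambda>s. f (s a))"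
proof -
  have meas: "(\<lambda>s. s a) \<in> (\<Pi>\<^sub>M a\<in>{..<N}. M) \<rightarrow>\<^sub>M M" using assms by simp
  have "(\<integral>x. f x \<partial>M) = (\<integral>x. f x \<partial>distr (\<Pi>\<^sub>M a\<in>{..<N}. M) M (\<lambda>s. s a))"
    by (simp only: component[OF assms(1)])
  also have "\<dots> = (\<integral>s. f (s a) \<partial>(\<Pi>\<^sub>M a\<in>{..<N}. M))"
    by (rule integral_distr[OF meas f])
  finally show "(\<integral>s. f (s a) \<partial>(\<Pi>\<^sub>M a\<in>{..<N}. M)) = (\<integral>x. f x \<partial>M)" by simp
  show "integrable (\<Pi>\<^sub>M a\<in>{..<N}. M) (\<lambda>s. f (s a))" if "integrable M f"
    using integrable_distr_eq[OF meas f] that by (simp only: component[OF assms(1)])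
qed

lemma L2_functions_component:
  "a < (N::nat) \<Longrightarrow> f \<in> L2_functions M \<Longrightarrow> (\<lambda>s. f (s a)) \<in> L2_functions (\<Pi>\<^sub>M a\<in>{..<N}. M)"
  using integral_component(2)[of a N "\<lambda>x. (f x)\<^sup>2"] by (auto simp: L2_functions_def)

text \<open>By independence each mixed product integrates to the product of two zero means, so only
  the N diagonal terms survive.\<close>

lemma integral_iid_sum_square:
  assumes Y: "Y \<in> L2_functions M" and mean: "(\<integral>x. Y x \<partial>M) = 0"
  shows "(\<integral>s. (\<Sum>a<N. Y (s a))\<^sup>2 \<partial>(\<Pi>\<^sub>M a\<in>{..<N}. M)) = real N * (\<integral>x. (Y x)\<^sup>2 \<partial>M)"
proof -
  let ?P = "\<Pi>\<^sub>M a\<in>{..<N}. M"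
  interpret P: product_prob_space "\<lambda>_. M" "{..<N}" ..
  have prod: "(\<integral>s. Y (s a) * Y (s b) \<partial>?P) = (if a = b then (\<integral>x. (Y x)\<^sup>2 \<partial>M) else 0)"
    if ab: "a < N" "b < N" for a b
  proof (cases "a = b")
    case True
    then show ?thesis using integral_component(1)[of a N "\<lambda>x. (Y x)\<^sup>2"] ab L2_functionsD[OF Y]
      by (simp add: power2_eq_square)
  next
    case False
    \<comment> \<open>The product formula concerns a factor for every coordinate, so the two
      relevant factors are padded with the constant 1.\<close>
    define f where "f i = (if i \<in> {a, b} then Y else (\<lambda>_. 1))" for i
    have "(\<Prod>i<N. f i (s i)) = Y (s a) * Y (s b)" for s
    proof -
      have "(\<Prod>i<N. f i (s i)) = (\<Prod>i\<in>{a, b}. Y (s i))"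
        using ab by (intro prod.mono_neutral_cong_right) (auto simp: f_def)
      then show ?thesis using False by simp
    qed
    then have "(\<integral>s. Y (s a) * Y (s b) \<partial>?P) = (\<integral>s. (\<Prod>i<N. f i (s i)) \<partial>?P)" by simp
    also have "\<dots> = (\<Prod>i<N. \<integral>x. f i x \<partial>M)"
      by (rule P.product_integral_prod) (auto simp: f_def L2_functions_integrable[OF Y])
    also have "\<dots> = 0" using ab mean by (intro prod_zero) (auto simp: f_def intro!: bexI[of _ a])
    finally show ?thesis using False by simp
  qed
  have int: "integrable ?P (\<lambda>s. Y (s a) * Y (s b))" if "a < N" "b < N" for a b
    by (intro L2_functions_integrable_mult L2_functions_component that Y)
  have "(\<integral>s. (\<Sum>a<N. Y (s a))\<^sup>2 \<partial>?P) = (\<integral>s. (\<Sum>a<N. \<Sum>b<N. Y (s a) * Y (s b)) \<partial>?P)"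
    by (simp add: power2_eq_square sum_product)
  also have "\<dots> = (\<Sum>a<N. \<Sum>b<N. \<integral>s. Y (s a) * Y (s b) \<partial>?P)"
  proof -
    have "(\<integral>s. (\<Sum>a<N. \<Sum>b<N. Y (s a) * Y (s b)) \<partial>?P) = (\<Sum>a<N. \<integral>s. (\<Sum>b<N. Y (s a) * Y (s b)) \<partial>?P)"
      by (intro Bochner_Integration.integral_sum Bochner_Integration.integrable_sum int) auto
    also have "\<dots> = (\<Sum>a<N. \<Sum>b<N. \<integral>s. Y (s a) * Y (s b) \<partial>?P)"
      by (intro sum.cong refl Bochner_Integration.integral_sum int) auto
    finally show ?thesis .
  qed
  also have "\<dots> = (\<Sum>a<N. \<Sum>b<N. if b = a then (\<integral>x. (Y x)\<^sup>2 \<partial>M) else 0)"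
    by (intro sum.cong refl) (auto simp: prod)
  finally show ?thesis by simp
qed

text \<open>Bias-variance decomposition about an arbitrary target r, with the variance bounded by
  the second moment. The left side is a nonnegative integral so that it can be inserted under
  Tonelli's theorem without integrability conditions.\<close>

lemma integral_iid_average_square:
  assumes X: "X \<in> L2_functions M" and m: "0 < m"
  shows "(\<integral>\<^sup>+t. ennreal (((\<Sum>b<m. X (t b)) / real m - r)\<^sup>2) \<partial>(\<Pi>\<^sub>M b\<in>{..<m}. M))
    \<le> ennreal (((\<integral>x. X x \<partial>M) - r)\<^sup>2 + (\<integral>x. (X x)\<^sup>2 \<partial>M) / real m)"
proof -
  let ?P = "\<Pi>\<^sub>M b\<in>{..<m}. M"
  interpret P: prob_space ?P by (intro prob_space_PiM prob_space_axioms)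
  define \<mu> where "\<mu> = (\<integral>x. X x \<partial>M)"
  define Y where "Y x = X x - \<mu>" for x
  have Y: "Y \<in> L2_functions M" unfolding Y_def by (intro L2_functions_diff X L2_functions_const)
  have mean: "(\<integral>x. Y x \<partial>M) = 0"
    using L2_functions_integrable[OF X] by (simp add: Y_def \<mu>_def prob_space)
  have var: "(\<integral>x. (Y x)\<^sup>2 \<partial>M) \<le> (\<integral>x. (X x)\<^sup>2 \<partial>M)"
  proof -
    have "(\<integral>x. (Y x)\<^sup>2 \<partial>M) = (\<integral>x. (X x)\<^sup>2 \<partial>M) - \<mu>\<^sup>2"
      unfolding Y_def \<mu>_def
      using variance_eq[OF L2_functions_integrable[OF X] L2_functionsD(2)[OF X]] by simp
    then show ?thesis by simp
  qed
  define S where "S t = (\<Sum>b<m. Y (t b))" for t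
  have S: "S \<in> L2_functions ?P" unfolding S_def
    by (intro L2_functions_sum L2_functions_component Y) simp
  have S0: "(\<integral>t. S t \<partial>?P) = 0"
    unfolding S_def using integral_component[OF _ L2_functionsD(1)[OF Y]] L2_functions_integrable[OF Y] mean
    by (simp add: Bochner_Integration.integral_sum)
  have S2: "(\<integral>t. (S t)\<^sup>2 \<partial>?P) = real m * (\<integral>x. (Y x)\<^sup>2 \<partial>M)"
    unfolding S_def by (rule integral_iid_sum_square[OF Y mean])
  have eq: "((\<Sum>b<m. X (t b)) / real m - r)\<^sup>2
      = (1 / (real m)\<^sup>2) * (S t)\<^sup>2 + (2 * (\<mu> - r) / real m) * S t + (\<mu> - r)\<^sup>2" for t
  proof -
    have e: "(\<Sum>b<m. X (t b)) / real m - r = S t / real m + (\<mu> - r)"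
      using m by (simp add: S_def Y_def sum_subtractf field_simps)
    show ?thesis unfolding e power2_sum power_divide by simp
  qed
  have "(\<integral>\<^sup>+t. ennreal (((\<Sum>b<m. X (t b)) / real m - r)\<^sup>2) \<partial>?P)
      = ennreal (\<integral>t. ((\<Sum>b<m. X (t b)) / real m - r)\<^sup>2 \<partial>?P)"
  proof (rule nn_integral_eq_integral)
    show "integrable ?P (\<lambda>t. ((\<Sum>b<m. X (t b)) / real m - r)\<^sup>2)"
      unfolding eq using L2_functionsD(2)[OF S] P.L2_functions_integrable[OF S] by simp
  qed simp
  also have "(\<integral>t. ((\<Sum>b<m. X (t b)) / real m - r)\<^sup>2 \<partial>?P)
      = (1 / (real m)\<^sup>2) * (real m * (\<integral>x. (Y x)\<^sup>2 \<partial>M)) + (\<mu> - r)\<^sup>2"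
    unfolding eq using L2_functionsD(2)[OF S] P.L2_functions_integrable[OF S] S0 S2
    by (simp add: P.prob_space)
  also have "\<dots> = (\<mu> - r)\<^sup>2 + (\<integral>x. (Y x)\<^sup>2 \<partial>M) / real m"
    using m by (simp add: power2_eq_square)
  also have "\<dots> \<le> (\<mu> - r)\<^sup>2 + (\<integral>x. (X x)\<^sup>2 \<partial>M) / real m"
    using var by (simp add: divide_right_mono)
  finally show ?thesis by (simp add: \<mu>_def ennreal_leI)
qed

text \<open>Chebyshev's inequality, obtained from Markov's inequality for the squared sum: its
  expectation grows like N and the threshold (N \<kappa>)^2 like N^2.\<close>

lemma prob_empirical_mean_le:
  assumes Y: "Y \<in> L2_functions M" and mean: "(\<integral>x. Y x \<partial>M) = 0" and "0 < \<kappa>" "0 < N"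
  shows "measure (\<Pi>\<^sub>M a\<in>{..<N}. M) {s \<in> space (\<Pi>\<^sub>M a\<in>{..<N}. M). \<kappa> \<le> \<bar>(\<Sum>a<N. Y (s a)) / real N\<bar>}
    \<le> (\<integral>x. (Y x)\<^sup>2 \<partial>M) / (real N * \<kappa>\<^sup>2)"
proof -
  let ?P = "\<Pi>\<^sub>M a\<in>{..<N}. M"
  interpret P: prob_space ?P by (intro prob_space_PiM prob_space_axioms)
  define S where "S s = (\<Sum>a<N. Y (s a))" for s
  have S: "S \<in> L2_functions ?P" unfolding S_def
    by (intro L2_functions_sum L2_functions_component Y) simp
  have "{s \<in> space ?P. \<kappa> \<le> \<bar>S s / real N\<bar>} = {s \<in> space ?P. (real N * \<kappa>)\<^sup>2 \<le> (S s)\<^sup>2}"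
  proof -
    have "\<kappa> \<le> \<bar>S s / real N\<bar> \<longleftrightarrow> (real N * \<kappa>)\<^sup>2 \<le> (S s)\<^sup>2" for s
      using assms(3,4) by (subst abs_le_square_iff[symmetric]) (simp add: field_simps abs_mult)
    then show ?thesis by simp
  qed
  moreover have "measure ?P {s \<in> space ?P. (real N * \<kappa>)\<^sup>2 \<le> (S s)\<^sup>2} \<le> (\<integral>s. (S s)\<^sup>2 \<partial>?P) / (real N * \<kappa>)\<^sup>2"
    using assms(3,4) L2_functionsD(2)[OF S] by (intro integral_Markov_inequality_measure[where A = "{}"]) auto
  moreover have "(\<integral>s. (S s)\<^sup>2 \<partial>?P) / (real N * \<kappa>)\<^sup>2 = (\<integral>x. (Y x)\<^sup>2 \<partial>M) / (real N * \<kappa>\<^sup>2)"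
    unfolding S_def integral_iid_sum_square[OF Y mean] using assms(3,4) by (simp add: power2_eq_square)
  ultimately show ?thesis by (simp add: S_def)
qed

end

section \<open>Approximation by rectangles and bounded kernels\<close>

lemma L2_functions_indicator:
  assumes "finite_measure M" "A \<in> sets M"
  shows "(indicator A :: 'a \<Rightarrow> real) \<in> L2_functions M"
proof -
  interpret finite_measure M by fact
  have "(indicator A x :: real)\<^sup>2 = indicator A x" for x by (simp add: indicator_def)
  then show ?thesis using assms(2) by (simp add: L2_functions_def integrable_real_indicator less_top[symmetric])
qed

text \<open>The squared difference is dominated by 9 f^2, the square of |f| + 2 |f|. The factor 2 in
  the hypothesis is the one with which simple functions approximate a measurable function further
  below; truncations of a disjoint union satisfy it as well.\<close>

lemma L2_dominated_approximation:
  assumes f: "f \<in> L2_functions M"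
    and s: "\<And>n. s n \<in> borel_measurable M"
    and lim: "\<And>x. x \<in> space M \<Longrightarrow> (\<lambda>n. s n x) \<longlonglongrightarrow> f x"
    and bound: "\<And>n x. x \<in> space M \<Longrightarrow> \<bar>s n x\<bar> \<le> 2 * \<bar>f x\<bar>"
  shows "(\<lambda>n. \<integral>x. (f x - s n x)\<^sup>2 \<partial>M) \<longlonglongrightarrow> 0"
proof -
  note fm = L2_functionsD[OF f]
  have "(\<lambda>n. \<integral>x. (f x - s n x)\<^sup>2 \<partial>M) \<longlonglongrightarrow> (\<integral>x. 0 \<partial>M)"
  proof (rule integral_dominated_convergence)
    show "integrable M (\<lambda>x. 9 * (f x)\<^sup>2)" using fm by simp
    show "(\<lambda>x. (f x - s n x)\<^sup>2) \<in> borel_measurable M" for n using fm s by measurable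
    show "AE x in M. (\<lambda>n. (f x - s n x)\<^sup>2) \<longlonglongrightarrow> 0"
    proof (rule AE_I2)
      fix x assume "x \<in> space M"
      then have "(\<lambda>n. (f x - s n x)\<^sup>2) \<longlonglongrightarrow> (f x - f x)\<^sup>2" by (intro tendsto_intros lim)
      then show "(\<lambda>n. (f x - s n x)\<^sup>2) \<longlonglongrightarrow> 0" by simp
    qed
    show "AE x in M. norm ((f x - s n x)\<^sup>2) \<le> 9 * (f x)\<^sup>2" for n
    proof (rule AE_I2)
      fix x assume "x \<in> space M"
      then have "\<bar>f x - s n x\<bar> \<le> \<bar>3 * f x\<bar>" using bound[of x n] by (simp add: abs_mult)
      then have "(f x - s n x)\<^sup>2 \<le> (3 * f x)\<^sup>2" by (simp only: abs_le_square_iff)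
      then show "norm ((f x - s n x)\<^sup>2) \<le> 9 * (f x)\<^sup>2" by (simp add: power_mult_distrib)
    qed
  qed simp
  then show "(\<lambda>n. \<integral>x. (f x - s n x)\<^sup>2 \<partial>M) \<longlonglongrightarrow> 0" by simp
qed

lemma integral_square_triangle:
  assumes "f \<in> L2_functions M" "g \<in> L2_functions M"
  shows "(\<integral>x. (f x + g x)\<^sup>2 \<partial>M) \<le> 2 * (\<integral>x. (f x)\<^sup>2 \<partial>M) + 2 * (\<integral>x. (g x)\<^sup>2 \<partial>M)"
proof -
  have "(\<integral>x. (f x + g x)\<^sup>2 \<partial>M) \<le> (\<integral>x. 2 * (f x)\<^sup>2 + 2 * (g x)\<^sup>2 \<partial>M)"
  proof (rule integral_mono)
    show "integrable M (\<lambda>x. (f x + g x)\<^sup>2)" using L2_functions_add[OF assms] by (rule L2_functionsD)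
    show "integrable M (\<lambda>x. 2 * (f x)\<^sup>2 + 2 * (g x)\<^sup>2)" using assms[THEN L2_functionsD(2)] by simp
    show "(f x + g x)\<^sup>2 \<le> 2 * (f x)\<^sup>2 + 2 * (g x)\<^sup>2" for x
      using sum_squares_bound[of "f x" "g x"] by (simp add: power2_sum)
  qed
  also have "\<dots> = 2 * (\<integral>x. (f x)\<^sup>2 \<partial>M) + 2 * (\<integral>x. (g x)\<^sup>2 \<partial>M)"
    using assms by (simp add: L2_functionsD)
  finally show ?thesis .
qed

text \<open>With lists, addition is concatenation, rectangles may overlap or repeat, and the
  positions number the second factors, which is the form that Gram-Schmidt expects.\<close>

definition rect_sum :: "(real \<times> 'a set \<times> 'b set) list \<Rightarrow> 'a \<times> 'b \<Rightarrow> real" where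
  "rect_sum rs z = (\<Sum>(c, A, B)\<leftarrow>rs. c * indicator A (fst z) * indicator B (snd z))"

definition rect_list :: "'a measure \<Rightarrow> 'b measure \<Rightarrow> (real \<times> 'a set \<times> 'b set) list \<Rightarrow> bool" where
  "rect_list M N rs \<longleftrightarrow> (\<forall>(c, A, B)\<in>set rs. A \<in> sets M \<and> B \<in> sets N)"

text \<open>This is the L2 closure of the linear span of the measurable rectangles, expressed by
  squared distances.\<close>

definition rect_approximable :: "'a measure \<Rightarrow> 'b measure \<Rightarrow> ('a \<times> 'b \<Rightarrow> real) \<Rightarrow> bool" where
  "rect_approximable M N f \<longleftrightarrow> f \<in> L2_functions (M \<Otimes>\<^sub>M N) \<and>
     (\<forall>\<eta>>0. \<exists>rs. rect_list M N rs \<and> (\<integral>z. (f z - rect_sum rs z)\<^sup>2 \<partial>(M \<Otimes>\<^sub>M N)) < \<eta>)"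

lemma rect_approximableD:
  assumes "rect_approximable M N f"
  shows "f \<in> L2_functions (M \<Otimes>\<^sub>M N)"
    and "0 < \<eta> \<Longrightarrow> \<exists>rs. rect_list M N rs \<and> (\<integral>z. (f z - rect_sum rs z)\<^sup>2 \<partial>(M \<Otimes>\<^sub>M N)) < \<eta>"
  using assms by (simp_all add: rect_approximable_def)

context pair_prob_space
begin

abbreviation "MM \<equiv> M1 \<Otimes>\<^sub>M M2"

lemma rect_sum_L2: "rect_list M1 M2 rs \<Longrightarrow> rect_sum rs \<in> L2_functions MM"
proof (induction rs)
  case Nil
  then show ?case by (simp add: rect_sum_def[abs_def] L2_functions_zero)
next
  case (Cons r rs)
  obtain c A B where r: "r = (c, A, B)" by (cases r) auto
  have AB: "A \<times> B \<in> sets MM" using Cons.prems by (auto simp: rect_list_def r)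
  have "rect_sum (r # rs) = (\<lambda>z. c * indicator (A \<times> B) z + rect_sum rs z)"
    by (auto simp: rect_sum_def r indicator_def fun_eq_iff)
  moreover have "rect_sum rs \<in> L2_functions MM" using Cons by (simp add: rect_list_def)
  ultimately show ?case
    using L2_functions_add[OF L2_functions_cmult[OF L2_functions_indicator[OF _ AB]]] P.finite_measure_axioms
    by simp
qed

text \<open>Two errors below \<eta>/4 suffice because squaring a sum costs a factor 2 on each
  square. Thanks to this lemma, later approximants need only be approximable themselves.\<close>

lemma rect_approximable_closure:
  assumes f: "f \<in> L2_functions MM"
    and g: "\<And>\<eta>. 0 < \<eta> \<Longrightarrow> \<exists>g. rect_approximable M1 M2 g \<and> (\<integral>z. (f z - g z)\<^sup>2 \<partial>MM) < \<eta>"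
  shows "rect_approximable M1 M2 f"
  unfolding rect_approximable_def
proof (intro conjI allI impI f)
  fix \<eta> :: real assume \<eta>: "0 < \<eta>"
  obtain g where ga: "rect_approximable M1 M2 g" and fg: "(\<integral>z. (f z - g z)\<^sup>2 \<partial>MM) < \<eta> / 4"
    using g[of "\<eta> / 4"] \<eta> by auto
  obtain rs where rs: "rect_list M1 M2 rs" and gr: "(\<integral>z. (g z - rect_sum rs z)\<^sup>2 \<partial>MM) < \<eta> / 4"
    using rect_approximableD(2)[OF ga, of "\<eta> / 4"] \<eta> by auto
  have gL: "g \<in> L2_functions MM" using ga by (simp add: rect_approximable_def)
  have "(\<integral>z. ((f z - g z) + (g z - rect_sum rs z))\<^sup>2 \<partial>MM) < \<eta>"
    using integral_square_triangle[OF L2_functions_diff[OF f gL] L2_functions_diff[OF gL rect_sum_L2[OF rs]]] fg gr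
    by linarith
  then show "\<exists>rs. rect_list M1 M2 rs \<and> (\<integral>z. (f z - rect_sum rs z)\<^sup>2 \<partial>MM) < \<eta>"
    using rs by auto
qed

lemma rect_approximable_rect_sum:
  assumes "rect_list M1 M2 rs"
  shows "rect_approximable M1 M2 (rect_sum rs)"
  using assms rect_sum_L2 by (auto simp: rect_approximable_def intro!: exI[of _ rs])

text \<open>Complements and representations of simple functions are compared with their targets only
  on the space of the product measure, hence this restricted form of equality.\<close>

lemma rect_approximable_cong:
  assumes f: "rect_approximable M1 M2 f" and g: "\<And>z. z \<in> space MM \<Longrightarrow> f z = g z"
  shows "rect_approximable M1 M2 g"
proof (rule rect_approximable_closure)
  have fL: "f \<in> L2_functions MM" using f by (simp add: rect_approximable_def)
  show "g \<in> L2_functions MM"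
    using fL g measurable_cong[of MM f g borel] Bochner_Integration.integrable_cong[of MM MM "\<lambda>x. (f x)\<^sup>2" "\<lambda>x. (g x)\<^sup>2"]
    by (simp add: L2_functions_def)
  have "(\<integral>z. (g z - f z)\<^sup>2 \<partial>MM) = (\<integral>z. 0 \<partial>MM)"
    by (intro Bochner_Integration.integral_cong refl) (simp add: g)
  then show "\<exists>f. rect_approximable M1 M2 f \<and> (\<integral>z. (g z - f z)\<^sup>2 \<partial>MM) < \<eta>" if "0 < \<eta>" for \<eta>
    using f that by auto
qed

lemma rect_approximable_add:
  assumes f: "rect_approximable M1 M2 f" and g: "rect_approximable M1 M2 g"
  shows "rect_approximable M1 M2 (\<lambda>z. f z + g z)"
proof (rule rect_approximable_closure)
  have fL: "f \<in> L2_functions MM" and gL: "g \<in> L2_functions MM"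
    using f g by (simp_all add: rect_approximable_def)
  then show "(\<lambda>z. f z + g z) \<in> L2_functions MM" by (rule L2_functions_add)
  fix \<eta> :: real assume \<eta>: "0 < \<eta>"
  then have \<eta>4: "0 < \<eta> / 4" by simp
  from rect_approximableD(2)[OF f this] obtain rs
    where rs: "rect_list M1 M2 rs" "(\<integral>z. (f z - rect_sum rs z)\<^sup>2 \<partial>MM) < \<eta> / 4" by blast
  from rect_approximableD(2)[OF g \<eta>4] obtain qs
    where qs: "rect_list M1 M2 qs" "(\<integral>z. (g z - rect_sum qs z)\<^sup>2 \<partial>MM) < \<eta> / 4" by blast
  have rsqs: "rect_list M1 M2 (rs @ qs)" using rs(1) qs(1) by (auto simp: rect_list_def)
  have "rect_sum (rs @ qs) z = rect_sum rs z + rect_sum qs z" for z by (simp add: rect_sum_def)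
  then have "(\<integral>z. (f z + g z - rect_sum (rs @ qs) z)\<^sup>2 \<partial>MM)
      = (\<integral>z. ((f z - rect_sum rs z) + (g z - rect_sum qs z))\<^sup>2 \<partial>MM)"
    by (intro Bochner_Integration.integral_cong refl) (simp add: algebra_simps)
  also have "\<dots> < \<eta>"
    using integral_square_triangle[OF L2_functions_diff[OF fL rect_sum_L2[OF rs(1)]]
        L2_functions_diff[OF gL rect_sum_L2[OF qs(1)]]] rs(2) qs(2)
    by linarith
  finally show "\<exists>h. rect_approximable M1 M2 h \<and> (\<integral>z. (f z + g z - h z)\<^sup>2 \<partial>MM) < \<eta>"
    using rect_approximable_rect_sum[OF rsqs] by blast
qed

lemma rect_approximable_zero: "rect_approximable M1 M2 (\<lambda>z. 0)"
  using rect_approximable_rect_sum[of "[]"] by (simp add: rect_sum_def[abs_def] rect_list_def)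

lemma rect_approximable_cmult:
  assumes f: "rect_approximable M1 M2 f"
  shows "rect_approximable M1 M2 (\<lambda>z. c * f z)"
proof (cases "c = 0")
  case True
  then show ?thesis using rect_approximable_zero by simp
next
  case False
  have fL: "f \<in> L2_functions MM" using f by (simp add: rect_approximable_def)
  show ?thesis
  proof (rule rect_approximable_closure)
    show "(\<lambda>z. c * f z) \<in> L2_functions MM" using fL by (rule L2_functions_cmult)
    fix \<eta> :: real assume \<eta>: "0 < \<eta>"
    then have "0 < \<eta> / c\<^sup>2" using False by simp
    then obtain rs where rs: "rect_list M1 M2 rs" "(\<integral>z. (f z - rect_sum rs z)\<^sup>2 \<partial>MM) < \<eta> / c\<^sup>2"
      using f unfolding rect_approximable_def by blast
    define qs where "qs = map (\<lambda>(a, A, B). (c * a, A, B)) rs"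
    have qs: "rect_list M1 M2 qs" using rs(1) by (auto simp: qs_def rect_list_def)
    have "rect_sum qs z = c * rect_sum rs z" for z
      by (simp add: qs_def rect_sum_def sum_list_const_mult[symmetric] o_def case_prod_unfold mult.assoc)
    then have "(\<integral>z. (c * f z - rect_sum qs z)\<^sup>2 \<partial>MM) = (\<integral>z. c\<^sup>2 * (f z - rect_sum rs z)\<^sup>2 \<partial>MM)"
      by (simp add: power_mult_distrib[symmetric] right_diff_distrib)
    also have "\<dots> < \<eta>" using rs(2) False by (simp add: field_simps)
    finally show "\<exists>h. rect_approximable M1 M2 h \<and> (\<integral>z. (c * f z - h z)\<^sup>2 \<partial>MM) < \<eta>"
      using rect_approximable_rect_sum[OF qs] by blast
  qed
qed

lemma rect_approximable_sum:
  assumes "\<And>i. i \<in> I \<Longrightarrow> rect_approximable M1 M2 (f i)"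
  shows "rect_approximable M1 M2 (\<lambda>z. \<Sum>i\<in>I. f i z)"
  using assms by (induction I rule: infinite_finite_induct)
    (auto simp: rect_approximable_zero intro: rect_approximable_add)

lemma rect_approximable_dominated_limit:
  assumes f: "f \<in> L2_functions MM"
    and s: "\<And>n. rect_approximable M1 M2 (s n)"
    and lim: "\<And>x. x \<in> space MM \<Longrightarrow> (\<lambda>n. s n x) \<longlonglongrightarrow> f x"
    and bound: "\<And>n x. x \<in> space MM \<Longrightarrow> \<bar>s n x\<bar> \<le> 2 * \<bar>f x\<bar>"
  shows "rect_approximable M1 M2 f"
proof (rule rect_approximable_closure[OF f])
  have "s n \<in> borel_measurable MM" for n using s[of n] by (auto simp: rect_approximable_def dest: L2_functionsD)
  then have "(\<lambda>n. \<integral>x. (f x - s n x)\<^sup>2 \<partial>MM) \<longlonglongrightarrow> 0"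
    using L2_dominated_approximation[OF f _ lim bound] by blast
  fix \<eta> :: real assume "0 < \<eta>"
  from order_tendstoD(2)[OF \<open>_ \<longlonglongrightarrow> 0\<close> this]
  obtain n where "(\<integral>x. (f x - s n x)\<^sup>2 \<partial>MM) < \<eta>"
    by (auto simp: eventually_sequentially)
  then show "\<exists>g. rect_approximable M1 M2 g \<and> (\<integral>z. (f z - g z)\<^sup>2 \<partial>MM) < \<eta>" using s by blast
qed

text \<open>Dynkin's argument: rectangles are stable under intersection and generate the product
  sigma-algebra, while the sets with approximable indicator are closed under complements and
  countable disjoint unions. For the unions, the indicators of the partial unions converge and are
  dominated by that of the whole union.\<close>

lemma rect_approximable_indicator:
  assumes "X \<in> sets MM"
  shows "rect_approximable M1 M2 (indicator X)"
proof -
  let ?G = "{a \<times> b | a b. a \<in> sets M1 \<and> b \<in> sets M2}"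
  have sets: "sets MM = sigma_sets (space M1 \<times> space M2) ?G" by (rule sets_pair_measure)
  have G: "?G \<subseteq> Pow (space M1 \<times> space M2)"
    by (auto dest: sets.sets_into_space)
  have rect: "rect_approximable M1 M2 (indicator (A \<times> B))" if "A \<in> sets M1" "B \<in> sets M2" for A B
  proof -
    have "rect_sum [(1, A, B)] = indicator (A \<times> B)"
      by (auto simp: rect_sum_def indicator_def fun_eq_iff)
    then show ?thesis using rect_approximable_rect_sum[of "[(1, A, B)]"] that by (simp add: rect_list_def)
  qed
  have "X \<in> sigma_sets (space M1 \<times> space M2) ?G" using assms sets by simp
  with Int_stable_pair_measure_generator G show ?thesis
  proof (induction rule: sigma_sets_induct_disjoint)
    case (basic A)
    then show ?case using rect by auto
  next
    case empty
    show ?case using rect_approximable_zero by simp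
  next
    case (compl A)
    have "rect_approximable M1 M2 (\<lambda>z. indicator (space M1 \<times> space M2) z + (- 1) * indicator A z)"
      using compl.IH by (intro rect_approximable_add rect_approximable_cmult rect) auto
    then show ?case
      by (rule rect_approximable_cong) (auto simp: space_pair_measure indicator_def)
  next
    case (union A)
    have A: "A i \<in> sets MM" for i using union.hyps(2) sets by auto
    have AE: "(\<Union>i. A i) \<in> sets MM" using A by auto
    have sum: "(\<Sum>i<n. indicator (A i) z :: real) = indicator (\<Union>i<n. A i) z" for n z
      using union.hyps(1) by (subst indicator_UN_disjoint) (auto simp: disjoint_family_on_def)
    show ?case
    proof (rule rect_approximable_dominated_limit)
      show "indicator (\<Union>i. A i) \<in> L2_functions MM"
        by (rule L2_functions_indicator[OF P.finite_measure_axioms AE])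
      show "rect_approximable M1 M2 (\<lambda>z. \<Sum>i<n. indicator (A i) z)" for n
        by (rule rect_approximable_sum) (rule union.IH)
      show "(\<lambda>n. \<Sum>i<n. indicator (A i) z) \<longlonglongrightarrow> (indicator (\<Union>i. A i) z :: real)" for z
        unfolding sum by (rule LIMSEQ_indicator_UN)
      show "\<bar>\<Sum>i<n. indicator (A i) z :: real\<bar> \<le> 2 * \<bar>indicator (\<Union>i. A i) z\<bar>" for n z
        unfolding sum by (auto simp: indicator_def)
    qed
  qed
qed

text \<open>A simple function is a finite combination of indicators, and simple functions converge
  to f under a bound of the kind required for dominated limits.\<close>

lemma rect_approximable_L2:
  assumes f: "f \<in> L2_functions MM"
  shows "rect_approximable M1 M2 f"
proof -
  obtain F where F: "\<And>i. simple_function MM (F i)"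
    "\<And>x. x \<in> space MM \<Longrightarrow> (\<lambda>i. F i x) \<longlonglongrightarrow> f x"
    "\<And>i x. x \<in> space MM \<Longrightarrow> dist (F i x) 0 \<le> 2 * dist (f x) 0"
    using borel_measurable_implies_sequence_metric[OF L2_functionsD(1)[OF f], of 0] by blast
  have "rect_approximable M1 M2 (F i)" for i
  proof -
    have fin: "finite (F i ` space MM)" using F(1) by (rule simple_functionD)
    have "rect_approximable M1 M2 (\<lambda>x. \<Sum>y\<in>F i ` space MM. y * indicator (F i -` {y} \<inter> space MM) x)"
      using F(1) by (intro rect_approximable_sum rect_approximable_cmult rect_approximable_indicator simple_functionD)
    moreover have "(\<Sum>y\<in>F i ` space MM. y * indicator (F i -` {y} \<inter> space MM) x) = F i x" if "x \<in> space MM" for x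
    proof -
      have "(\<Sum>y\<in>F i ` space MM. y * indicator (F i -` {y} \<inter> space MM) x)
          = (\<Sum>y\<in>F i ` space MM. if y = F i x then y else 0)"
        using that by (intro sum.cong refl) (auto simp: indicator_def)
      then show ?thesis using fin that by simp
    qed
    ultimately show ?thesis by (rule rect_approximable_cong)
  qed
  then show ?thesis using F(2,3) by (intro rect_approximable_dominated_limit[OF f]) simp_all
qed

end

section \<open>Projection kernels in the query variable and their Monte Carlo approximation\<close>

context pair_prob_space
begin

lemma AE_L2_functions_section:
  assumes f: "f \<in> L2_functions MM"
  shows "AE x in M1. (\<lambda>y. f (x, y)) \<in> L2_functions M2"
proof -
  have "AE x in M1. integrable M2 (\<lambda>y. (f (x, y))\<^sup>2)"
    using AE_integrable_fst'[OF L2_functionsD(2)[OF f]] .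
  moreover have "AE x in M1. (\<lambda>y. f (x, y)) \<in> borel_measurable M2"
    using L2_functionsD(1)[OF f] by (intro AE_I2 measurable_compose_Pair1)
  ultimately show ?thesis by eventually_elim (rule L2_functionsI)
qed

text \<open>Tonelli's theorem, with the inner integral turned into a real number for almost every x.
  Where a section is not square integrable the real integral has its default value 0, on a null set
  that the outer integral ignores.\<close>

lemma integral_square_sections:
  assumes f: "f \<in> L2_functions MM"
  shows "(\<integral>\<^sup>+x. ennreal (\<integral>y. (f (x, y))\<^sup>2 \<partial>M2) \<partial>M1) = ennreal (\<integral>z. (f z)\<^sup>2 \<partial>MM)"
proof -
  have [measurable]: "f \<in> borel_measurable MM" using f by (rule L2_functionsD)
  have "ennreal (\<integral>z. (f z)\<^sup>2 \<partial>MM) = (\<integral>\<^sup>+z. ennreal ((f z)\<^sup>2) \<partial>MM)"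
    using L2_functionsD(2)[OF f] by (intro nn_integral_eq_integral[symmetric]) auto
  also have "\<dots> = (\<integral>\<^sup>+x. \<integral>\<^sup>+y. ennreal ((f (x, y))\<^sup>2) \<partial>M2 \<partial>M1)"
    by (rule M2.nn_integral_fst[symmetric]) measurable
  also have "\<dots> = (\<integral>\<^sup>+x. ennreal (\<integral>y. (f (x, y))\<^sup>2 \<partial>M2) \<partial>M1)"
    using AE_L2_functions_section[OF f]
    by (intro nn_integral_cong_AE, eventually_elim) (auto intro!: nn_integral_eq_integral dest: L2_functionsD)
  finally show ?thesis by simp
qed

text \<open>The kernel is that of the orthogonal projection onto a finite-dimensional space of bounded functions.\<close>

lemma bounded_kernel_approximation:
  assumes R: "R \<in> L2_functions MM" and \<eta>: "0 < \<eta>"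
  shows "\<exists>k C. case_prod k \<in> borel_measurable (M2 \<Otimes>\<^sub>M M2) \<and> (\<forall>q q'. \<bar>k q q'\<bar> \<le> C) \<and>
    (\<integral>\<^sup>+z. ennreal (((\<integral>q'. k (snd z) q' * R (fst z, q') \<partial>M2) - R z)\<^sup>2) \<partial>MM) \<le> ennreal \<eta>"
proof -
  have [measurable]: "R \<in> borel_measurable MM" using R by (rule L2_functionsD)
  obtain rs where rs: "rect_list M1 M2 rs" and Rrs: "(\<integral>z. (R z - rect_sum rs z)\<^sup>2 \<partial>MM) < \<eta>"
    using rect_approximableD(2)[OF rect_approximable_L2[OF R] \<eta>] by blast
  define n where "n = length rs"
  define c where "c j = fst (rs ! j)" for j
  define A where "A j = fst (snd (rs ! j))" for j
  define B where "B j = snd (snd (rs ! j))" for j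
  have B: "B j \<in> sets M2" if "j < n" for j
    using rs nth_mem[of j rs] that by (cases "rs ! j") (force simp: rect_list_def n_def B_def)
  have rect: "rect_sum rs (x, y) = (\<Sum>j<n. (c j * indicator (A j) x) * indicator (B j) y)" for x y
    by (simp add: rect_sum_def sum_list_sum_nth n_def lessThan_atLeast0 case_prod_unfold c_def A_def B_def)
  have "(indicator (B b) :: 'b \<Rightarrow> real) \<in> L2_functions M2" if "b < n" for b
    by (rule L2_functions_indicator[OF M2.finite_measure_axioms B[OF that]])
  from gram_schmidt[of n "\<lambda>b. indicator (B b)" M2, OF this] obtain K e D
    where e: "orthonormal_family M2 K e"
      and span: "\<forall>k<K. \<exists>c. e k = (\<lambda>x. \<Sum>b<n. c b * indicator (B b) x)"
      and D: "\<forall>b<n. AE x in M2. indicator (B b) x = (\<Sum>k<K. D b k * e k x)"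
    by blast
  have eL: "e k \<in> L2_functions M2" if "k < K" for k using e that by (simp add: orthonormal_family_def)
  \<comment> \<open>The pointwise span relation is essential here: the kernel must be bounded at
    every pair of points, not only almost everywhere.\<close>
  have bounded: "\<exists>C. \<forall>x. \<bar>e k x\<bar> \<le> C" if k: "k < K" for k
  proof -
    obtain a where a: "e k = (\<lambda>x. \<Sum>b<n. a b * indicator (B b) x)" using span k by blast
    have "\<bar>e k x\<bar> \<le> (\<Sum>b<n. \<bar>a b\<bar>)" for x
    proof -
      have "\<bar>e k x\<bar> \<le> (\<Sum>b<n. \<bar>a b * indicator (B b) x\<bar>)" unfolding a by (rule sum_abs)
      also have "\<dots> \<le> (\<Sum>b<n. \<bar>a b\<bar>)" by (intro sum_mono) (simp add: indicator_def)
      finally show ?thesis .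
    qed
    then show ?thesis by blast
  qed
  then have "\<forall>k\<in>{..<K}. \<exists>C. \<forall>x. \<bar>e k x\<bar> \<le> C" by simp
  from bchoice[OF this] obtain E where E: "\<And>k x. k < K \<Longrightarrow> \<bar>e k x\<bar> \<le> E k" by auto
  define \<kappa> where "\<kappa> q q' = (\<Sum>k<K. e k q * e k q')" for q q'
  have [measurable]: "e k \<in> borel_measurable M2" if "k < K" for k using eL[OF that] by (rule L2_functionsD)
  have \<kappa>_meas: "case_prod \<kappa> \<in> borel_measurable (M2 \<Otimes>\<^sub>M M2)"
    unfolding \<kappa>_def case_prod_unfold by (intro borel_measurable_sum) measurable
  have \<kappa>_bound: "\<bar>\<kappa> q q'\<bar> \<le> (\<Sum>k<K. E k * E k)" for q q'
  proof -
    have "\<bar>\<kappa> q q'\<bar> \<le> (\<Sum>k<K. \<bar>e k q * e k q'\<bar>)" unfolding \<kappa>_def by (rule sum_abs)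
    also have "\<dots> \<le> (\<Sum>k<K. E k * E k)"
      unfolding abs_mult using E by (intro sum_mono mult_mono) (auto intro: order_trans[OF abs_ge_zero])
    finally show ?thesis .
  qed
  \<comment> \<open>The exceptional null set comes from finitely many identities for the indicators
    of the \<open>B b\<close>, which do not involve x. One null set therefore serves all x.\<close>
  have rect_e: "AE y in M2. \<forall>x. rect_sum rs (x, y) = (\<Sum>k<K. (\<Sum>j<n. c j * indicator (A j) x * D j k) * e k y)"
  proof -
    have "AE y in M2. \<forall>b\<in>{..<n}. indicator (B b) y = (\<Sum>k<K. D b k * e k y)"
      using D by (intro AE_finite_allI) auto
    then show ?thesis
    proof eventually_elim
      fix y assume *: "\<forall>b\<in>{..<n}. indicator (B b) y = (\<Sum>k<K. D b k * e k y)"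
      show "\<forall>x. rect_sum rs (x, y) = (\<Sum>k<K. (\<Sum>j<n. c j * indicator (A j) x * D j k) * e k y)"
      proof
        fix x
        have "rect_sum rs (x, y) = (\<Sum>j<n. \<Sum>k<K. c j * indicator (A j) x * D j k * e k y)"
          unfolding rect using * by (intro sum.cong refl) (simp add: sum_distrib_left mult.assoc)
        then show "rect_sum rs (x, y) = (\<Sum>k<K. (\<Sum>j<n. c j * indicator (A j) x * D j k) * e k y)"
          by (subst (asm) sum.swap) (simp add: sum_distrib_right)
      qed
    qed
  qed
  \<comment> \<open>For fixed x the kernel yields the orthogonal projection of R(x, .). It is at
    least as close to R(x, .) as the section of the rectangle sum, which lies in the same span up to
    a null set.\<close>
  have key: "AE x in M1. (\<integral>\<^sup>+y. ennreal (((\<integral>q'. \<kappa> y q' * R (x, q') \<partial>M2) - R (x, y))\<^sup>2) \<partial>M2)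
      \<le> ennreal (\<integral>y. (R (x, y) - rect_sum rs (x, y))\<^sup>2 \<partial>M2)"
    using AE_L2_functions_section[OF R]
  proof eventually_elim
    fix x assume Rx: "(\<lambda>y. R (x, y)) \<in> L2_functions M2"
    define a where "a k = (\<integral>y. R (x, y) * e k y \<partial>M2)" for k
    define d where "d k = (\<Sum>j<n. c j * indicator (A j) x * D j k)" for k
    have proj: "(\<integral>q'. \<kappa> y q' * R (x, q') \<partial>M2) = (\<Sum>k<K. a k * e k y)" for y
    proof -
      have "(\<integral>q'. \<kappa> y q' * R (x, q') \<partial>M2) = (\<integral>q'. (\<Sum>k<K. e k y * (R (x, q') * e k q')) \<partial>M2)"
        by (simp add: \<kappa>_def sum_distrib_left sum_distrib_right ac_simps)
      also have "\<dots> = (\<Sum>k<K. e k y * a k)"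
        unfolding a_def using L2_functions_integrable_mult[OF Rx eL]
        by (intro integral_linear_combination) simp
      finally show ?thesis by (simp add: mult.commute)
    qed
    have pL: "(\<lambda>y. R (x, y) - (\<Sum>k<K. a k * e k y)) \<in> L2_functions M2"
      by (intro L2_functions_diff Rx L2_functions_sum L2_functions_cmult eL) simp
    have "(\<integral>\<^sup>+y. ennreal (((\<integral>q'. \<kappa> y q' * R (x, q') \<partial>M2) - R (x, y))\<^sup>2) \<partial>M2)
        = (\<integral>\<^sup>+y. ennreal ((R (x, y) - (\<Sum>k<K. a k * e k y))\<^sup>2) \<partial>M2)"
      unfolding proj by (simp add: power2_commute)
    also have "\<dots> = ennreal (\<integral>y. (R (x, y) - (\<Sum>k<K. a k * e k y))\<^sup>2 \<partial>M2)"
      using L2_functionsD(2)[OF pL] by (intro nn_integral_eq_integral) auto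
    also have "\<dots> \<le> ennreal (\<integral>y. (R (x, y) - (\<Sum>k<K. d k * e k y))\<^sup>2 \<partial>M2)"
      unfolding a_def by (intro ennreal_leI orthonormal_best_approximation e Rx)
    also have "(\<integral>y. (R (x, y) - (\<Sum>k<K. d k * e k y))\<^sup>2 \<partial>M2) = (\<integral>y. (R (x, y) - rect_sum rs (x, y))\<^sup>2 \<partial>M2)"
    proof (rule Bochner_Integration.integral_cong_AE)
      have "(\<lambda>y. R (x, y) - (\<Sum>k<K. d k * e k y)) \<in> L2_functions M2"
        by (intro L2_functions_diff Rx L2_functions_sum L2_functions_cmult eL) simp
      then show "(\<lambda>y. (R (x, y) - (\<Sum>k<K. d k * e k y))\<^sup>2) \<in> borel_measurable M2"
        by (intro borel_measurable_power) (rule L2_functionsD)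
      have "(\<lambda>y. R (x, y) - rect_sum rs (x, y)) \<in> borel_measurable M2"
        using L2_functionsD(1)[OF Rx] B unfolding rect
        by (intro borel_measurable_diff borel_measurable_sum borel_measurable_times borel_measurable_const
            borel_measurable_indicator) auto
      then show "(\<lambda>y. (R (x, y) - rect_sum rs (x, y))\<^sup>2) \<in> borel_measurable M2"
        by (rule borel_measurable_power)
      show "AE y in M2. (R (x, y) - (\<Sum>k<K. d k * e k y))\<^sup>2 = (R (x, y) - rect_sum rs (x, y))\<^sup>2"
        using rect_e by eventually_elim (simp add: d_def)
    qed
    finally show "(\<integral>\<^sup>+y. ennreal (((\<integral>q'. \<kappa> y q' * R (x, q') \<partial>M2) - R (x, y))\<^sup>2) \<partial>M2)
      \<le> ennreal (\<integral>y. (R (x, y) - rect_sum rs (x, y))\<^sup>2 \<partial>M2)" .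
  qed
  have proj_meas: "(\<lambda>z. \<integral>q'. \<kappa> (snd z) q' * R (fst z, q') \<partial>M2) \<in> borel_measurable MM"
  proof (rule M2.borel_measurable_lebesgue_integral)
    have "(\<lambda>w. case_prod \<kappa> (snd (fst w), snd w)) \<in> borel_measurable (MM \<Otimes>\<^sub>M M2)"
      by (rule measurable_compose[OF _ \<kappa>_meas]) measurable
    then show "(\<lambda>(z, q'). \<kappa> (snd z) q' * R (fst z, q')) \<in> borel_measurable (MM \<Otimes>\<^sub>M M2)"
      unfolding case_prod_unfold by (intro borel_measurable_times) (simp, measurable)
  qed
  have "(\<integral>\<^sup>+z. ennreal (((\<integral>q'. \<kappa> (snd z) q' * R (fst z, q') \<partial>M2) - R z)\<^sup>2) \<partial>MM)
      = (\<integral>\<^sup>+x. \<integral>\<^sup>+y. ennreal (((\<integral>q'. \<kappa> y q' * R (x, q') \<partial>M2) - R (x, y))\<^sup>2) \<partial>M2 \<partial>M1)"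
    by (subst M2.nn_integral_fst[symmetric])
      (auto intro!: measurable_compose[OF _ measurable_ennreal] borel_measurable_power borel_measurable_diff proj_meas)
  also have "\<dots> \<le> (\<integral>\<^sup>+x. ennreal (\<integral>y. (R (x, y) - rect_sum rs (x, y))\<^sup>2 \<partial>M2) \<partial>M1)"
    by (rule nn_integral_mono_AE[OF key])
  also have "\<dots> = ennreal (\<integral>z. (R z - rect_sum rs z)\<^sup>2 \<partial>MM)"
    by (rule integral_square_sections[OF L2_functions_diff[OF R rect_sum_L2[OF rs]]])
  also have "\<dots> \<le> ennreal \<eta>" using Rrs by (intro ennreal_leI) simp
  finally show ?thesis using \<kappa>_meas \<kappa>_bound by blast
qed


text \<open>After the order of integration is exchanged, the sum at a fixed point (x, y) is an
  average of m independent copies of q' \<mapsto> k y q' R(x, q'). The bias of this average is the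
  error of the kernel itself, and the bound on k reduces its second moment to C^2 times that of R(x,
  .), whence the term of order 1/m.\<close>

lemma sampled_kernel_error:
  assumes R: "R \<in> L2_functions MM"
    and k: "case_prod k \<in> borel_measurable (M2 \<Otimes>\<^sub>M M2)" and C: "\<And>q q'. \<bar>k q q'\<bar> \<le> C" and m: "0 < m"
  shows "(\<integral>\<^sup>+t. \<integral>\<^sup>+z. ennreal (((\<Sum>b<m. k (snd z) (t b) * R (fst z, t b)) / real m - R z)\<^sup>2) \<partial>MM
      \<partial>(\<Pi>\<^sub>M b\<in>{..<m}. M2))
    \<le> (\<integral>\<^sup>+z. ennreal (((\<integral>q'. k (snd z) q' * R (fst z, q') \<partial>M2) - R z)\<^sup>2) \<partial>MM)
      + ennreal (C\<^sup>2 * (\<integral>z. (R z)\<^sup>2 \<partial>MM) / real m)"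
proof -
  let ?P = "\<Pi>\<^sub>M b\<in>{..<m}. M2"
  let ?H = "\<lambda>z t. ennreal (((\<Sum>b<m. k (snd z) (t b) * R (fst z, t b)) / real m - R z)\<^sup>2)"
  let ?B = "\<lambda>z. ennreal (((\<integral>q'. k (snd z) q' * R (fst z, q') \<partial>M2) - R z)\<^sup>2)"
  interpret T: prob_space ?P by (intro prob_space_PiM M2.prob_space_axioms)
  interpret MT: pair_sigma_finite MM ?P ..
  have R_meas [measurable]: "R \<in> borel_measurable MM" using R by (rule L2_functionsD)
  \<comment> \<open>Any pair of arguments would do, since an absolute value lies below C.\<close>
  have C0: "0 \<le> C" using C[of undefined undefined] by linarith
  have kR: "(\<lambda>w. k (snd (f w)) (g w) * R (fst (f w), g w)) \<in> borel_measurable X"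
    if [measurable]: "f \<in> X \<rightarrow>\<^sub>M MM" "g \<in> X \<rightarrow>\<^sub>M M2" for f g and X :: "'x measure"
  proof (intro borel_measurable_times)
    have "(\<lambda>w. case_prod k (snd (f w), g w)) \<in> borel_measurable X"
      by (rule measurable_compose[OF _ k]) measurable
    then show "(\<lambda>w. k (snd (f w)) (g w)) \<in> borel_measurable X" by simp
  qed measurable
  have H: "case_prod ?H \<in> borel_measurable (MM \<Otimes>\<^sub>M ?P)"
    unfolding case_prod_unfold
    by (intro measurable_compose[OF _ measurable_ennreal] borel_measurable_power borel_measurable_diff
        borel_measurable_divide borel_measurable_sum borel_measurable_const kR measurable_compose[OF _ R_meas]
        measurable_fst measurable_compose[OF measurable_snd] measurable_component_singleton) simp
  have B: "?B \<in> borel_measurable MM"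
  proof -
    have "(\<lambda>w. k (snd (fst w)) (snd w) * R (fst (fst w), snd w)) \<in> borel_measurable (MM \<Otimes>\<^sub>M M2)"
      by (intro kR) measurable
    then have "(\<lambda>z. \<integral>q'. k (snd z) q' * R (fst z, q') \<partial>M2) \<in> borel_measurable MM"
      by (intro M2.borel_measurable_lebesgue_integral) (simp add: case_prod_unfold)
    then show ?thesis
      by (intro measurable_compose[OF _ measurable_ennreal] borel_measurable_power borel_measurable_diff R_meas)
  qed
  have pointwise: "(\<integral>\<^sup>+t. ?H (x, y) t \<partial>?P) \<le> ?B (x, y) + ennreal (C\<^sup>2 * (\<integral>q'. (R (x, q'))\<^sup>2 \<partial>M2) / real m)"
    if Rx: "(\<lambda>y. R (x, y)) \<in> L2_functions M2" and xy: "x \<in> space M1" "y \<in> space M2" for x y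
  proof -
    have bound: "(k y q' * R (x, q'))\<^sup>2 \<le> C\<^sup>2 * (R (x, q'))\<^sup>2" for q'
      using C[of y q'] C0 unfolding power_mult_distrib
      by (intro mult_right_mono) (auto simp: abs_le_square_iff[symmetric])
    have X: "(\<lambda>q'. k y q' * R (x, q')) \<in> L2_functions M2"
    proof (rule L2_functionsI)
      show "(\<lambda>q'. k y q' * R (x, q')) \<in> borel_measurable M2"
        using kR[of "\<lambda>_. (x, y)" M2 "\<lambda>q'. q'"] xy by (simp add: space_pair_measure)
      then show "integrable M2 (\<lambda>q'. (k y q' * R (x, q'))\<^sup>2)"
        by (intro Bochner_Integration.integrable_bound[OF integrable_mult_right[OF L2_functionsD(2)[OF Rx], of "C\<^sup>2"]])
          (auto intro!: AE_I2 simp: bound)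
    qed
    have sq: "(\<integral>q'. (k y q' * R (x, q'))\<^sup>2 \<partial>M2) \<le> C\<^sup>2 * (\<integral>q'. (R (x, q'))\<^sup>2 \<partial>M2)"
    proof -
      have "(\<integral>q'. (k y q' * R (x, q'))\<^sup>2 \<partial>M2) \<le> (\<integral>q'. C\<^sup>2 * (R (x, q'))\<^sup>2 \<partial>M2)"
        using L2_functionsD(2)[OF X] L2_functionsD(2)[OF Rx] bound by (intro integral_mono) auto
      then show ?thesis by simp
    qed
    have "(\<integral>\<^sup>+t. ?H (x, y) t \<partial>?P)
        \<le> ennreal (((\<integral>q'. k y q' * R (x, q') \<partial>M2) - R (x, y))\<^sup>2 + (\<integral>q'. (k y q' * R (x, q'))\<^sup>2 \<partial>M2) / real m)"
      using M2.integral_iid_average_square[OF X m, of "R (x, y)"] by simp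
    also have "\<dots> \<le> ennreal (((\<integral>q'. k y q' * R (x, q') \<partial>M2) - R (x, y))\<^sup>2 + C\<^sup>2 * (\<integral>q'. (R (x, q'))\<^sup>2 \<partial>M2) / real m)"
      by (intro ennreal_leI add_left_mono divide_right_mono sq) simp
    finally show ?thesis by simp
  qed
  have key: "AE x in M1. (\<integral>\<^sup>+y. \<integral>\<^sup>+t. ?H (x, y) t \<partial>?P \<partial>M2)
      \<le> (\<integral>\<^sup>+y. ?B (x, y) \<partial>M2) + ennreal (C\<^sup>2 / real m) * ennreal (\<integral>y. (R (x, y))\<^sup>2 \<partial>M2)"
    using AE_L2_functions_section[OF R] AE_space
  proof eventually_elim
    fix x assume Rx: "(\<lambda>y. R (x, y)) \<in> L2_functions M2" and x: "x \<in> space M1"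
    have "(\<integral>\<^sup>+y. \<integral>\<^sup>+t. ?H (x, y) t \<partial>?P \<partial>M2)
        \<le> (\<integral>\<^sup>+y. ?B (x, y) + ennreal (C\<^sup>2 * (\<integral>q'. (R (x, q'))\<^sup>2 \<partial>M2) / real m) \<partial>M2)"
      using pointwise[OF Rx x] by (intro nn_integral_mono)
    also have "\<dots> = (\<integral>\<^sup>+y. ?B (x, y) \<partial>M2) + ennreal (C\<^sup>2 * (\<integral>q'. (R (x, q'))\<^sup>2 \<partial>M2) / real m)"
      using measurable_compose_Pair1[OF x B] by (subst nn_integral_add) (auto simp: M2.emeasure_space_1)
    also have "ennreal (C\<^sup>2 * (\<integral>q'. (R (x, q'))\<^sup>2 \<partial>M2) / real m)
        = ennreal (C\<^sup>2 / real m) * ennreal (\<integral>y. (R (x, y))\<^sup>2 \<partial>M2)"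
      by (subst ennreal_mult[symmetric]) auto
    finally show "(\<integral>\<^sup>+y. \<integral>\<^sup>+t. ?H (x, y) t \<partial>?P \<partial>M2)
      \<le> (\<integral>\<^sup>+y. ?B (x, y) \<partial>M2) + ennreal (C\<^sup>2 / real m) * ennreal (\<integral>y. (R (x, y))\<^sup>2 \<partial>M2)" .
  qed
  have RR: "(\<lambda>x. ennreal (\<integral>y. (R (x, y))\<^sup>2 \<partial>M2)) \<in> borel_measurable M1" by measurable
  then have RR': "(\<lambda>x. ennreal (C\<^sup>2 / real m) * ennreal (\<integral>y. (R (x, y))\<^sup>2 \<partial>M2)) \<in> borel_measurable M1" by measurable
  have "(\<integral>\<^sup>+t. \<integral>\<^sup>+z. ?H z t \<partial>MM \<partial>?P) = (\<integral>\<^sup>+z. \<integral>\<^sup>+t. ?H z t \<partial>?P \<partial>MM)"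
    by (rule MT.Fubini'[OF H])
  also have "\<dots> = (\<integral>\<^sup>+x. \<integral>\<^sup>+y. \<integral>\<^sup>+t. ?H (x, y) t \<partial>?P \<partial>M2 \<partial>M1)"
    by (rule M2.nn_integral_fst[symmetric, OF T.borel_measurable_nn_integral[OF H]])
  also have "\<dots> \<le> (\<integral>\<^sup>+x. (\<integral>\<^sup>+y. ?B (x, y) \<partial>M2) + ennreal (C\<^sup>2 / real m) * ennreal (\<integral>y. (R (x, y))\<^sup>2 \<partial>M2) \<partial>M1)"
    by (rule nn_integral_mono_AE[OF key])
  also have "\<dots> = (\<integral>\<^sup>+z. ?B z \<partial>MM) + ennreal (C\<^sup>2 / real m) * ennreal (\<integral>z. (R z)\<^sup>2 \<partial>MM)"
    unfolding nn_integral_add[OF M2.borel_measurable_nn_integral_fst[OF B] RR']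
      nn_integral_cmult[OF RR] M2.nn_integral_fst[OF B] integral_square_sections[OF R] ..
  also have "ennreal (C\<^sup>2 / real m) * ennreal (\<integral>z. (R z)\<^sup>2 \<partial>MM) = ennreal (C\<^sup>2 * (\<integral>z. (R z)\<^sup>2 \<partial>MM) / real m)"
    by (subst ennreal_mult[symmetric]) auto
  finally show ?thesis .
qed

end

section \<open>Error of the regularized CUR approximation\<close>

context prob_space
begin

text \<open>On a probability space a square integrable function is integrable; applied to f^2 this
  descends from the fourth to the second power.\<close>

lemma L2_functions_of_fourth_power:
  assumes [measurable]: "f \<in> borel_measurable M" and 4: "integrable M (\<lambda>x. f x ^ 4)"
  shows "(\<lambda>x. (f x)\<^sup>2) \<in> L2_functions M" and "f \<in> L2_functions M"
proof -
  have "((f x)\<^sup>2)\<^sup>2 = f x ^ 4" for x by (simp flip: power_mult)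
  with 4 show *: "(\<lambda>x. (f x)\<^sup>2) \<in> L2_functions M" by (simp add: L2_functions_def)
  show "f \<in> L2_functions M"
    using L2_functions_integrable[OF *] by (simp add: L2_functions_def)
qed

lemma L2_functions_mult_of_squares:
  assumes "f \<in> borel_measurable M" "g \<in> borel_measurable M"
    and "(\<lambda>x. (f x)\<^sup>2) \<in> L2_functions M" "(\<lambda>x. (g x)\<^sup>2) \<in> L2_functions M"
  shows "(\<lambda>x. f x * g x) \<in> L2_functions M"
proof (rule L2_functionsI)
  show "(\<lambda>x. f x * g x) \<in> borel_measurable M" using assms(1,2) by measurable
  show "integrable M (\<lambda>x. (f x * g x)\<^sup>2)"
    using L2_functions_integrable_mult[OF assms(3,4)] by (simp add: power_mult_distrib)
qed

text \<open>An entrywise perturbation of the identity by at most \<kappa> changes the quadratic form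
  by at most \<kappa> K |w|^2, because |w_j w_k| is at most half of w_j^2 + w_k^2. With \<kappa> = 1
  / (2 (K + 1)) this is at most half of |w|^2; the added 1 keeps \<kappa> meaningful for K =
  0.\<close>

lemma weighted_gram_lower_bound:
  fixes G :: "nat \<Rightarrow> nat \<Rightarrow> real" and w :: "nat \<Rightarrow> real"
  assumes G: "\<And>j k. j < K \<Longrightarrow> k < K \<Longrightarrow> \<bar>G j k - (if j = k then 1 else 0)\<bar> \<le> 1 / (2 * (real K + 1))"
  shows "(\<Sum>k<K. (w k)\<^sup>2) \<le> 2 * (\<Sum>j<K. \<Sum>k<K. w j * w k * G j k)"
proof -
  define \<kappa> where "\<kappa> = 1 / (2 * (real K + 1))"
  define S where "S = (\<Sum>k<K. (w k)\<^sup>2)"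
  have S0: "0 \<le> S" by (simp add: S_def sum_nonneg)
  have "(\<Sum>j<K. \<Sum>k<K. w j * w k * (if j = k then 1 else 0)) = (\<Sum>j<K. \<Sum>k<K. if k = j then (w j)\<^sup>2 else 0)"
    by (intro sum.cong refl) (auto simp: power2_eq_square)
  then have diag: "(\<Sum>j<K. \<Sum>k<K. w j * w k * (if j = k then 1 else 0)) = S"
    by (simp add: S_def)
  have "S - (\<Sum>j<K. \<Sum>k<K. w j * w k * G j k)
      = (\<Sum>j<K. \<Sum>k<K. - (w j * w k * (G j k - (if j = k then 1 else 0))))"
    unfolding diag[symmetric] by (simp add: sum_subtractf right_diff_distrib sum_negf)
  also have "\<dots> \<le> (\<Sum>j<K. \<Sum>k<K. \<kappa> / 2 * ((w j)\<^sup>2 + (w k)\<^sup>2))"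
  proof (intro sum_mono)
    fix j k assume jk: "j \<in> {..<K}" "k \<in> {..<K}"
    have "- (w j * w k * (G j k - (if j = k then 1 else 0)))
        \<le> \<bar>w j * w k\<bar> * \<bar>G j k - (if j = k then 1 else 0)\<bar>"
      unfolding abs_mult[symmetric] by (rule abs_ge_minus_self)
    also have "\<dots> \<le> \<bar>w j * w k\<bar> * \<kappa>" using G[of j k] jk by (intro mult_left_mono) (auto simp: \<kappa>_def)
    also have "\<dots> \<le> (((w j)\<^sup>2 + (w k)\<^sup>2) / 2) * \<kappa>"
      using sum_squares_bound[of "\<bar>w j\<bar>" "\<bar>w k\<bar>"] by (intro mult_right_mono) (auto simp: abs_mult \<kappa>_def)
    finally show "- (w j * w k * (G j k - (if j = k then 1 else 0))) \<le> \<kappa> / 2 * ((w j)\<^sup>2 + (w k)\<^sup>2)"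
      by (simp add: mult.commute)
  qed
  also have "\<dots> = \<kappa> / 2 * (real K * S + real K * S)"
  proof -
    have "(\<Sum>j<K. \<Sum>k<K. (w j)\<^sup>2 + (w k)\<^sup>2) = real K * S + real K * S"
      by (simp add: sum.distrib S_def sum_distrib_left)
    then show ?thesis by (simp only: sum_distrib_left[symmetric])
  qed
  also have "\<dots> = (\<kappa> * real K) * S" by (simp add: algebra_simps)
  also have "\<dots> \<le> (1 / 2) * S"
    using S0 by (intro mult_right_mono) (simp_all add: \<kappa>_def field_simps)
  finally show ?thesis by (simp add: S_def)
qed

text \<open>The event must not depend on v: it will be used with the difference between the ridge
  coefficients and the competitor, which depends on the sample itself. Uniformity in v is possible
  because in an orthonormal basis both norms are quadratic forms, so it suffices that the finitely
  many empirical means of the products e j e k are close to 0 or 1.\<close>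

lemma empirical_norm_dominates:
  fixes g :: "nat \<Rightarrow> 'a \<Rightarrow> real" and m :: nat
  assumes g: "\<And>b. b < m \<Longrightarrow> g b \<in> borel_measurable M" "\<And>b. b < m \<Longrightarrow> integrable M (\<lambda>x. g b x ^ 4)"
    and \<delta>: "0 < \<delta>"
  shows "\<exists>N0. \<forall>N\<ge>N0. \<exists>A\<in>sets (\<Pi>\<^sub>M a\<in>{..<N}. M). 1 - \<delta> \<le> measure (\<Pi>\<^sub>M a\<in>{..<N}. M) A \<and>
    (\<forall>s\<in>A. \<forall>v. real N * (\<integral>x. (\<Sum>b<m. v b * g b x)\<^sup>2 \<partial>M) \<le> 2 * (\<Sum>a<N. (\<Sum>b<m. v b * g b (s a))\<^sup>2))"
proof -
  have gL: "g b \<in> L2_functions M" and g2L: "(\<lambda>x. (g b x)\<^sup>2) \<in> L2_functions M" if "b < m" for b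
    using L2_functions_of_fourth_power[OF g(1)[OF that] g(2)[OF that]] by auto
  from gram_schmidt[of m g M, OF gL] obtain K e B
    where e: "orthonormal_family M K e"
      and span: "\<forall>k<K. \<exists>c. e k = (\<lambda>x. \<Sum>b<m. c b * g b x)"
      and B: "\<forall>b<m. AE x in M. g b x = (\<Sum>k<K. B b k * e k x)"
    by blast
  have eL: "e k \<in> L2_functions M" if "k < K" for k using e that by (simp add: orthonormal_family_def)
  have on: "(\<integral>x. e j x * e k x \<partial>M) = (if j = k then 1 else 0)" if "j < K" "k < K" for j k
    using e that by (simp add: orthonormal_family_def)
  have e_meas: "e k \<in> borel_measurable M" if "k < K" for k using eL[OF that] by (rule L2_functionsD)
  have eeL: "(\<lambda>x. e j x * e k x) \<in> L2_functions M" if jk: "j < K" "k < K" for j k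
  proof -
    obtain a c where a: "e j = (\<lambda>x. \<Sum>b<m. a b * g b x)" and c: "e k = (\<lambda>x. \<Sum>b<m. c b * g b x)"
      using span jk by blast
    have "(\<lambda>x. \<Sum>b<m. \<Sum>b'<m. (a b * c b') * (g b x * g b' x)) \<in> L2_functions M"
      by (intro L2_functions_sum L2_functions_cmult L2_functions_mult_of_squares g g2L) auto
    then show ?thesis unfolding a c by (simp add: sum_product ac_simps)
  qed
  define Y where "Y j k x = e j x * e k x - (if j = k then 1 else 0)" for j k x
  have YL: "Y j k \<in> L2_functions M" if "j < K" "k < K" for j k
    unfolding Y_def by (intro L2_functions_diff eeL that L2_functions_const)
  have Y0: "(\<integral>x. Y j k x \<partial>M) = 0" if "j < K" "k < K" for j k
    using L2_functions_integrable[OF eeL[OF that]] on[OF that] by (simp add: Y_def prob_space)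
  define \<kappa> where "\<kappa> = 1 / (2 * (real K + 1))"
  have \<kappa>: "0 < \<kappa>" by (simp add: \<kappa>_def)
  \<comment> \<open>The union bound over all pairs (j, k) gives failure probability at most V / (N
    \<kappa>^2), and \<open>N1\<close> is chosen to bring this below \<delta>.\<close>
  define V where "V = (\<Sum>j<K. \<Sum>k<K. \<integral>x. (Y j k x)\<^sup>2 \<partial>M)"
  have V0: "0 \<le> V" by (simp add: V_def sum_nonneg)
  obtain N1 :: nat where N1: "V / (\<kappa>\<^sup>2 * \<delta>) < real N1" using reals_Archimedean2 by blast
  show ?thesis
  proof (intro exI[of _ "Suc N1"] allI impI)
    fix N assume N: "Suc N1 \<le> N"
    let ?P = "\<Pi>\<^sub>M a\<in>{..<N}. M"
    interpret P: prob_space ?P by (intro prob_space_PiM prob_space_axioms)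
    have N0: "0 < N" "real N > 0" using N by simp_all
    have comp: "(\<lambda>s. f (s a)) \<in> borel_measurable ?P" if "f \<in> borel_measurable M" "a < N" for f :: "'a \<Rightarrow> real" and a
      using that(2) by (intro measurable_compose[of "\<lambda>s. s a" ?P M f, OF _ that(1)]) simp
    define bad where "bad j k = {s \<in> space ?P. \<kappa> \<le> \<bar>(\<Sum>a<N. Y j k (s a)) / real N\<bar>}" for j k
    have bad_sets: "bad j k \<in> sets ?P" if "j < K" "k < K" for j k
    proof -
      have [measurable]: "(\<lambda>s. \<Sum>a<N. Y j k (s a)) \<in> borel_measurable ?P"
        using L2_functionsD(1)[OF YL[OF that]] by (intro borel_measurable_sum comp) auto
      show ?thesis unfolding bad_def by measurable
    qed
    have bad_prob: "P.prob (bad j k) \<le> (\<integral>x. (Y j k x)\<^sup>2 \<partial>M) / (real N * \<kappa>\<^sup>2)" if "j < K" "k < K" for j k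
      unfolding bad_def by (rule prob_empirical_mean_le[OF YL[OF that] Y0[OF that] \<kappa> N0(1)])
    define Bad where "Bad = (\<Union>(j, k)\<in>{..<K} \<times> {..<K}. bad j k)"
    have Bad_sets: "Bad \<in> sets ?P" unfolding Bad_def using bad_sets by (intro sets.finite_UN) auto
    have "P.prob Bad \<le> (\<Sum>p\<in>{..<K} \<times> {..<K}. P.prob (case p of (j, k) \<Rightarrow> bad j k))"
      unfolding Bad_def using bad_sets by (intro P.finite_measure_subadditive_finite) auto
    also have "\<dots> \<le> (\<Sum>(j, k)\<in>{..<K} \<times> {..<K}. (\<integral>x. (Y j k x)\<^sup>2 \<partial>M) / (real N * \<kappa>\<^sup>2))"
      using bad_prob by (intro sum_mono) auto
    also have "\<dots> = V / (real N * \<kappa>\<^sup>2)"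
      by (simp add: V_def sum.cartesian_product[symmetric] sum_divide_distrib)
    also have "\<dots> \<le> \<delta>"
    proof -
      have "V / (\<kappa>\<^sup>2 * \<delta>) < real N" using N1 N by linarith
      then have "V < real N * (\<kappa>\<^sup>2 * \<delta>)" using \<kappa> \<delta> by (simp add: pos_divide_less_eq)
      then show ?thesis using \<kappa> N0 by (simp add: pos_divide_le_eq ac_simps)
    qed
    finally have Bad_prob: "P.prob Bad \<le> \<delta>" .
    \<comment> \<open>The expansion of g b holds only almost everywhere but is evaluated at sample
      points; this event excludes samples that hit an exceptional point and has probability
      1.\<close>
    define Good where "Good = {s \<in> space ?P. \<forall>a\<in>{..<N}. \<forall>b\<in>{..<m}. g b (s a) = (\<Sum>k<K. B b k * e k (s a))}"
    have Good_sets: "Good \<in> sets ?P"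
    proof -
      have "{s \<in> space ?P. g b (s a) = (\<Sum>k<K. B b k * e k (s a))} \<in> sets ?P" if "a < N" "b < m" for a b
      proof (rule borel_measurable_eq)
        show "(\<lambda>s. g b (s a)) \<in> borel_measurable ?P" by (rule comp[OF g(1)[OF that(2)] that(1)])
        show "(\<lambda>s. \<Sum>k<K. B b k * e k (s a)) \<in> borel_measurable ?P"
          by (intro borel_measurable_sum borel_measurable_times borel_measurable_const comp[OF e_meas that(1)]) simp
      qed
      then have "{s \<in> space ?P. \<forall>a\<in>{..<N}. \<forall>b\<in>{..<m}. g b (s a) = (\<Sum>k<K. B b k * e k (s a))} \<in> sets ?P"
        by (intro sets.sets_Collect_finite_All) auto
      then show ?thesis by (simp only: Good_def)
    qed
    have Good_AE: "AE s in ?P. s \<in> Good"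
    proof -
      have "AE s in ?P. g b (s a) = (\<Sum>k<K. B b k * e k (s a))" if "a < N" "b < m" for a b
        using AE_PiM_component[of "{..<N}" "\<lambda>_. M" a "\<lambda>x. g b x = (\<Sum>k<K. B b k * e k x)"] B that prob_space_axioms
        by simp
      then have "AE s in ?P. \<forall>a\<in>{..<N}. \<forall>b\<in>{..<m}. g b (s a) = (\<Sum>k<K. B b k * e k (s a))"
        by (intro AE_finite_allI) auto
      then show ?thesis using AE_space by eventually_elim (simp add: Good_def)
    qed
    show "\<exists>A\<in>sets ?P. 1 - \<delta> \<le> P.prob A \<and>
      (\<forall>s\<in>A. \<forall>v. real N * (\<integral>x. (\<Sum>b<m. v b * g b x)\<^sup>2 \<partial>M) \<le> 2 * (\<Sum>a<N. (\<Sum>b<m. v b * g b (s a))\<^sup>2))"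
    proof (intro bexI[of _ "Good - Bad"] conjI ballI allI)
      show "Good - Bad \<in> sets ?P" using Good_sets Bad_sets by simp
      have "P.prob (space ?P - Bad) = 1 - P.prob Bad" by (rule P.prob_compl[OF Bad_sets])
      moreover have "P.prob (Good - Bad) = P.prob (space ?P - Bad)"
      proof (rule P.finite_measure_eq_AE)
        show "AE s in ?P. (s \<in> Good - Bad) = (s \<in> space ?P - Bad)"
          using Good_AE by eventually_elim (auto simp: Good_def)
      qed (use Good_sets Bad_sets in auto)
      ultimately show "1 - \<delta> \<le> P.prob (Good - Bad)" using Bad_prob by simp
    next
      fix s and v :: "nat \<Rightarrow> real" assume s: "s \<in> Good - Bad"
      \<comment> \<open>These are coordinates of the combination of the g b with weights v in the
        basis e; on the event they are valid for the empirical and the true norm alike.\<close>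
      define w where "w k = (\<Sum>b<m. v b * B b k)" for k
      have repr: "(\<Sum>b<m. v b * (\<Sum>k<K. B b k * y k)) = (\<Sum>k<K. w k * y k)" for y :: "nat \<Rightarrow> real"
        unfolding w_def sum_distrib_left sum_distrib_right by (subst sum.swap) (simp add: mult.assoc)
      have emp: "(\<Sum>b<m. v b * g b (s a)) = (\<Sum>k<K. w k * e k (s a))" if "a < N" for a
        using s that unfolding repr[symmetric] by (intro sum.cong refl) (simp add: Good_def)
      have "AE x in M. \<forall>b\<in>{..<m}. g b x = (\<Sum>k<K. B b k * e k x)"
        using B by (intro AE_finite_allI) auto
      then have "AE x in M. (\<Sum>b<m. v b * g b x)\<^sup>2 = (\<Sum>k<K. w k * e k x)\<^sup>2"
        by eventually_elim (simp add: repr[symmetric])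
      then have "(\<integral>x. (\<Sum>b<m. v b * g b x)\<^sup>2 \<partial>M) = (\<integral>x. (\<Sum>k<K. w k * e k x)\<^sup>2 \<partial>M)"
        using g(1) e_meas
        by (intro Bochner_Integration.integral_cong_AE borel_measurable_power borel_measurable_sum
            borel_measurable_times borel_measurable_const) auto
      also have "\<dots> = (\<Sum>k<K. (w k)\<^sup>2)" by (rule orthonormal_norm_sum[OF e])
      finally have true: "(\<integral>x. (\<Sum>b<m. v b * g b x)\<^sup>2 \<partial>M) = (\<Sum>k<K. (w k)\<^sup>2)" .
      define G where "G j k = (\<Sum>a<N. e j (s a) * e k (s a)) / real N" for j k
      have "\<bar>G j k - (if j = k then 1 else 0)\<bar> \<le> \<kappa>" if "j < K" "k < K" for j k
      proof -
        have eq: "(\<Sum>a<N. Y j k (s a)) / real N = G j k - (if j = k then 1 else 0)"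
          using N0 by (simp add: Y_def G_def sum_subtractf diff_divide_distrib)
        have "s \<notin> bad j k" using s that by (auto simp: Bad_def)
        moreover have "s \<in> space ?P" using s by (simp add: Good_def)
        ultimately have "\<not> \<kappa> \<le> \<bar>(\<Sum>a<N. Y j k (s a)) / real N\<bar>" unfolding bad_def by blast
        then show ?thesis unfolding eq by linarith
      qed
      then have "(\<Sum>k<K. (w k)\<^sup>2) \<le> 2 * (\<Sum>j<K. \<Sum>k<K. w j * w k * G j k)"
        unfolding \<kappa>_def by (rule weighted_gram_lower_bound)
      also have "(\<Sum>j<K. \<Sum>k<K. w j * w k * G j k) = (\<Sum>a<N. (\<Sum>k<K. w k * e k (s a))\<^sup>2) / real N"
      proof -
        have "(\<Sum>a<N. (\<Sum>k<K. w k * e k (s a))\<^sup>2)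
            = (\<Sum>a<N. \<Sum>j<K. \<Sum>k<K. w j * w k * (e j (s a) * e k (s a)))"
          by (simp add: power2_eq_square sum_product ac_simps)
        also have "\<dots> = (\<Sum>j<K. \<Sum>a<N. \<Sum>k<K. w j * w k * (e j (s a) * e k (s a)))" by (rule sum.swap)
        also have "\<dots> = (\<Sum>j<K. \<Sum>k<K. \<Sum>a<N. w j * w k * (e j (s a) * e k (s a)))"
        proof (rule sum.cong[OF refl])
          fix j
          show "(\<Sum>a<N. \<Sum>k<K. w j * w k * (e j (s a) * e k (s a)))
              = (\<Sum>k<K. \<Sum>a<N. w j * w k * (e j (s a) * e k (s a)))"
            by (rule sum.swap)
        qed
        also have "\<dots> = (\<Sum>j<K. \<Sum>k<K. w j * w k * G j k) * real N"
          unfolding sum_distrib_right G_def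
          by (intro sum.cong refl) (use N0 in \<open>simp add: sum_distrib_left[symmetric]\<close>)
        finally show ?thesis using N0 by simp
      qed
      finally show "real N * (\<integral>x. (\<Sum>b<m. v b * g b x)\<^sup>2 \<partial>M) \<le> 2 * (\<Sum>a<N. (\<Sum>b<m. v b * g b (s a))\<^sup>2)"
        unfolding true using N0 by (simp add: emp pos_le_divide_eq mult.commute)
    qed
  qed
qed

end

section \<open>Deterministic error bound for given supports\<close>

lemma power2_add_le: "(x + y :: real)\<^sup>2 \<le> 2 * x\<^sup>2 + 2 * y\<^sup>2"
  using sum_squares_bound[of x y] by (simp add: power2_sum)

context pair_prob_space
begin

text \<open>The error splits as D + E with E the error of the competitor d and D the distance from d
  to the ridge solution c. For fixed y the function D(., y) lies in the span of the R(., t b), so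
  \<open>norm\<close> bounds it by its values at the items, where both c and d have small residuals.
  The result does not contain l, which enters only through l |d|^2 \<le> m C^2.\<close>

lemma CUR_reg_error_bound:
  fixes R :: "'a \<times> 'b \<Rightarrow> real" and d :: "'b \<Rightarrow> nat \<Rightarrow> real" and N m :: nat
    and s :: "nat \<Rightarrow> 'a" and t :: "nat \<Rightarrow> 'b"
  assumes R: "R \<in> L2_functions MM" and N: "0 < N" and l: "0 < l" "l < 1"
    and s: "\<And>a. a < N \<Longrightarrow> s a \<in> space M1" and t: "\<And>b. b < m \<Longrightarrow> t b \<in> space M2"
    and gL: "\<And>b. b < m \<Longrightarrow> (\<lambda>x. R (x, t b)) \<in> L2_functions M1"
    and d: "\<And>b. b < m \<Longrightarrow> (\<lambda>y. d y b) \<in> borel_measurable M2" "\<And>y b. b < m \<Longrightarrow> \<bar>d y b\<bar> \<le> C"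
    and \<eta>: "0 \<le> \<eta>" "(\<integral>\<^sup>+z. ennreal (((\<Sum>b<m. R (fst z, t b) * d (snd z) b) - R z)\<^sup>2) \<partial>MM) \<le> ennreal \<eta>"
    and norm: "\<And>v. real N * (\<integral>x. (\<Sum>b<m. v b * R (x, t b))\<^sup>2 \<partial>M1) \<le> 2 * (\<Sum>a<N. (\<Sum>b<m. v b * R (s a, t b))\<^sup>2)"
    and \<kappa>: "0 \<le> \<kappa>"
      "(\<Sum>a<N. \<integral>\<^sup>+y. ennreal (((\<Sum>b<m. R (s a, t b) * d y b) - R (s a, y))\<^sup>2) \<partial>M2) \<le> ennreal (real N * \<kappa>)"
  shows "CUR_reg l R N m s t \<in> L2_functions MM"
    and "(\<integral>z. (CUR_reg l R N m s t z - R z)\<^sup>2 \<partial>MM) \<le> 16 * \<kappa> + 8 * (real m * C\<^sup>2 / real N) + 2 * \<eta>"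
proof -
  define c where "c y b = (\<Sum>a<N. ridge_coeff l R N m s t b a * R (s a, y))" for y b
  define D where "D z = (\<Sum>b<m. (c (snd z) b - d (snd z) b) * R (fst z, t b))" for z
  define E where "E z = (\<Sum>b<m. R (fst z, t b) * d (snd z) b) - R z" for z
  define e where "e a y = (\<Sum>b<m. R (s a, t b) * d y b) - R (s a, y)" for a y
  \<comment> \<open>Contribution of the penalty: l |d|^2 \<le> m C^2 is doubled when the two
    residuals are added, doubled again by the comparison of norms, and divided by N.\<close>
  define \<Lambda> where "\<Lambda> = 4 * (real m * C\<^sup>2 / real N)"
  have \<Lambda>0: "0 \<le> \<Lambda>" by (simp add: \<Lambda>_def)
  have R_meas: "R \<in> borel_measurable MM" using R by (rule L2_functionsD)
  have g_meas: "(\<lambda>z. R (fst z, t b)) \<in> borel_measurable MM" if "b < m" for b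
    using gL[OF that] by (intro measurable_compose[OF measurable_fst]) (rule L2_functionsD)
  have Rs_meas: "(\<lambda>y. R (s a, y)) \<in> borel_measurable M2" if "a < N" for a
    by (rule measurable_compose_Pair1[OF s[OF that] R_meas])
  have c_meas: "(\<lambda>y. c y b) \<in> borel_measurable M2" for b
    unfolding c_def by (intro borel_measurable_sum borel_measurable_times borel_measurable_const Rs_meas) simp
  have D_meas: "D \<in> borel_measurable MM"
    unfolding D_def using g_meas
    by (intro borel_measurable_sum borel_measurable_times borel_measurable_diff
        measurable_compose[OF measurable_snd c_meas] measurable_compose[OF measurable_snd d(1)]) auto
  have E_meas: "E \<in> borel_measurable MM"
    unfolding E_def using g_meas
    by (intro borel_measurable_sum borel_measurable_times borel_measurable_diff R_meas
        measurable_compose[OF measurable_snd d(1)]) auto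
  have e_meas: "e a \<in> borel_measurable M2" if "a < N" for a
    unfolding e_def using d(1)
    by (intro borel_measurable_sum borel_measurable_times borel_measurable_diff Rs_meas[OF that]
        borel_measurable_const) auto
  have CUR: "CUR_reg l R N m s t z - R z = D z + E z" for z
  proof -
    have "CUR_reg l R N m s t z = (\<Sum>b<m. R (fst z, t b) * c (snd z) b)"
      using CUR_reg_eq_sum[OF l(1), of R N m s t "fst z" "snd z"] by (simp add: c_def)
    then show ?thesis
      by (simp add: D_def E_def sum_subtractf left_diff_distrib right_diff_distrib mult.commute)
  qed
  have D_section: "(\<integral>\<^sup>+x. ennreal ((D (x, y))\<^sup>2) \<partial>M1)
      \<le> ennreal (8 / real N) * (\<Sum>a<N. ennreal ((e a y)\<^sup>2)) + ennreal \<Lambda>" for y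
  proof -
    let ?v = "\<lambda>b. c y b - d y b"
    have D_L2: "(\<lambda>x. \<Sum>b<m. ?v b * R (x, t b)) \<in> L2_functions M1"
      by (intro L2_functions_sum L2_functions_cmult gL) simp
    have opt: "(\<Sum>a<N. ((\<Sum>b<m. R (s a, t b) * c y b) - R (s a, y))\<^sup>2)
        \<le> (\<Sum>a<N. (e a y)\<^sup>2) + l * (\<Sum>b<m. (d y b)\<^sup>2)"
      unfolding c_def e_def by (rule ridge_coeff_optimal[OF l(1)])
    have d2: "l * (\<Sum>b<m. (d y b)\<^sup>2) \<le> real m * C\<^sup>2"
    proof -
      have "(\<Sum>b<m. (d y b)\<^sup>2) \<le> (\<Sum>b<m. C\<^sup>2)"
        using d(2) by (intro sum_mono) (simp add: abs_le_square_iff[symmetric] order_trans[OF _ abs_ge_self])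
      then have "(\<Sum>b<m. (d y b)\<^sup>2) \<le> real m * C\<^sup>2" by simp
      moreover have "l * (\<Sum>b<m. (d y b)\<^sup>2) \<le> 1 * (\<Sum>b<m. (d y b)\<^sup>2)"
        using l by (intro mult_right_mono) (auto simp: sum_nonneg)
      ultimately show ?thesis by simp
    qed
    have "(\<Sum>a<N. (\<Sum>b<m. ?v b * R (s a, t b))\<^sup>2)
        \<le> (\<Sum>a<N. 2 * ((\<Sum>b<m. R (s a, t b) * c y b) - R (s a, y))\<^sup>2 + 2 * (e a y)\<^sup>2)"
    proof (rule sum_mono)
      fix a
      have "(\<Sum>b<m. ?v b * R (s a, t b)) = ((\<Sum>b<m. R (s a, t b) * c y b) - R (s a, y)) + (- e a y)"
        by (simp add: e_def left_diff_distrib right_diff_distrib sum_subtractf mult.commute)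
      then show "(\<Sum>b<m. ?v b * R (s a, t b))\<^sup>2
          \<le> 2 * ((\<Sum>b<m. R (s a, t b) * c y b) - R (s a, y))\<^sup>2 + 2 * (e a y)\<^sup>2"
        using power2_add_le[of "(\<Sum>b<m. R (s a, t b) * c y b) - R (s a, y)" "- e a y"] by simp
    qed
    also have "\<dots> = 2 * (\<Sum>a<N. ((\<Sum>b<m. R (s a, t b) * c y b) - R (s a, y))\<^sup>2) + 2 * (\<Sum>a<N. (e a y)\<^sup>2)"
      by (simp add: sum.distrib sum_distrib_left)
    \<comment> \<open>Optimality of c replaces its residual by that of d plus the penalty, so only
      quantities of the competitor remain.\<close>
    also have "\<dots> \<le> 4 * (\<Sum>a<N. (e a y)\<^sup>2) + 2 * (real m * C\<^sup>2)" using opt d2 by linarith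
    finally have "real N * (\<integral>x. (\<Sum>b<m. ?v b * R (x, t b))\<^sup>2 \<partial>M1)
        \<le> 8 * (\<Sum>a<N. (e a y)\<^sup>2) + 4 * (real m * C\<^sup>2)" using norm[of ?v] by linarith
    then have bound: "(\<integral>x. (\<Sum>b<m. ?v b * R (x, t b))\<^sup>2 \<partial>M1) \<le> 8 / real N * (\<Sum>a<N. (e a y)\<^sup>2) + \<Lambda>"
      using N by (simp add: \<Lambda>_def field_simps)
    have int: "(\<integral>\<^sup>+x. ennreal ((D (x, y))\<^sup>2) \<partial>M1) = ennreal (\<integral>x. (\<Sum>b<m. ?v b * R (x, t b))\<^sup>2 \<partial>M1)"
      unfolding D_def using L2_functionsD(2)[OF D_L2] by (subst nn_integral_eq_integral) auto
    have "ennreal (8 / real N * (\<Sum>a<N. (e a y)\<^sup>2) + \<Lambda>)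
        = ennreal (8 / real N * (\<Sum>a<N. (e a y)\<^sup>2)) + ennreal \<Lambda>"
      using \<Lambda>0 by (intro ennreal_plus) (simp_all add: sum_nonneg)
    also have "ennreal (8 / real N * (\<Sum>a<N. (e a y)\<^sup>2)) = ennreal (8 / real N) * ennreal (\<Sum>a<N. (e a y)\<^sup>2)"
      by (intro ennreal_mult) (simp_all add: sum_nonneg)
    also have "ennreal (\<Sum>a<N. (e a y)\<^sup>2) = (\<Sum>a<N. ennreal ((e a y)\<^sup>2))"
      by (rule sum_ennreal[symmetric]) simp
    finally show ?thesis unfolding int using ennreal_leI[OF bound] by simp
  qed
  have D_int: "(\<integral>\<^sup>+z. ennreal ((D z)\<^sup>2) \<partial>MM) \<le> ennreal (8 * \<kappa> + \<Lambda>)"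
  proof -
    have D2: "(\<lambda>z. ennreal ((D z)\<^sup>2)) \<in> borel_measurable MM" using D_meas by measurable
    have e2: "(\<lambda>y. ennreal ((e a y)\<^sup>2)) \<in> borel_measurable M2" if "a < N" for a
      using e_meas[OF that] by measurable
    have e2s: "(\<lambda>y. \<Sum>a<N. ennreal ((e a y)\<^sup>2)) \<in> borel_measurable M2"
      using e2 by (intro borel_measurable_sum) auto
    then have e2s': "(\<lambda>y. ennreal (8 / real N) * (\<Sum>a<N. ennreal ((e a y)\<^sup>2))) \<in> borel_measurable M2"
      by measurable
    have "(\<integral>\<^sup>+z. ennreal ((D z)\<^sup>2) \<partial>MM) = (\<integral>\<^sup>+y. \<integral>\<^sup>+x. ennreal ((D (x, y))\<^sup>2) \<partial>M1 \<partial>M2)"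
      by (rule nn_integral_snd[OF D2, symmetric])
    also have "\<dots> \<le> (\<integral>\<^sup>+y. ennreal (8 / real N) * (\<Sum>a<N. ennreal ((e a y)\<^sup>2)) + ennreal \<Lambda> \<partial>M2)"
      by (rule nn_integral_mono[OF D_section])
    also have "\<dots> = ennreal (8 / real N) * (\<Sum>a<N. \<integral>\<^sup>+y. ennreal ((e a y)\<^sup>2) \<partial>M2) + ennreal \<Lambda>"
      unfolding nn_integral_add[OF e2s' borel_measurable_const] nn_integral_cmult[OF e2s]
      using e2 by (subst nn_integral_sum) (auto simp: M2.emeasure_space_1)
    also have "\<dots> \<le> ennreal (8 / real N) * ennreal (real N * \<kappa>) + ennreal \<Lambda>"
      using \<kappa>(2) by (intro add_right_mono mult_left_mono) (simp_all add: e_def)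
    also have "\<dots> = ennreal (8 * \<kappa> + \<Lambda>)"
      using N \<kappa>(1) \<Lambda>0 by (simp add: ennreal_mult[symmetric] ennreal_plus[symmetric] del: ennreal_plus)
    finally show ?thesis .
  qed
  have sum_meas: "(\<lambda>z. D z + E z) \<in> borel_measurable MM" using D_meas E_meas by measurable
  have total: "(\<integral>\<^sup>+z. ennreal ((D z + E z)\<^sup>2) \<partial>MM) \<le> ennreal (16 * \<kappa> + 2 * \<Lambda> + 2 * \<eta>)"
  proof -
    have D2: "(\<lambda>z. 2 * ennreal ((D z)\<^sup>2)) \<in> borel_measurable MM" "(\<lambda>z. ennreal ((D z)\<^sup>2)) \<in> borel_measurable MM"
      and E2: "(\<lambda>z. 2 * ennreal ((E z)\<^sup>2)) \<in> borel_measurable MM" "(\<lambda>z. ennreal ((E z)\<^sup>2)) \<in> borel_measurable MM"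
      using D_meas E_meas by measurable
    have "(\<integral>\<^sup>+z. ennreal ((D z + E z)\<^sup>2) \<partial>MM) \<le> (\<integral>\<^sup>+z. 2 * ennreal ((D z)\<^sup>2) + 2 * ennreal ((E z)\<^sup>2) \<partial>MM)"
    proof (rule nn_integral_mono)
      fix z
      have "ennreal ((D z + E z)\<^sup>2) \<le> ennreal (2 * (D z)\<^sup>2 + 2 * (E z)\<^sup>2)" by (intro ennreal_leI power2_add_le)
      then show "ennreal ((D z + E z)\<^sup>2) \<le> 2 * ennreal ((D z)\<^sup>2) + 2 * ennreal ((E z)\<^sup>2)"
        by (simp add: ennreal_plus ennreal_mult)
    qed
    also have "\<dots> = 2 * (\<integral>\<^sup>+z. ennreal ((D z)\<^sup>2) \<partial>MM) + 2 * (\<integral>\<^sup>+z. ennreal ((E z)\<^sup>2) \<partial>MM)"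
      unfolding nn_integral_add[OF D2(1) E2(1)] nn_integral_cmult[OF D2(2)] nn_integral_cmult[OF E2(2)] ..
    also have "\<dots> \<le> 2 * ennreal (8 * \<kappa> + \<Lambda>) + 2 * ennreal \<eta>"
      using \<eta>(2) by (intro add_mono mult_left_mono D_int) (simp_all add: E_def)
    also have "\<dots> = ennreal (2 * (8 * \<kappa> + \<Lambda>) + 2 * \<eta>)"
      using \<kappa>(1) \<eta>(1) \<Lambda>0 by (simp add: ennreal_plus ennreal_mult)
    finally show ?thesis by (simp add: algebra_simps)
  qed
  \<comment> \<open>Square integrability is a conclusion here: the nonnegative integral of the
    squared error is finite, so the error lies in L2, and adding R gives the approximation
    itself.\<close>
  then have "(\<integral>\<^sup>+z. ennreal ((D z + E z)\<^sup>2) \<partial>MM) < \<infinity>" by (rule order.strict_trans1) simp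
  then have DE: "(\<lambda>z. D z + E z) \<in> L2_functions MM"
    using L2_functions_iff_nn_integral[OF sum_meas] by simp
  have "CUR_reg l R N m s t = (\<lambda>z. (D z + E z) + R z)" using CUR by (auto simp: fun_eq_iff algebra_simps)
  then show "CUR_reg l R N m s t \<in> L2_functions MM" using L2_functions_add[OF DE R] by simp
  have "ennreal (\<integral>z. (D z + E z)\<^sup>2 \<partial>MM) \<le> ennreal (16 * \<kappa> + 2 * \<Lambda> + 2 * \<eta>)"
    using total L2_functionsD(2)[OF DE] by (subst (asm) nn_integral_eq_integral) auto
  then have "(\<integral>z. (D z + E z)\<^sup>2 \<partial>MM) \<le> 16 * \<kappa> + 2 * \<Lambda> + 2 * \<eta>"
    using \<kappa>(1) \<eta>(1) \<Lambda>0 by (subst (asm) ennreal_le_iff) auto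
  then show "(\<integral>z. (CUR_reg l R N m s t z - R z)\<^sup>2 \<partial>MM) \<le> 16 * \<kappa> + 8 * (real m * C\<^sup>2 / real N) + 2 * \<eta>"
    unfolding CUR by (simp add: \<Lambda>_def)
qed

end

section \<open>Random items with fixed queries\<close>

text \<open>Markov's inequality in complementary form: if the mean is at most the fraction q of the
  threshold c, then the threshold is exceeded with probability at most q.\<close>

lemma (in prob_space) prob_le_of_nn_integral_le:
  assumes F [measurable]: "F \<in> borel_measurable M" and q: "0 \<le> q" and c: "0 < c"
    and le: "(\<integral>\<^sup>+x. F x \<partial>M) \<le> ennreal (q * c)"
  shows "1 - q \<le> prob {x \<in> space M. F x \<le> ennreal c}"
proof -
  have "emeasure M {x \<in> space M. 1 \<le> ennreal (1 / c) * F x}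
      \<le> ennreal (1 / c) * (\<integral>\<^sup>+x. F x * indicator (space M) x \<partial>M)"
    by (rule nn_integral_Markov_inequality) auto
  also have "(\<integral>\<^sup>+x. F x * indicator (space M) x \<partial>M) = (\<integral>\<^sup>+x. F x \<partial>M)"
    by (intro nn_integral_cong) auto
  also have "ennreal (1 / c) * \<dots> \<le> ennreal (1 / c) * ennreal (q * c)"
    using le by (rule mult_left_mono) simp
  also have "\<dots> = ennreal q" using c q by (simp add: ennreal_mult[symmetric])
  finally have "prob {x \<in> space M. 1 \<le> ennreal (1 / c) * F x} \<le> q"
    using q by (simp add: emeasure_eq_measure)
  moreover have "prob {x \<in> space M. \<not> F x \<le> ennreal c} \<le> prob {x \<in> space M. 1 \<le> ennreal (1 / c) * F x}"
  proof (rule finite_measure_mono)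
    show "{x \<in> space M. \<not> F x \<le> ennreal c} \<subseteq> {x \<in> space M. 1 \<le> ennreal (1 / c) * F x}"
    proof safe
      fix x assume "\<not> F x \<le> ennreal c"
      then have "ennreal (1 / c) * ennreal c \<le> ennreal (1 / c) * F x" by (intro mult_left_mono) auto
      then show "1 \<le> ennreal (1 / c) * F x" using c by (simp add: ennreal_mult[symmetric])
    qed
  qed measurable
  moreover have "prob {x \<in> space M. \<not> F x \<le> ennreal c} = 1 - prob {x \<in> space M. F x \<le> ennreal c}"
    by (rule prob_neg) measurable
  ultimately show ?thesis by linarith
qed

context pair_prob_space
begin

text \<open>Two events of probability at least 1 - \<delta> are intersected: the comparison of norms
  on the span, and smallness of the empirical error of d. Neither they nor the threshold
  \<open>N0\<close> involve l, so the threshold serves all l below 1.\<close>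

lemma CUR_reg_close_for_fixed_queries:
  fixes R :: "'a \<times> 'b \<Rightarrow> real" and d :: "'b \<Rightarrow> nat \<Rightarrow> real" and m :: nat and t :: "nat \<Rightarrow> 'b"
  assumes R: "R \<in> L2_functions MM"
    and t: "\<And>b. b < m \<Longrightarrow> t b \<in> space M2"
    and g4: "\<And>b. b < m \<Longrightarrow> integrable M1 (\<lambda>x. R (x, t b) ^ 4)"
    and d: "\<And>b. b < m \<Longrightarrow> (\<lambda>y. d y b) \<in> borel_measurable M2" "\<And>y b. b < m \<Longrightarrow> \<bar>d y b\<bar> \<le> C"
    and \<eta>: "0 \<le> \<eta>" "(\<integral>\<^sup>+z. ennreal (((\<Sum>b<m. R (fst z, t b) * d (snd z) b) - R z)\<^sup>2) \<partial>MM) \<le> ennreal \<eta>"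
    and \<kappa>: "0 < \<kappa>" and \<delta>: "0 < \<delta>" "\<eta> \<le> \<delta> * \<kappa>" and \<rho>: "0 < \<rho>"
  shows "\<exists>N0. \<forall>N\<ge>N0. \<forall>l. 0 < l \<and> l < 1 \<longrightarrow> (\<exists>A\<in>sets (\<Pi>\<^sub>M a\<in>{..<N}. M1).
    1 - 2 * \<delta> \<le> measure (\<Pi>\<^sub>M a\<in>{..<N}. M1) A \<and> (\<forall>s\<in>A. CUR_reg l R N m s t \<in> L2_functions MM \<and>
      (\<integral>z. (CUR_reg l R N m s t z - R z)\<^sup>2 \<partial>MM) \<le> 16 * \<kappa> + \<rho> + 2 * \<eta>))"
proof -
  have R_meas: "R \<in> borel_measurable MM" using R by (rule L2_functionsD)
  have g_meas: "(\<lambda>x. R (x, t b)) \<in> borel_measurable M1" if "b < m" for b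
    by (rule measurable_Pair1[OF R_meas t[OF that]])
  obtain N1 where N1: "\<And>N. N1 \<le> N \<Longrightarrow> \<exists>A\<in>sets (\<Pi>\<^sub>M a\<in>{..<N}. M1). 1 - \<delta> \<le> measure (\<Pi>\<^sub>M a\<in>{..<N}. M1) A \<and>
    (\<forall>s\<in>A. \<forall>v. real N * (\<integral>x. (\<Sum>b<m. v b * R (x, t b))\<^sup>2 \<partial>M1) \<le> 2 * (\<Sum>a<N. (\<Sum>b<m. v b * R (s a, t b))\<^sup>2))"
    using M1.empirical_norm_dominates[of m "\<lambda>b x. R (x, t b)", OF g_meas g4 \<delta>(1)] by blast
  \<comment> \<open>From this size on, the penalty term of the deterministic bound is at most
    \<rho>.\<close>
  obtain N2 :: nat where N2: "8 * (real m * C\<^sup>2) / \<rho> < real N2" using reals_Archimedean2 by blast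
  define h where "h x = (\<integral>\<^sup>+y. ennreal (((\<Sum>b<m. R (x, t b) * d y b) - R (x, y))\<^sup>2) \<partial>M2)" for x
  have err_meas: "(\<lambda>z. ennreal (((\<Sum>b<m. R (fst z, t b) * d (snd z) b) - R z)\<^sup>2)) \<in> borel_measurable MM"
    using g_meas d(1)
    by (intro measurable_compose[OF _ measurable_ennreal] borel_measurable_power borel_measurable_diff
        borel_measurable_sum borel_measurable_times R_meas measurable_compose[OF measurable_fst, of "\<lambda>x. R (x, _)"]
        measurable_compose[OF measurable_snd, of "\<lambda>y. d y _"]) auto
  have h_meas: "h \<in> borel_measurable M1"
    using M2.borel_measurable_nn_integral_fst[OF err_meas] by (simp add: h_def[abs_def])
  have h_int: "(\<integral>\<^sup>+x. h x \<partial>M1) \<le> ennreal \<eta>"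
    using M2.nn_integral_fst[OF err_meas] \<eta>(2) by (simp add: h_def)
  show ?thesis
  proof (intro exI[of _ "Suc (max N1 N2)"] allI impI)
    fix N and l :: real assume N: "Suc (max N1 N2) \<le> N" and l: "0 < l \<and> l < 1"
    let ?P = "\<Pi>\<^sub>M a\<in>{..<N}. M1"
    interpret S: prob_space ?P by (intro prob_space_PiM M1.prob_space_axioms)
    have N0: "0 < N" "N1 \<le> N" "real N2 < real N" using N by simp_all
    obtain A1 where A1: "A1 \<in> sets ?P" "1 - \<delta> \<le> S.prob A1"
      and norm: "\<And>s v. s \<in> A1 \<Longrightarrow>
        real N * (\<integral>x. (\<Sum>b<m. v b * R (x, t b))\<^sup>2 \<partial>M1) \<le> 2 * (\<Sum>a<N. (\<Sum>b<m. v b * R (s a, t b))\<^sup>2)"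
      using N1[OF N0(2)] by blast
    \<comment> \<open>The sum over the items of the squared error of d has mean at most N \<eta>,
      and \<eta> \<le> \<delta> \<kappa> makes this the fraction \<delta> of the threshold N
      \<kappa> in Markov's inequality.\<close>
    define F where "F s = (\<Sum>a<N. h (s a))" for s
    have hs: "(\<lambda>s. h (s a)) \<in> borel_measurable ?P" if "a < N" for a
      using that by (intro measurable_compose[of "\<lambda>s. s a" ?P M1 h, OF _ h_meas]) simp
    have F_meas: "F \<in> borel_measurable ?P" unfolding F_def using hs by (intro borel_measurable_sum) auto
    have "(\<integral>\<^sup>+s. F s \<partial>?P) = (\<Sum>a<N. \<integral>\<^sup>+s. h (s a) \<partial>?P)"
      unfolding F_def using hs by (intro nn_integral_sum) auto
    also have "\<dots> = (\<Sum>a<N. \<integral>\<^sup>+x. h x \<partial>M1)"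
      by (intro sum.cong refl M1.nn_integral_component h_meas) simp
    also have "\<dots> \<le> (\<Sum>a<N. ennreal \<eta>)" by (intro sum_mono h_int)
    also have "\<dots> = ennreal (real N * \<eta>)" using \<eta>(1) by (simp add: ennreal_mult ennreal_of_nat_eq_real_of_nat)
    also have "\<dots> \<le> ennreal (\<delta> * (real N * \<kappa>))"
      using mult_left_mono[OF \<delta>(2), of "real N"] by (intro ennreal_leI) (simp add: ac_simps)
    finally have F_prob: "1 - \<delta> \<le> S.prob {s \<in> space ?P. F s \<le> ennreal (real N * \<kappa>)}"
      using N0 \<kappa> \<delta> by (intro S.prob_le_of_nn_integral_le F_meas) auto
    define A2 where "A2 = {s \<in> space ?P. F s \<le> ennreal (real N * \<kappa>)}"
    have A2: "A2 \<in> sets ?P" unfolding A2_def using F_meas by measurable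
    show "\<exists>A\<in>sets ?P. 1 - 2 * \<delta> \<le> S.prob A \<and> (\<forall>s\<in>A. CUR_reg l R N m s t \<in> L2_functions MM \<and>
      (\<integral>z. (CUR_reg l R N m s t z - R z)\<^sup>2 \<partial>MM) \<le> 16 * \<kappa> + \<rho> + 2 * \<eta>)"
    proof (intro bexI[of _ "A1 \<inter> A2"] conjI ballI)
      show "A1 \<inter> A2 \<in> sets ?P" using A1(1) A2 by simp
      have "S.prob (A1 \<union> A2) = S.prob A1 + S.prob A2 - S.prob (A1 \<inter> A2)"
        using S.finite_measure_Union'[OF A1(1) A2] S.finite_measure_Diff'[OF A2 A1(1)] by (simp add: Int_commute)
      then show "1 - 2 * \<delta> \<le> S.prob (A1 \<inter> A2)"
        using S.prob_le_1[of "A1 \<union> A2"] A1(2) F_prob by (simp add: A2_def)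
    next
      fix s assume s: "s \<in> A1 \<inter> A2"
      then have "s \<in> space ?P" by (simp add: A2_def)
      then have sp: "s a \<in> space M1" if "a < N" for a using that by (auto simp: space_PiM PiE_def)
      have \<kappa>F: "(\<Sum>a<N. \<integral>\<^sup>+y. ennreal (((\<Sum>b<m. R (s a, t b) * d y b) - R (s a, y))\<^sup>2) \<partial>M2) \<le> ennreal (real N * \<kappa>)"
        using s by (simp add: A2_def F_def h_def)
      have gL: "(\<lambda>x. R (x, t b)) \<in> L2_functions M1" if "b < m" for b
        by (rule M1.L2_functions_of_fourth_power(2)[OF g_meas[OF that] g4[OF that]])
      have sA: "s \<in> A1" using s by simp
      note bound = CUR_reg_error_bound[OF R N0(1) conjunct1[OF l] conjunct2[OF l] sp t gL d \<eta> norm[OF sA] less_imp_le[OF \<kappa>] \<kappa>F]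
      show "CUR_reg l R N m s t \<in> L2_functions MM" by (rule bound(1)) assumption+
      have "8 * (real m * C\<^sup>2 / real N) \<le> \<rho>"
      proof -
        have "8 * (real m * C\<^sup>2) / \<rho> < real N" using N2 N0 by linarith
        then show ?thesis using \<rho> N0 by (simp add: pos_divide_less_eq pos_divide_le_eq ac_simps)
      qed
      moreover have "(\<integral>z. (CUR_reg l R N m s t z - R z)\<^sup>2 \<partial>MM) \<le> 16 * \<kappa> + 8 * (real m * C\<^sup>2 / real N) + 2 * \<eta>"
        by (rule bound(2)) assumption+
      ultimately show "(\<integral>z. (CUR_reg l R N m s t z - R z)\<^sup>2 \<partial>MM) \<le> 16 * \<kappa> + \<rho> + 2 * \<eta>" by linarith
    qed
  qed
qed

text \<open>Measurability is not cosmetic: \<open>measure\<close> is 0 on nonmeasurable sets, so a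
  lower bound on the probability depends on it. The approximation is measurable jointly in the
  supports and the point of evaluation; both conditions of the event are then obtained by
  integrating out the point.\<close>

lemma CUR_close_event_sets:
  fixes R :: "'a \<times> 'b \<Rightarrow> real"
  assumes R [measurable]: "R \<in> borel_measurable MM" and l: "0 < l"
  shows "CUR_close_event M1 M2 R l N m \<epsilon> \<in> sets (support_sample M1 M2 N m)"
proof -
  let ?S = "support_sample M1 M2 N m"
  define f where "f w = CUR_reg l R N m (fst (fst w)) (snd (fst w)) (snd w)" for w
  have R_comp: "(\<lambda>w. R (p w, q w)) \<in> borel_measurable X"
    if "p \<in> X \<rightarrow>\<^sub>M M1" "q \<in> X \<rightarrow>\<^sub>M M2" for p q and X :: "'x measure"
    using measurable_compose[OF measurable_Pair[OF that] R] .
  have s: "(\<lambda>w. fst (fst w) a) \<in> ?S \<Otimes>\<^sub>M MM \<rightarrow>\<^sub>M M1" if "a < N" for a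
  proof -
    have "a \<in> {..<N}" using that by simp
    then show ?thesis unfolding support_sample_def by measurable
  qed
  have t: "(\<lambda>w. snd (fst w) b) \<in> ?S \<Otimes>\<^sub>M MM \<rightarrow>\<^sub>M M2" if "b < m" for b
  proof -
    have "b \<in> {..<m}" using that by simp
    then show ?thesis unfolding support_sample_def by measurable
  qed
  have xy: "(\<lambda>w. fst (snd w)) \<in> ?S \<Otimes>\<^sub>M MM \<rightarrow>\<^sub>M M1" "(\<lambda>w. snd (snd w)) \<in> ?S \<Otimes>\<^sub>M MM \<rightarrow>\<^sub>M M2" by measurable
  have ridge: "(\<lambda>w. ridge_coeff l R N m (fst (fst w)) (snd (fst w)) b a) \<in> borel_measurable (?S \<Otimes>\<^sub>M MM)"
    if "a < N" "b < m" for a b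
    by (rule borel_measurable_ridge_coeff[OF l that]) (rule R_comp[OF s t])
  have f_meas: "f \<in> borel_measurable (?S \<Otimes>\<^sub>M MM)"
  proof -
    have "f = (\<lambda>w. \<Sum>b<m. R (fst (snd w), snd (fst w) b) *
        (\<Sum>a<N. ridge_coeff l R N m (fst (fst w)) (snd (fst w)) b a * R (fst (fst w) a, snd (snd w))))"
    proof
      fix w show "f w = (\<Sum>b<m. R (fst (snd w), snd (fst w) b) *
        (\<Sum>a<N. ridge_coeff l R N m (fst (fst w)) (snd (fst w)) b a * R (fst (fst w) a, snd (snd w))))"
        using CUR_reg_eq_sum[OF l, of R N m "fst (fst w)" "snd (fst w)" "fst (snd w)" "snd (snd w)"] by (simp add: f_def)
    qed
    then show ?thesis
      by (simp only:) (intro borel_measurable_sum borel_measurable_times R_comp s t xy ridge; simp)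
  qed
  have sect: "CUR_reg l R N m (fst \<omega>) (snd \<omega>) \<in> borel_measurable MM" if "\<omega> \<in> space ?S" for \<omega>
    using measurable_compose_Pair1[OF that f_meas] by (simp add: f_def)
  have "CUR_close_event M1 M2 R l N m \<epsilon> = {\<omega> \<in> space ?S. (\<integral>\<^sup>+z. ennreal ((f (\<omega>, z))\<^sup>2) \<partial>MM) < \<infinity> \<and>
      sqrt (\<integral>z. (f (\<omega>, z) - R z)\<^sup>2 \<partial>MM) < \<epsilon>}"
    unfolding CUR_close_event_def L2_dist_def f_def
    using sect by (auto simp: L2_functions_iff_nn_integral)
  moreover have "{\<omega> \<in> space ?S. (\<integral>\<^sup>+z. ennreal ((f (\<omega>, z))\<^sup>2) \<partial>MM) < \<infinity>} \<in> sets ?S"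
  proof -
    have "(\<lambda>w. ennreal ((f w)\<^sup>2)) \<in> borel_measurable (?S \<Otimes>\<^sub>M MM)" using f_meas by measurable
    from P.borel_measurable_nn_integral_fst[OF this] show ?thesis by measurable
  qed
  moreover have "{\<omega> \<in> space ?S. sqrt (\<integral>z. (f (\<omega>, z) - R z)\<^sup>2 \<partial>MM) < \<epsilon>} \<in> sets ?S"
  proof -
    have "(\<lambda>w. (f w - R (snd w))\<^sup>2) \<in> borel_measurable (?S \<Otimes>\<^sub>M MM)" using f_meas by measurable
    then have "(\<lambda>\<omega>. \<integral>z. (f (\<omega>, z) - R z)\<^sup>2 \<partial>MM) \<in> borel_measurable ?S"
      by (intro P.borel_measurable_lebesgue_integral) (simp add: case_prod_unfold)
    then show ?thesis by measurable
  qed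
  ultimately show ?thesis by (auto intro: sets.sets_Collect_conj)
qed

end

section \<open>Random queries and a threshold uniform in them\<close>

text \<open>The sets S n on which the bound holds from n on increase, and their union contains T. By
  continuity from below some S n has probability above r; the strict inequality r < prob T leaves
  the room for this.\<close>

lemma (in prob_space) prob_eventually_ge:
  fixes p :: "nat \<Rightarrow> 'a \<Rightarrow> real"
  assumes p: "\<And>N. p N \<in> borel_measurable M" and T: "T \<in> sets M"
    and ev: "\<And>t. t \<in> T \<Longrightarrow> \<exists>n. \<forall>N\<ge>n. c \<le> p N t" and r: "r < prob T"
  shows "\<exists>n. \<forall>N\<ge>n. r < prob {t \<in> space M. c \<le> p N t}"
proof -
  define S where "S n = {t \<in> space M. \<forall>N\<in>{n..}. c \<le> p N t}" for n
  have pc: "{t \<in> space M. c \<le> p N t} \<in> sets M" for N using p by measurable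
  have S: "S n \<in> sets M" for n
    unfolding S_def using pc by (intro sets.sets_Collect_countable_Ball) auto
  have "(\<lambda>n. prob (S n)) \<longlonglongrightarrow> prob (\<Union>n. S n)"
    using S by (intro finite_Lim_measure_incseq) (auto simp: incseq_def S_def)
  moreover have "prob T \<le> prob (\<Union>n. S n)"
  proof (rule finite_measure_mono)
    show "T \<subseteq> (\<Union>n. S n)"
    proof
      fix t assume t: "t \<in> T"
      then obtain n where "\<forall>N\<ge>n. c \<le> p N t" using ev by blast
      then have "t \<in> S n" using t sets.sets_into_space[OF T] by (auto simp: S_def)
      then show "t \<in> (\<Union>n. S n)" by blast
    qed
    show "(\<Union>n. S n) \<in> sets M" using S by auto
  qed
  ultimately have "\<forall>\<^sub>F n in sequentially. r < prob (S n)"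
    using r by (intro order_tendstoD(1)[of _ "prob (\<Union>n. S n)"]) auto
  then obtain n where n: "r < prob (S n)" by (auto simp: eventually_sequentially)
  have "r < prob {t \<in> space M. c \<le> p N t}" if "n \<le> N" for N
    using n finite_measure_mono[OF _ pc, of "S n" N] that by (force simp: S_def)
  then show ?thesis by blast
qed

text \<open>Tonelli's theorem for the indicator of E, keeping only those sections whose probability
  is at least c. It recombines a statement for most queries with one for most items.\<close>

lemma (in pair_prob_space) prob_pair_ge_of_sections:
  assumes E: "E \<in> sets MM" and c: "0 \<le> c"
  shows "c * M2.prob {y \<in> space M2. c \<le> M1.prob ((\<lambda>x. (x, y)) -` E)} \<le> prob E"
    and "(\<lambda>y. M1.prob ((\<lambda>x. (x, y)) -` E)) \<in> borel_measurable M2"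
proof -
  have em: "(\<lambda>y. emeasure M1 ((\<lambda>x. (x, y)) -` E)) \<in> borel_measurable M2"
    by (rule measurable_emeasure_Pair2[OF E])
  then show pm: "(\<lambda>y. M1.prob ((\<lambda>x. (x, y)) -` E)) \<in> borel_measurable M2"
    unfolding measure_def by measurable
  define S where "S = {y \<in> space M2. c \<le> M1.prob ((\<lambda>x. (x, y)) -` E)}"
  have S: "S \<in> sets M2" unfolding S_def using pm by measurable
  have "ennreal c * emeasure M2 S = (\<integral>\<^sup>+y. ennreal c * indicator S y \<partial>M2)"
    using S by (simp add: nn_integral_cmult_indicator)
  also have "\<dots> \<le> (\<integral>\<^sup>+y. emeasure M1 ((\<lambda>x. (x, y)) -` E) \<partial>M2)"
    by (intro nn_integral_mono) (auto simp: indicator_def S_def M1.emeasure_eq_measure ennreal_leI)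
  also have "\<dots> = emeasure MM E" by (rule emeasure_pair_measure_alt2[OF E, symmetric])
  finally show "c * M2.prob {y \<in> space M2. c \<le> M1.prob ((\<lambda>x. (x, y)) -` E)} \<le> prob E"
    using c by (simp add: S_def[symmetric] M2.emeasure_eq_measure emeasure_eq_measure ennreal_mult[symmetric])
qed

lemma (in pair_prob_space) CUR_close_event_eventually:
  fixes R :: "'a \<times> 'b \<Rightarrow> real"
  assumes R_meas: "R \<in> borel_measurable MM" and R4: "integrable MM (\<lambda>z. R z ^ 4)"
    and \<epsilon>: "0 < \<epsilon>" and \<delta>: "0 < \<delta>" "\<delta> \<le> 1"
  shows "\<exists>m0. \<forall>m\<ge>m0. \<exists>N0. \<forall>N\<ge>N0. \<forall>l. 0 < l \<and> l < 1 \<longrightarrow>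
    1 - \<delta> \<le> measure (support_sample M1 M2 N m) (CUR_close_event M1 M2 R l N m \<epsilon>)"
proof -
  note R = L2_functions_of_fourth_power(2)[OF R_meas R4]
  \<comment> \<open>Error budget: 16 \<kappa> = \<epsilon>^2/4, the penalty term gets
    \<epsilon>^2/8, and 2 \<eta> \<le> \<epsilon>^2/8, in total \<epsilon>^2/2 < \<epsilon>^2.
    Probability budget: \<delta>/4 for the items, as 2 \<delta>' = \<delta>/4, and \<delta>/4 for
    the queries, where bias and variance each get \<delta>/8 times \<eta>. The bound \<eta> \<le>
    \<delta>' \<kappa> is the requirement of the Markov step over the items.\<close>
  define \<kappa> where "\<kappa> = \<epsilon>\<^sup>2 / 64"
  define \<delta>' where "\<delta>' = \<delta> / 8"
  define \<eta> where "\<eta> = min (\<epsilon>\<^sup>2 / 16) (\<delta>' * \<kappa>)"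
  have pos: "0 < \<kappa>" "0 < \<delta>'" "0 < \<eta>" using \<epsilon> \<delta> by (simp_all add: \<kappa>_def \<delta>'_def \<eta>_def)
  have \<eta>\<delta>: "0 < \<delta> / 8 * \<eta>" using pos \<delta> by simp
  obtain k C where k: "case_prod k \<in> borel_measurable (M2 \<Otimes>\<^sub>M M2)" and C: "\<And>q q'. \<bar>k q q'\<bar> \<le> C"
    and bias: "(\<integral>\<^sup>+z. ennreal (((\<integral>q'. k (snd z) q' * R (fst z, q') \<partial>M2) - R z)\<^sup>2) \<partial>MM) \<le> ennreal (\<delta> / 8 * \<eta>)"
    using bounded_kernel_approximation[OF R \<eta>\<delta>] by blast
  define V where "V = C\<^sup>2 * (\<integral>z. (R z)\<^sup>2 \<partial>MM)"
  obtain m1 :: nat where m1: "V / (\<delta> / 8 * \<eta>) < real m1" using reals_Archimedean2 by blast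
  have g4_AE: "AE y in M2. integrable M1 (\<lambda>x. R (x, y) ^ 4)"
  proof -
    interpret Q: pair_prob_space M2 M1 ..
    have "integrable (M2 \<Otimes>\<^sub>M M1) (\<lambda>(y, x). R (x, y) ^ 4)"
      using integrable_product_swap[OF R4] by (simp add: case_prod_unfold)
    from Q.AE_integrable_fst'[OF this] show ?thesis by simp
  qed
  show ?thesis
  proof (rule exI[of _ "Suc m1"], rule allI, rule impI)
    fix m assume m: "Suc m1 \<le> m"
    then have m0: "0 < m" by simp
    let ?Q = "\<Pi>\<^sub>M b\<in>{..<m}. M2"
    interpret Q: prob_space ?Q by (intro prob_space_PiM M2.prob_space_axioms)
    \<comment> \<open>The factor 1/m belongs to the coefficient, so that the competitor is the Monte
      Carlo average for the kernel integral.\<close>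
    define d where "d t y b = k y (t b) / real m" for t :: "nat \<Rightarrow> 'b" and y b
    define err where "err t = (\<integral>\<^sup>+z. ennreal (((\<Sum>b<m. R (fst z, t b) * d t (snd z) b) - R z)\<^sup>2) \<partial>MM)" for t
    have eq: "(\<Sum>b<m. R (fst z, t b) * d t (snd z) b) = (\<Sum>b<m. k (snd z) (t b) * R (fst z, t b)) / real m" for t z
      by (simp add: d_def sum_divide_distrib mult.commute)
    have err_meas: "err \<in> borel_measurable ?Q"
    proof -
      have t: "(\<lambda>w. fst w b) \<in> ?Q \<Otimes>\<^sub>M MM \<rightarrow>\<^sub>M M2" if "b < m" for b
      proof -
        have "b \<in> {..<m}" using that by simp
        then show ?thesis by measurable
      qed
      have Rt: "(\<lambda>w. R (fst (snd w), fst w b)) \<in> borel_measurable (?Q \<Otimes>\<^sub>M MM)" if "b < m" for b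
        by (rule measurable_compose[OF measurable_Pair[OF _ t[OF that]] R_meas]) measurable
      have kt: "(\<lambda>w. d (fst w) (snd (snd w)) b) \<in> borel_measurable (?Q \<Otimes>\<^sub>M MM)" if "b < m" for b
      proof -
        have "(\<lambda>w. case_prod k (snd (snd w), fst w b)) \<in> borel_measurable (?Q \<Otimes>\<^sub>M MM)"
          by (rule measurable_compose[OF measurable_Pair[OF _ t[OF that]] k]) measurable
        then show ?thesis unfolding d_def by simp
      qed
      have "(\<lambda>w. ennreal (((\<Sum>b<m. R (fst (snd w), fst w b) * d (fst w) (snd (snd w)) b) - R (snd w))\<^sup>2))
          \<in> borel_measurable (?Q \<Otimes>\<^sub>M MM)"
        by (intro measurable_compose[OF _ measurable_ennreal] borel_measurable_power borel_measurable_diff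
            borel_measurable_sum borel_measurable_times Rt kt measurable_compose[OF measurable_snd R_meas]) simp_all
      from borel_measurable_nn_integral_fst[OF this] show ?thesis by (simp add: err_def[abs_def])
    qed
    have "(\<integral>\<^sup>+t. err t \<partial>?Q) \<le> ennreal (\<delta> / 8 * \<eta>) + ennreal (V / real m)"
    proof -
      have "(\<integral>\<^sup>+t. err t \<partial>?Q) \<le> (\<integral>\<^sup>+z. ennreal (((\<integral>q'. k (snd z) q' * R (fst z, q') \<partial>M2) - R z)\<^sup>2) \<partial>MM) + ennreal (V / real m)"
        unfolding err_def eq V_def by (rule sampled_kernel_error[OF R k C m0])
      also have "\<dots> \<le> ennreal (\<delta> / 8 * \<eta>) + ennreal (V / real m)" by (intro add_right_mono bias)
      finally show ?thesis .
    qed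
    also have "V / real m \<le> \<delta> / 8 * \<eta>"
    proof -
      have "V / (\<delta> / 8 * \<eta>) < real m" using m1 m by linarith
      then show ?thesis using \<eta>\<delta> m0 by (simp add: pos_divide_less_eq pos_divide_le_eq mult.commute)
    qed
    then have "ennreal (\<delta> / 8 * \<eta>) + ennreal (V / real m) \<le> ennreal (\<delta> / 8 * \<eta>) + ennreal (\<delta> / 8 * \<eta>)"
      by (intro add_left_mono ennreal_leI)
    also have "\<dots> = ennreal (\<delta> / 4 * \<eta>)"
      using \<eta>\<delta> by (subst ennreal_plus[symmetric]) auto
    finally have err_prob: "1 - \<delta> / 4 \<le> Q.prob {t \<in> space ?Q. err t \<le> ennreal \<eta>}"
      using pos \<delta> by (intro Q.prob_le_of_nn_integral_le err_meas) auto
    \<comment> \<open>Integrability of R^4 over the product gives it only for almost every query.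
      Sampled queries avoid \<open>Z\<close> almost surely, so the restriction does not lower the
      probability of \<open>T\<close>.\<close>
    obtain Z where Z: "Z \<in> null_sets M2" "\<And>y. y \<in> space M2 - Z \<Longrightarrow> integrable M1 (\<lambda>x. R (x, y) ^ 4)"
      using AE_E3[OF g4_AE] by blast
    define T where "T = {t \<in> space ?Q. err t \<le> ennreal \<eta>} \<inter> {t \<in> space ?Q. \<forall>b\<in>{..<m}. t b \<notin> Z}"
    have Zt: "{t \<in> space ?Q. t b \<notin> Z} \<in> sets ?Q" if "b \<in> {..<m}" for b
    proof -
      have "Z \<in> sets M2" using Z(1) by (rule null_setsD2)
      then show ?thesis using that by measurable
    qed
    have T_sets: "{t \<in> space ?Q. err t \<le> ennreal \<eta>} \<in> sets ?Q" "T \<in> sets ?Q"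
      unfolding T_def using err_meas Zt by (auto intro!: sets.Int sets.sets_Collect_finite_All)
    have "AE t in ?Q. \<forall>b\<in>{..<m}. t b \<notin> Z"
      using AE_not_in[OF Z(1)] by (intro AE_finite_allI AE_PiM_component M2.prob_space_axioms) auto
    then have "Q.prob T = Q.prob {t \<in> space ?Q. err t \<le> ennreal \<eta>}"
      using T_sets by (intro Q.finite_measure_eq_AE) (auto simp: T_def elim!: eventually_mono)
    then have T_prob: "1 - \<delta> / 2 < Q.prob T" using err_prob \<delta> by linarith
    define bad where "bad N l \<longleftrightarrow> (0 < l \<and> l < 1) \<and>
      measure (support_sample M1 M2 N m) (CUR_close_event M1 M2 R l N m \<epsilon>) < 1 - \<delta>" for N l
    \<comment> \<open>A counterexample l is chosen for each N that has one, with 1/2 as an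
      admissible default. For fixed queries the threshold is uniform in l, so it covers this
      sequence; refuting \<open>bad N (L N)\<close> then excludes every bad l at that N.\<close>
    define L where "L N = (if \<exists>l. bad N l then SOME l. bad N l else 1 / 2)" for N
    have bad_L: "bad N (L N)" if "bad N l" for N l
      using that unfolding L_def by (auto intro: someI)
    have L: "0 < L N \<and> L N < 1" for N
    proof (cases "\<exists>l. bad N l")
      case True
      then show ?thesis using bad_L by (auto simp: bad_def)
    qed (simp add: L_def)
    define E where "E N = CUR_close_event M1 M2 R (L N) N m \<epsilon>" for N
    have pair: "pair_prob_space (\<Pi>\<^sub>M a\<in>{..<N}. M1) ?Q" for N
      by (intro pair_prob_space.intro pair_sigma_finite.intro prob_space_imp_sigma_finite prob_space_PiM
          M1.prob_space_axioms M2.prob_space_axioms)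
    have E_sets: "E N \<in> sets ((\<Pi>\<^sub>M a\<in>{..<N}. M1) \<Otimes>\<^sub>M ?Q)" for N
      using CUR_close_event_sets[OF R_meas conjunct1[OF L]] by (simp add: E_def support_sample_def)
    define p where "p N t = measure (\<Pi>\<^sub>M a\<in>{..<N}. M1) ((\<lambda>s. (s, t)) -` E N)" for N t
    have p_meas: "p N \<in> borel_measurable ?Q" for N
      using pair_prob_space.prob_pair_ge_of_sections(2)[OF pair E_sets order_refl] by (simp add: p_def[abs_def])
    have ev: "\<exists>n. \<forall>N\<ge>n. 1 - \<delta> / 4 \<le> p N t" if t: "t \<in> T" for t
    proof -
      have t_space: "t \<in> space ?Q" and t_err: "err t \<le> ennreal \<eta>" using t by (auto simp: T_def)
      have tb: "t b \<in> space M2" if "b < m" for b using t_space that by (auto simp: space_PiM PiE_def)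
      have t4: "integrable M1 (\<lambda>x. R (x, t b) ^ 4)" if "b < m" for b
        using t tb[OF that] that by (intro Z(2)) (auto simp: T_def)
      have d_meas: "(\<lambda>y. d t y b) \<in> borel_measurable M2" if "b < m" for b
        using measurable_Pair1[OF k tb[OF that]] unfolding d_def by simp
      have d_bound: "\<bar>d t y b\<bar> \<le> C / real m" for y b
        using C[of y "t b"] by (simp add: d_def divide_right_mono)
      have \<eta>\<kappa>: "\<eta> \<le> \<delta>' * \<kappa>" by (simp add: \<eta>_def)
      have \<rho>: "0 < \<epsilon>\<^sup>2 / 8" using \<epsilon> by simp
      obtain n where n: "\<And>N l. n \<le> N \<Longrightarrow> 0 < l \<and> l < 1 \<Longrightarrow> \<exists>A\<in>sets (\<Pi>\<^sub>M a\<in>{..<N}. M1).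
          1 - 2 * \<delta>' \<le> measure (\<Pi>\<^sub>M a\<in>{..<N}. M1) A \<and> (\<forall>s\<in>A. CUR_reg l R N m s t \<in> L2_functions MM \<and>
          (\<integral>z. (CUR_reg l R N m s t z - R z)\<^sup>2 \<partial>MM) \<le> 16 * \<kappa> + \<epsilon>\<^sup>2 / 8 + 2 * \<eta>)"
        using CUR_reg_close_for_fixed_queries[OF R tb t4 d_meas d_bound less_imp_le[OF pos(3)] t_err[unfolded err_def]
            pos(1,2) \<eta>\<kappa> \<rho>] by blast
      have "1 - \<delta> / 4 \<le> p N t" if N: "n \<le> N" for N
      proof -
        let ?P = "\<Pi>\<^sub>M a\<in>{..<N}. M1"
        interpret S: prob_space ?P by (intro prob_space_PiM M1.prob_space_axioms)
        obtain A where A: "A \<in> sets ?P" "1 - 2 * \<delta>' \<le> S.prob A"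
          and close: "\<And>s. s \<in> A \<Longrightarrow> CUR_reg (L N) R N m s t \<in> L2_functions MM"
            "\<And>s. s \<in> A \<Longrightarrow> (\<integral>z. (CUR_reg (L N) R N m s t z - R z)\<^sup>2 \<partial>MM) \<le> 16 * \<kappa> + \<epsilon>\<^sup>2 / 8 + 2 * \<eta>"
          using n[OF N L] by blast
        have "A \<subseteq> (\<lambda>s. (s, t)) -` E N"
        proof
          fix s assume s: "s \<in> A"
          have "16 * \<kappa> + \<epsilon>\<^sup>2 / 8 + 2 * \<eta> < \<epsilon>\<^sup>2" 
          proof -
            have "\<eta> \<le> \<epsilon>\<^sup>2 / 16" by (simp add: \<eta>_def)
            then show ?thesis using \<rho> unfolding \<kappa>_def by linarith
          qed
          with close(2)[OF s] have "L2_dist MM (CUR_reg (L N) R N m s t) R < \<epsilon>"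
            unfolding L2_dist_def using \<epsilon> by (intro real_less_lsqrt) auto
          moreover have "s \<in> space ?P" using s sets.sets_into_space[OF A(1)] by blast
          ultimately show "s \<in> (\<lambda>s. (s, t)) -` E N"
            using close(1)[OF s] t_space by (simp add: E_def CUR_close_event_def support_sample_def space_pair_measure)
        qed
        then have "S.prob A \<le> p N t"
          unfolding p_def by (rule S.finite_measure_mono) (rule sets_Pair2[OF E_sets])
        then show ?thesis using A(2) by (simp add: \<delta>'_def)
      qed
      then show ?thesis by blast
    qed
    obtain n where n: "\<And>N. n \<le> N \<Longrightarrow> 1 - \<delta> / 2 < Q.prob {t \<in> space ?Q. 1 - \<delta> / 4 \<le> p N t}"
      using Q.prob_eventually_ge[OF p_meas T_sets(2) ev T_prob] by blast
    have "1 - \<delta> \<le> measure (support_sample M1 M2 N m) (CUR_close_event M1 M2 R l N m \<epsilon>)"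
      if N: "n \<le> N" and l: "0 < l \<and> l < 1" for N l
    proof (rule ccontr)
      assume "\<not> ?thesis"
      then have "bad N l" using l by (simp add: bad_def)
      then have "measure (support_sample M1 M2 N m) (E N) < 1 - \<delta>"
        using bad_L by (auto simp: bad_def E_def)
      moreover have "(1 - \<delta> / 4) * Q.prob {t \<in> space ?Q. 1 - \<delta> / 4 \<le> p N t} \<le> measure (support_sample M1 M2 N m) (E N)"
        using pair_prob_space.prob_pair_ge_of_sections(1)[OF pair E_sets, of "1 - \<delta> / 4" N] \<delta>
        by (simp add: p_def support_sample_def)
      moreover have "(1 - \<delta> / 4) * (1 - \<delta> / 2) \<le> (1 - \<delta> / 4) * Q.prob {t \<in> space ?Q. 1 - \<delta> / 4 \<le> p N t}"
        using n[OF N] \<delta> by (intro mult_left_mono) auto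
      \<comment> \<open>The product is 1 - 3 \<delta>/4 + \<delta>^2/8. The loss \<delta>/2 instead
        of \<delta>/4 on the query side comes from the passage to a common threshold.\<close>
      moreover have "1 - \<delta> \<le> (1 - \<delta> / 4) * (1 - \<delta> / 2)" using \<delta> by (simp add: field_simps)
      ultimately show False by linarith
    qed
    then show "\<exists>N0. \<forall>N\<ge>N0. \<forall>l. 0 < l \<and> l < 1 \<longrightarrow>
        1 - \<delta> \<le> measure (support_sample M1 M2 N m) (CUR_close_event M1 M2 R l N m \<epsilon>)"
      by blast
  qed
qed

section \<open>Exchange of items and queries, and conclusion\<close>

text \<open>Swapping the coordinates preserves product measures, both for the supports and for the
  point of evaluation. Under the first swap one event is the preimage of the other; under the
  second, membership in L2 and the distance are unchanged.\<close>

lemma (in pair_prob_space) CUR_close_event_swap: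
  fixes R :: "'a \<times> 'b \<Rightarrow> real"
  assumes R: "R \<in> borel_measurable MM" and l: "0 < l"
  shows "measure (support_sample M2 M1 m N) (CUR_close_event M2 M1 (R \<circ> prod.swap) l m N \<epsilon>)
    = measure (support_sample M1 M2 N m) (CUR_close_event M1 M2 R l N m \<epsilon>)"
proof -
  interpret Q: pair_prob_space M2 M1 ..
  let ?PN = "\<Pi>\<^sub>M a\<in>{..<N}. M1" and ?Pm = "\<Pi>\<^sub>M b\<in>{..<m}. M2"
  interpret SP: pair_prob_space ?PN ?Pm
    by (intro pair_prob_space.intro pair_sigma_finite.intro prob_space_imp_sigma_finite prob_space_PiM
        M1.prob_space_axioms M2.prob_space_axioms)
  let ?E = "CUR_close_event M1 M2 R l N m \<epsilon>" and ?E' = "CUR_close_event M2 M1 (R \<circ> prod.swap) l m N \<epsilon>"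
  have E: "?E \<in> sets (?PN \<Otimes>\<^sub>M ?Pm)"
    using CUR_close_event_sets[OF R l] by (simp add: support_sample_def)
  have CUR: "CUR_reg l (R \<circ> prod.swap) m N t s = (\<lambda>(y, x). CUR_reg l R N m s t (x, y))" for s t
    using CUR_reg_swap[OF l, of R N m s t] by (auto simp: fun_eq_iff)
  have L2: "(\<lambda>(y, x). f (x, y)) \<in> L2_functions (M2 \<Otimes>\<^sub>M M1) \<longleftrightarrow> f \<in> L2_functions MM" for f :: "'a \<times> 'b \<Rightarrow> real"
  proof
    assume f: "f \<in> L2_functions MM"
    show "(\<lambda>(y, x). f (x, y)) \<in> L2_functions (M2 \<Otimes>\<^sub>M M1)"
      using measurable_pair_swap[OF L2_functionsD(1)[OF f]] integrable_product_swap[OF L2_functionsD(2)[OF f]]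
      by (simp add: L2_functions_def case_prod_unfold)
  next
    assume f: "(\<lambda>(y, x). f (x, y)) \<in> L2_functions (M2 \<Otimes>\<^sub>M M1)"
    show "f \<in> L2_functions MM"
      using measurable_pair_swap[OF L2_functionsD(1)[OF f]] Q.integrable_product_swap[OF L2_functionsD(2)[OF f]]
      by (simp add: L2_functions_def case_prod_unfold)
  qed
  have dist: "L2_dist (M2 \<Otimes>\<^sub>M M1) (\<lambda>(y, x). f (x, y)) (R \<circ> prod.swap) = L2_dist MM f R"
    if f: "f \<in> borel_measurable MM" for f :: "'a \<times> 'b \<Rightarrow> real"
  proof -
    have "(\<lambda>z. (f z - R z)\<^sup>2) \<in> borel_measurable MM" using f R by measurable
    from integral_product_swap[OF this] show ?thesis
      by (simp add: L2_dist_def case_prod_unfold prod.swap_def o_def)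
  qed
  have "(\<lambda>(t, s). (s, t)) -` ?E \<inter> space (?Pm \<Otimes>\<^sub>M ?PN) = ?E'"
    unfolding CUR_close_event_def support_sample_def CUR L2
    using dist by (auto simp: space_pair_measure dest: L2_functionsD(1))
  then show ?thesis
    using measure_distr[OF measurable_pair_swap', of ?E ?PN ?Pm] E SP.distr_pair_swap
    by (simp add: support_sample_def)
qed

text \<open>Here "enough" support items and queries means that either kind may be taken large first
  and the other large depending on it; both orders are asserted. As \<open>l0\<close> precedes all
  thresholds, one range of l serves every size of the supports.\<close>

theorem theorem3p1:
  fixes TI :: "'i topology" and TQ :: "'q topology"
    and MI :: "'i measure" and MQ :: "'q measure"
    and R :: "'i \<times> 'q \<Rightarrow> real"
    and \<epsilon> \<delta> :: real
  assumes "compact_space TI" and "compact_space TQ"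
    and "space MI = topspace TI" and "space MQ = topspace TQ"
    and "prob_space MI" and "prob_space MQ"
    and "R \<in> borel_measurable (MI \<Otimes>\<^sub>M MQ)"
    and "integrable (MI \<Otimes>\<^sub>M MQ) (\<lambda>x. R x ^ 4)"
    and "\<epsilon> > 0" and "\<delta> > 0"
  shows "\<exists>l0>0.
      (\<exists>m0. \<forall>m\<ge>m0. \<exists>N0. \<forall>N\<ge>N0. \<forall>l. 0 < l \<and> l < l0 \<longrightarrow>
         measure (support_sample MI MQ N m) (CUR_close_event MI MQ R l N m \<epsilon>) \<ge> 1 - \<delta>) \<and>
      (\<exists>N0. \<forall>N\<ge>N0. \<exists>m0. \<forall>m\<ge>m0. \<forall>l. 0 < l \<and> l < l0 \<longrightarrow>
         measure (support_sample MI MQ N m) (CUR_close_event MI MQ R l N m \<epsilon>) \<ge> 1 - \<delta>)"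
proof -
  interpret MI: prob_space MI by fact
  interpret MQ: prob_space MQ by fact
  interpret IQ: pair_prob_space MI MQ ..
  interpret QI: pair_prob_space MQ MI ..
  \<comment> \<open>Truncation at 1 keeps the factor 1 - \<delta>/4 of the product estimate
    nonnegative and only strengthens the claim.\<close>
  define \<delta>' where "\<delta>' = min \<delta> 1"
  have \<delta>': "0 < \<delta>'" "\<delta>' \<le> 1" "1 - \<delta> \<le> 1 - \<delta>'" using \<open>\<delta> > 0\<close> by (simp_all add: \<delta>'_def)
  note R = \<open>R \<in> borel_measurable (MI \<Otimes>\<^sub>M MQ)\<close> and R4 = \<open>integrable (MI \<Otimes>\<^sub>M MQ) (\<lambda>x. R x ^ 4)\<close>
  have R': "R \<circ> prod.swap \<in> borel_measurable (MQ \<Otimes>\<^sub>M MI)"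
    using measurable_pair_swap[OF R] by (simp add: o_def prod.swap_def case_prod_unfold)
  have R4': "integrable (MQ \<Otimes>\<^sub>M MI) (\<lambda>x. (R \<circ> prod.swap) x ^ 4)"
    using IQ.integrable_product_swap[OF R4] by (simp add: o_def prod.swap_def case_prod_unfold)
  have "\<exists>m0. \<forall>m\<ge>m0. \<exists>N0. \<forall>N\<ge>N0. \<forall>l. 0 < l \<and> l < 1 \<longrightarrow>
      measure (support_sample MI MQ N m) (CUR_close_event MI MQ R l N m \<epsilon>) \<ge> 1 - \<delta>"
    using IQ.CUR_close_event_eventually[OF R R4 \<open>\<epsilon> > 0\<close> \<delta>'(1,2)] \<delta>'(3) by (meson order_trans)
  moreover have "\<exists>N0. \<forall>N\<ge>N0. \<exists>m0. \<forall>m\<ge>m0. \<forall>l. 0 < l \<and> l < 1 \<longrightarrow>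
      measure (support_sample MI MQ N m) (CUR_close_event MI MQ R l N m \<epsilon>) \<ge> 1 - \<delta>"
  proof -
    obtain N0 where N0: "\<And>N. N0 \<le> N \<Longrightarrow> \<exists>m0. \<forall>m\<ge>m0. \<forall>l. 0 < l \<and> l < 1 \<longrightarrow>
        1 - \<delta>' \<le> measure (support_sample MQ MI m N) (CUR_close_event MQ MI (R \<circ> prod.swap) l m N \<epsilon>)"
      using QI.CUR_close_event_eventually[OF R' R4' \<open>\<epsilon> > 0\<close> \<delta>'(1,2)] by blast
    show ?thesis
    proof (rule exI[of _ N0], rule allI, rule impI)
      fix N assume "N0 \<le> N"
      from N0[OF this] obtain m0 where m0: "\<And>m l. m0 \<le> m \<Longrightarrow> 0 < l \<and> l < 1 \<Longrightarrow>
        1 - \<delta>' \<le> measure (support_sample MQ MI m N) (CUR_close_event MQ MI (R \<circ> prod.swap) l m N \<epsilon>)"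
        by blast
      show "\<exists>m0. \<forall>m\<ge>m0. \<forall>l. 0 < l \<and> l < 1 \<longrightarrow>
          measure (support_sample MI MQ N m) (CUR_close_event MI MQ R l N m \<epsilon>) \<ge> 1 - \<delta>"
      proof (rule exI[of _ m0], intro allI impI)
        fix m and l :: real assume "m0 \<le> m" and l: "0 < l \<and> l < 1"
        from m0[OF this] \<delta>'(3)
        show "measure (support_sample MI MQ N m) (CUR_close_event MI MQ R l N m \<epsilon>) \<ge> 1 - \<delta>"
          unfolding IQ.CUR_close_event_swap[OF R conjunct1[OF l]] by linarith
      qed
    qed
  qed
  \<comment> \<open>Both halves hold for every l below 1, so the range of l depends on neither
    \<epsilon> nor \<delta>.\<close>
  ultimately show ?thesis by (intro exI[of _ 1]) simp
qed

end
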